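(* In the setting described in the context, suppose $c_tH^2\le\Delta t\le C_tH^2$ for constants $0<c_t\le C_t$, and that $\eta_0$ and $\kappa_0$ are uniformly bounded. Let $\widehat V_{H}^{(m)}$ be the computed coarse space and $\widehat V_{H,1}^{(m)}$ its high-permeability part, and let $T_m:V_{H,1}\to\widehat V_{H,1}^{(m)}$ be the restriction to $V_{H,1}$ of the orthogonal projection of $V_{h,0}$ onto $\widehat V_{H,1}^{(m)}$ in the inner product inducing $|||\cdot|||$. Assume that $V_H$ and $\widehat V_H^{(m)}$ have the same dimension and that there is a number $\varepsilon_m$ with $0\le\varepsilon_m\le\varepsilon_*<1$, where $\varepsilon_*$ is independent of $h$, $H$ and the coefficient contrast, such that $$|||v_0-T_mv_0|||\le\varepsilon_m\|v_0\|_{\widetilde a}\qquad\text{for all }v_0\in V_{H,1}.$$ Let $\widehat R_0$ be the restriction matrix associated with $\widehat V_{H,1}^{(m)}$ and $\widehat{\widetilde A}_0:=\widehat R_0\widetilde A\widehat R_0^T$. Then the two-level additive Schwarz preconditioner formed with the computed coarse space satisfies $$\operatorname{cond}\Big(\big(\widehat R_0^T\widehat{\widetilde A}_0^{-1}\widehat R_0+\sum_{i=1}^NR_i^T\widetilde A_i^{-1}R_i\big)\widetilde A\Big)\le C(\varepsilon_* )=O(1),$$ where $C(\varepsilon_* )$ is independent of $h$, $H$ and the coefficient contrast $\eta=\kappa_{\max}/\kappa_{\min}$.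
   Context: **Domain and meshes.** $\Omega\subset\mathbb R^d$ ($d=2,3$) is a bounded domain; $\kappa\in L^\infty(\Omega)$ satisfies $0<\kappa_{\min}\le\kappa\le\kappa_{\max}$, with contrast $\eta=\kappa_{\max}/\kappa_{\min}$. $\mathcal T^h$ is a fine partition with mesh size $h$, $V_h=P_1(\mathcal T^h)$ is the space of continuous piecewise linear functions, and $V_{h,0}=\{v\in V_h: v=0\text{ on }\partial\Omega\}$. $\mathcal T^H$ is a coarse partition of $\Omega$ with mesh size $H$ and elements $K_1,\dots,K_N$. **Forms.** $a(u,v)=\int_\Omega\kappa\nabla u\cdot\nabla v\,dx$, $s(u,v)=H^{-2}\int_\Omega\kappa uv\,dx$, $\|u\|_a^2=a(u,u)$, $\|u\|_s^2=s(u,u)$; $\|\cdot\|_{a(K)},\|\cdot\|_{s(K)}$ are the same with integrals restricted to $K$. For a time step $\Delta t>0$, $\|v\|_{\widetilde a}^2=\Delta t\,a(v,v)+\|v\|_{L^2(\Omega)}^2$ and $|||v|||^2=\|v\|_{\widetilde a}^2+\Delta t\,\|v\|_s^2$. **Auxiliary space.** In each coarse element $K$ there are pairwise disjoint connected open Lipschitz subdomains $K_h^i\subset K$ (high-permeability components), and $K_l=K\setminus\bigcup_iK_h^i$. There are constants $\eta_0,\kappa_0$ with $\max_{K_h^i}\kappa/\min_{K_h^i}\kappa\le\eta_0$, $\min_{K_h^i}\kappa\ge\kappa_0$, $\max_{K_l}\kappa<\kappa_0$, and a constant $C$ independent of $H$ and $K$ with $\int_{K_h^i}|u|^2\le CH^2\int_{K_h^i}|\nabla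 u|^2$ whenever $\int_{K_h^i}u=0$. $V_{\mathrm{aux},1}$ is the span of the characteristic functions of all $K_h^i$ (over all $K$), $V_{\mathrm{aux},2}$ the span of the characteristic functions of all $K_l$, $V_{\mathrm{aux}}=V_{\mathrm{aux},1}+V_{\mathrm{aux},2}$, and $\pi$ is the $s$-orthogonal projection onto $V_{\mathrm{aux}}$; $\pi_K$ denotes $\pi$ on the element $K$. It is assumed that $\|(I-\pi_K)u\|_{s(K)}^2\le C_\pi\|u\|_{a(K)}^2$ for all $u\in H^1(K)$ and all $K$, with $C_\pi$ independent of $H$ and of the contrast. **Coarse space.** For $\psi\in V_{\mathrm{aux}}$ let $\phi_\psi\in V_{h,0}$ solve $a(\phi_\psi,v)+s(\pi\phi_\psi,\pi v)=s(\psi,\pi v)$ for all $v\in V_{h,0}$. Then $V_{H,j}=\{\phi_\psi:\psi\in V_{\mathrm{aux},j}\}$, $j=1,2$, and $V_H=V_{H,1}+V_{H,2}$. **Computed coarse space.** For each characteristic function $\psi$ in the bases of $V_{\mathrm{aux},1}$ and $V_{\mathrm{aux},2}$, $\widehat\phi_\psi^{(m)}\in V_{h,0}$ is the function obtained after $m$ iterations of an iterative solver (preconditioned conjugate gradients) for the linear problem $a(\phi_\psi,v)+s(\pi\phi_\psi,\pi v)=s(\psi,\pi v)$ for all $v\in V_{h,0}$, whose exact solution is $\phi_\psi\in V_{h,0}$. $\widehat V_H^{(m)}$ is the span of all $\widehat\phi^{(m)}_\psi$, and $\widehat V_{H,1}^{(m)}$ the span of those with $\psi\in V_{\mathrm{aux},1}$.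 (Only the hypotheses stated in the claim are required of these functions.) **Overlapping subdomains.** $\omega_i$ is obtained by extending $K_i$ by layers of fine elements; $\Omega=\bigcup_i\omega_i$, and each point of $\Omega$ lies in at most a fixed number of the $\omega_i$, independent of $h,H,\eta$. $V_i=V_{h,0}(\omega_i)$ ($i\ge1$) is the space of fine finite element functions on $\omega_i$ vanishing on $\partial\omega_i$. There is a partition of unity $\{\chi_i\}\subset V_h$ with $\chi_i$ supported in $\omega_i$, $\sum_i\chi_i=1$, $\sum_i\chi_i^2\le1$, $|\nabla\chi_i|\le CH^{-1}$. The fine nodal interpolant $I_h$ satisfies $\|I_hv\|_a\le C_I\|v\|_a$ and $\|I_hv\|_s\le C_I\|v\|_s$ for all continuous $v$ that are piecewise quadratic on $\mathcal T^h$, with $C_I$ independent of $h,H,\eta$. **Matrices.** $A$ and $M$ are the fine-grid stiffness matrix (of $a$) and mass matrix (of the $L^2(\Omega)$ inner product) on $V_{h,0}$; $\widetilde A=\Delta t\,A+M$. For $i\ge1$, $R_i^T:V_i\to V_{h,0}$ is the matrix of extension by zero, $A_i=R_iAR_i^T$, $M_i=R_iMR_i^T$, and $\widetilde A_i=\Delta t\,A_i+M_i=R_i\widetilde AR_i^T$. $\widehat R_0^T$ is the matrix of the inclusion $\widehat V_{H,1}^{(m)}\subset V_{h,0}$ in terms of a basis of $\widehat V_{H,1}^{(m)}$. The condition number is the ratio of the largest to the smallest eigenvalue.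
   Formalization: The constant C may depend on the lower bound κ_min of the coefficient (κ_max, hence the contrast, is arbitrary); with κ_min tending to 0 the bound fails, e.g. for a thin high-permeability strip in a background of vanishing permeability. *)

theory Defs
  imports
    "HOL-Analysis.Analysis"
    "HOL-Probability.Essential_Supremum"
    "HOL-Library.Function_Algebras"
    "Jordan_Normal_Form.Gauss_Jordan_Elimination"
    "Jordan_Normal_Form.Spectral_Radius"
begin

section \<open>Function spaces\<close>

text \<open>Real functions form a real vector space under the pointwise operations; \<open>fspace.span\<close>,
  \<open>fspace.independent\<close>, \<open>fspace.dim\<close> and \<open>fspace.representation\<close> are the library notions there.\<close>

global_interpretation fspace: vector_space "\<lambda>(c::real) (f::'a \<Rightarrow> real) x. c * f x"
  by unfold_locales (auto simp: fun_eq_iff algebra_simps)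

definition basis_list :: "('a \<Rightarrow> real) list \<Rightarrow> ('a \<Rightarrow> real) set \<Rightarrow> bool" where
  "basis_list bs V \<longleftrightarrow> distinct bs \<and> fspace.independent (set bs) \<and> fspace.span (set bs) = V"

text \<open>The element chosen by \<open>SOME\<close> is unique if the form \<open>b\<close> is definite on \<open>W\<close>. If \<open>b\<close> is only
  semidefinite (the form \<open>s\<close> on functions that are equal almost everywhere), it is unique up to a
  \<open>b\<close>-null function, which no form evaluated below can see.\<close>

definition orth_proj ::
  "(('a \<Rightarrow> real) \<Rightarrow> ('a \<Rightarrow> real) \<Rightarrow> real) \<Rightarrow> ('a \<Rightarrow> real) set \<Rightarrow> ('a \<Rightarrow> real) \<Rightarrow> ('a \<Rightarrow> real)" where
  "orth_proj b W u = (SOME p. p \<in> W \<and> (\<forall>w\<in>W. b (u - p) w = 0))"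

definition form_norm ::
  "(('a \<Rightarrow> real) \<Rightarrow> ('a \<Rightarrow> real) \<Rightarrow> real) \<Rightarrow> ('a \<Rightarrow> real) \<Rightarrow> real" where
  "form_norm b u = sqrt (b u u)"

definition sq_integrable ::
  "'a::euclidean_space set \<Rightarrow> ('a \<Rightarrow> 'b::euclidean_space) \<Rightarrow> bool" where
  "sq_integrable U f \<longleftrightarrow>
     f \<in> borel_measurable (lebesgue_on U) \<and> integrable (lebesgue_on U) (\<lambda>x. (norm (f x))\<^sup>2)"

text \<open>The pointwise gradient. Finite element functions have it off the element boundaries, that is,
  almost everywhere; the value elsewhere is irrelevant under the integrals.\<close>

definition grad :: "('a::euclidean_space \<Rightarrow> real) \<Rightarrow> 'a \<Rightarrow> 'a" where
  "grad u x = (THE g. GDERIV u x :> g)"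

text \<open>Test functions: smooth with compact support in \<open>U\<close>. Here \<open>D [v\<^sub>k, \<dots>, v\<^sub>1]\<close> is the iterated
  directional derivative, and all of these are required to be Frechet differentiable.\<close>

definition test_functions :: "'a::euclidean_space set \<Rightarrow> ('a \<Rightarrow> real) set" where
  "test_functions U =
     {\<phi>. (\<exists>D :: 'a list \<Rightarrow> 'a \<Rightarrow> real.
            D [] = \<phi> \<and> (\<forall>vs x. (D vs has_derivative (\<lambda>v. D (v # vs) x)) (at x))) \<and>
         compact (closure {x. \<phi> x \<noteq> 0}) \<and> closure {x. \<phi> x \<noteq> 0} \<subseteq> U}"

text \<open>\<open>H1_with_gradient U u g\<close>: \<open>u\<close> belongs to \<open>H\<^sup>1(U)\<close> and \<open>g\<close> is its weak gradient.\<close>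

definition H1_with_gradient ::
  "'a::euclidean_space set \<Rightarrow> ('a \<Rightarrow> real) \<Rightarrow> ('a \<Rightarrow> 'a) \<Rightarrow> bool" where
  "H1_with_gradient U u g \<longleftrightarrow>
     sq_integrable U u \<and> sq_integrable U g \<and>
     (\<forall>\<phi>\<in>test_functions U. \<forall>b\<in>Basis.
        (LINT x|lebesgue_on U. u x * inner (grad \<phi> x) b)
          = - (LINT x|lebesgue_on U. inner (g x) b * \<phi> x))"

text \<open>Near each boundary point, \<open>U\<close> is the set above the graph of a Lipschitz function of the
  coordinates orthogonal to some unit vector \<open>e\<close>.\<close>

definition lipschitz_domain :: "'a::euclidean_space set \<Rightarrow> bool" where
  "lipschitz_domain U \<longleftrightarrow>
     (\<forall>x\<in>frontier U. \<exists>r>0. \<exists>e L. \<exists>\<gamma> :: 'a \<Rightarrow> real. norm e = 1 \<and> L-lipschitz_on UNIV \<gamma> \<and>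
        U \<inter> ball x r = {y \<in> ball x r. \<gamma> (y - inner y e *\<^sub>R e) < inner y e})"


section \<open>Meshes and finite element spaces\<close>

definition mesh_size :: "'a::euclidean_space set set \<Rightarrow> real" where
  "mesh_size \<T> = Max (diameter ` \<T>)"

text \<open>A conforming simplicial mesh with closed simplices. The condition on the interior says that
  the simplices cover the closure of \<open>\<Omega>\<close> and that \<open>\<Omega>\<close> has no slits.\<close>

definition fine_mesh :: "'a::euclidean_space set \<Rightarrow> 'a set set \<Rightarrow> bool" where
  "fine_mesh \<Omega> \<T> \<longleftrightarrow>
     triangulation \<T> \<and> (\<forall>T\<in>\<T>. int DIM('a) simplex T) \<and> interior (\<Union>\<T>) = \<Omega>"

definition vertices :: "'a::euclidean_space set set \<Rightarrow> 'a set" where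
  "vertices \<T> = {p. \<exists>T\<in>\<T>. p extreme_point_of T}"

text \<open>Closed coarse elements \<open>K 0, \<dots>, K (N - 1)\<close>, each a union of fine elements.\<close>

definition coarse_mesh :: "'a::euclidean_space set set \<Rightarrow> nat \<Rightarrow> (nat \<Rightarrow> 'a set) \<Rightarrow> bool" where
  "coarse_mesh \<T> N K \<longleftrightarrow>
     (\<forall>i<N. K i \<noteq> {} \<and> K i = \<Union>{T\<in>\<T>. T \<subseteq> K i}) \<and>
     (\<forall>i<N. \<forall>j<N. i \<noteq> j \<longrightarrow> interior (K i) \<inter> interior (K j) = {}) \<and>
     (\<Union>i<N. K i) = \<Union>\<T>"

text \<open>Functions on the closure of \<open>\<Omega>\<close> are represented by their extension by zero, so that equality
  of finite element functions is equality of HOL functions.\<close>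

definition Vh :: "'a::euclidean_space set set \<Rightarrow> ('a \<Rightarrow> real) set" where
  "Vh \<T> = {v. continuous_on (\<Union>\<T>) v \<and> (\<forall>x. x \<notin> \<Union>\<T> \<longrightarrow> v x = 0) \<and>
              (\<forall>T\<in>\<T>. \<exists>b c. \<forall>x\<in>T. v x = inner b x + c)}"

definition Vh0 :: "'a::euclidean_space set \<Rightarrow> 'a set set \<Rightarrow> ('a \<Rightarrow> real) set" where
  "Vh0 \<Omega> \<T> = {v \<in> Vh \<T>. \<forall>x\<in>frontier \<Omega>. v x = 0}"

text \<open>Finite element functions on \<open>\<omega>\<close> vanishing on its boundary, extended by zero.\<close>

definition Vh0_local ::
  "'a::euclidean_space set \<Rightarrow> 'a set set \<Rightarrow> 'a set \<Rightarrow> ('a \<Rightarrow> real) set" where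
  "Vh0_local \<Omega> \<T> \<omega> = {v \<in> Vh0 \<Omega> \<T>. \<forall>x. x \<notin> \<omega> \<longrightarrow> v x = 0}"

definition nodal_interp :: "'a::euclidean_space set set \<Rightarrow> ('a \<Rightarrow> real) \<Rightarrow> ('a \<Rightarrow> real)" where
  "nodal_interp \<T> v = (THE w. w \<in> Vh \<T> \<and> (\<forall>p\<in>vertices \<T>. w p = v p))"

definition piecewise_quadratic :: "'a::euclidean_space set set \<Rightarrow> ('a \<Rightarrow> real) \<Rightarrow> bool" where
  "piecewise_quadratic \<T> v \<longleftrightarrow> continuous_on (\<Union>\<T>) v \<and>
     (\<forall>T\<in>\<T>. \<exists>Q b c. linear Q \<and> (\<forall>x\<in>T. v x = inner (Q x) x + inner b x + c))"

primrec add_layers :: "'a set set \<Rightarrow> nat \<Rightarrow> 'a set \<Rightarrow> 'a set" where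
  "add_layers \<T> 0 S = S"
| "add_layers \<T> (Suc k) S = \<Union>{T\<in>\<T>. T \<inter> add_layers \<T> k S \<noteq> {}}"

definition subdomain :: "'a::euclidean_space set set \<Rightarrow> nat \<Rightarrow> 'a set \<Rightarrow> 'a set" where
  "subdomain \<T> l K = interior (add_layers \<T> l K)"


section \<open>Forms\<close>

definition a_form ::
  "'a::euclidean_space set \<Rightarrow> ('a \<Rightarrow> real) \<Rightarrow> ('a \<Rightarrow> real) \<Rightarrow> ('a \<Rightarrow> real) \<Rightarrow> real" where
  "a_form D \<kappa> u v = (LINT x|lebesgue_on D. \<kappa> x * inner (grad u x) (grad v x))"

definition s_form ::
  "'a::euclidean_space set \<Rightarrow> ('a \<Rightarrow> real) \<Rightarrow> real \<Rightarrow> ('a \<Rightarrow> real) \<Rightarrow> ('a \<Rightarrow> real) \<Rightarrow> real" where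
  "s_form D \<kappa> H u v = (LINT x|lebesgue_on D. \<kappa> x * u x * v x) / H\<^sup>2"

definition L2_form ::
  "'a::euclidean_space set \<Rightarrow> ('a \<Rightarrow> real) \<Rightarrow> ('a \<Rightarrow> real) \<Rightarrow> real" where
  "L2_form D u v = (LINT x|lebesgue_on D. u x * v x)"

definition tilde_form ::
  "'a::euclidean_space set \<Rightarrow> ('a \<Rightarrow> real) \<Rightarrow> real \<Rightarrow> ('a \<Rightarrow> real) \<Rightarrow> ('a \<Rightarrow> real) \<Rightarrow> real" where
  "tilde_form D \<kappa> dt u v = dt * a_form D \<kappa> u v + L2_form D u v"

definition triple_form ::
  "'a::euclidean_space set \<Rightarrow> ('a \<Rightarrow> real) \<Rightarrow> real \<Rightarrow> real \<Rightarrow> ('a \<Rightarrow> real) \<Rightarrow> ('a \<Rightarrow> real) \<Rightarrow> real" where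
  "triple_form D \<kappa> H dt u v = tilde_form D \<kappa> dt u v + dt * s_form D \<kappa> H u v"


section \<open>Coefficient and auxiliary space\<close>

text \<open>The contrast is \<open>\<kappa>max / \<kappa>min\<close>; for a given lower bound \<open>\<kappa>min\<close> it is unbounded, since \<open>\<kappa>max\<close>
  is arbitrary. The essential bounds below are extended reals; the essential maximum over a null
  set is \<open>-\<infinity>\<close>.\<close>

definition coefficient :: "'a::euclidean_space set \<Rightarrow> real \<Rightarrow> real \<Rightarrow> ('a \<Rightarrow> real) \<Rightarrow> bool" where
  "coefficient \<Omega> \<kappa>min \<kappa>max \<kappa> \<longleftrightarrow>
     \<kappa> \<in> borel_measurable (lebesgue_on \<Omega>) \<and> 0 < \<kappa>min \<and>
     (AE x in lebesgue_on \<Omega>. \<kappa>min \<le> \<kappa> x \<and> \<kappa> x \<le> \<kappa>max)"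

definition ess_max :: "'a::euclidean_space set \<Rightarrow> ('a \<Rightarrow> real) \<Rightarrow> ereal" where
  "ess_max D \<kappa> = esssup (lebesgue_on D) (\<lambda>x. ereal (\<kappa> x))"

definition ess_min :: "'a::euclidean_space set \<Rightarrow> ('a \<Rightarrow> real) \<Rightarrow> ereal" where
  "ess_min D \<kappa> = - esssup (lebesgue_on D) (\<lambda>x. - ereal (\<kappa> x))"

text \<open>\<open>P i\<close> is the set of high-permeability components of the coarse element \<open>K i\<close>.\<close>

definition low_part :: "(nat \<Rightarrow> 'a set) \<Rightarrow> (nat \<Rightarrow> 'a set set) \<Rightarrow> nat \<Rightarrow> 'a set" where
  "low_part K P i = K i - \<Union>(P i)"

definition high_perm_components ::
  "nat \<Rightarrow> (nat \<Rightarrow> 'a::euclidean_space set) \<Rightarrow> (nat \<Rightarrow> 'a set set) \<Rightarrow> ('a \<Rightarrow> real) \<Rightarrow>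
     real \<Rightarrow> real \<Rightarrow> real \<Rightarrow> real \<Rightarrow> bool" where
  "high_perm_components N K P \<kappa> H \<eta>0 \<kappa>0 C\<^sub>P \<longleftrightarrow>
     (\<forall>i<N.
        finite (P i) \<and> disjoint (P i) \<and>
        (\<forall>D\<in>P i.
           D \<noteq> {} \<and> D \<subseteq> K i \<and> open D \<and> connected D \<and> lipschitz_domain D \<and>
           ess_max D \<kappa> / ess_min D \<kappa> \<le> ereal \<eta>0 \<and> ereal \<kappa>0 \<le> ess_min D \<kappa> \<and>
           (\<forall>u g. H1_with_gradient D u g \<longrightarrow> (LINT x|lebesgue_on D. u x) = 0 \<longrightarrow>
              (LINT x|lebesgue_on D. (u x)\<^sup>2)
                \<le> C\<^sub>P * H\<^sup>2 * (LINT x|lebesgue_on D. (norm (g x))\<^sup>2))) \<and>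
        ess_max (low_part K P i) \<kappa> < ereal \<kappa>0)"

definition aux_basis1 :: "nat \<Rightarrow> (nat \<Rightarrow> 'a set set) \<Rightarrow> ('a \<Rightarrow> real) set" where
  "aux_basis1 N P = indicat_real ` (\<Union>i<N. P i)"

definition aux_basis2 ::
  "nat \<Rightarrow> (nat \<Rightarrow> 'a set) \<Rightarrow> (nat \<Rightarrow> 'a set set) \<Rightarrow> ('a \<Rightarrow> real) set" where
  "aux_basis2 N K P = (\<lambda>i. indicat_real (low_part K P i)) ` {..<N}"

definition Vaux :: "nat \<Rightarrow> (nat \<Rightarrow> 'a set) \<Rightarrow> (nat \<Rightarrow> 'a set set) \<Rightarrow> ('a \<Rightarrow> real) set" where
  "Vaux N K P = fspace.span (aux_basis1 N P \<union> aux_basis2 N K P)"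

definition Vaux_elem :: "(nat \<Rightarrow> 'a set) \<Rightarrow> (nat \<Rightarrow> 'a set set) \<Rightarrow> nat \<Rightarrow> ('a \<Rightarrow> real) set" where
  "Vaux_elem K P i = fspace.span (indicat_real ` insert (low_part K P i) (P i))"

definition aux_approximation ::
  "nat \<Rightarrow> (nat \<Rightarrow> 'a::euclidean_space set) \<Rightarrow> (nat \<Rightarrow> 'a set set) \<Rightarrow> ('a \<Rightarrow> real) \<Rightarrow>
     real \<Rightarrow> real \<Rightarrow> bool" where
  "aux_approximation N K P \<kappa> H C\<^sub>\<pi> \<longleftrightarrow>
     (\<forall>i<N. \<forall>u g. H1_with_gradient (interior (K i)) u g \<longrightarrow>
        (let w = u - orth_proj (s_form (K i) \<kappa> H) (Vaux_elem K P i) u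
         in s_form (K i) \<kappa> H w w \<le> C\<^sub>\<pi> * (LINT x|lebesgue_on (K i). \<kappa> x * (norm (g x))\<^sup>2)))"


section \<open>Coarse space\<close>

definition multiscale_function ::
  "'a::euclidean_space set \<Rightarrow> 'a set set \<Rightarrow> ('a \<Rightarrow> real) \<Rightarrow> real \<Rightarrow> ('a \<Rightarrow> real) set \<Rightarrow>
     ('a \<Rightarrow> real) \<Rightarrow> ('a \<Rightarrow> real)" where
  "multiscale_function \<Omega> \<T> \<kappa> H W \<psi> =
     (let s = s_form \<Omega> \<kappa> H; pr = orth_proj s W
      in THE \<phi>. \<phi> \<in> Vh0 \<Omega> \<T> \<and>
           (\<forall>v\<in>Vh0 \<Omega> \<T>. a_form \<Omega> \<kappa> \<phi> v + s (pr \<phi>) (pr v) = s \<psi> (pr v)))"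


section \<open>Overlapping subdomains\<close>

definition overlapping_cover ::
  "'a::euclidean_space set \<Rightarrow> nat \<Rightarrow> (nat \<Rightarrow> 'a set) \<Rightarrow> nat \<Rightarrow> bool" where
  "overlapping_cover \<Omega> N \<omega> N\<^sub>o\<^sub>v \<longleftrightarrow>
     \<Omega> = (\<Union>i<N. \<omega> i) \<and> (\<forall>x\<in>\<Omega>. card {i. i < N \<and> x \<in> \<omega> i} \<le> N\<^sub>o\<^sub>v)"

definition partition_of_unity ::
  "'a::euclidean_space set \<Rightarrow> 'a set set \<Rightarrow> nat \<Rightarrow> (nat \<Rightarrow> 'a set) \<Rightarrow> (nat \<Rightarrow> 'a \<Rightarrow> real) \<Rightarrow>
     real \<Rightarrow> real \<Rightarrow> bool" where
  "partition_of_unity \<Omega> \<T> N \<omega> \<theta> H C\<^sub>\<theta> \<longleftrightarrow>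
     (\<forall>i<N. \<theta> i \<in> Vh \<T> \<and> (\<forall>x\<in>\<Omega> - \<omega> i. \<theta> i x = 0) \<and>
            (AE x in lebesgue_on \<Omega>. norm (grad (\<theta> i) x) \<le> C\<^sub>\<theta> / H)) \<and>
     (\<forall>x\<in>\<Omega>. (\<Sum>i<N. \<theta> i x) = 1 \<and> (\<Sum>i<N. (\<theta> i x)\<^sup>2) \<le> 1)"

definition interp_stable ::
  "'a::euclidean_space set \<Rightarrow> 'a set set \<Rightarrow> ('a \<Rightarrow> real) \<Rightarrow> real \<Rightarrow> real \<Rightarrow> bool" where
  "interp_stable \<Omega> \<T> \<kappa> H C\<^sub>I \<longleftrightarrow>
     (\<forall>v. piecewise_quadratic \<T> v \<longrightarrow>
        form_norm (a_form \<Omega> \<kappa>) (nodal_interp \<T> v) \<le> C\<^sub>I * form_norm (a_form \<Omega> \<kappa>) v \<and>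
        form_norm (s_form \<Omega> \<kappa> H) (nodal_interp \<T> v) \<le> C\<^sub>I * form_norm (s_form \<Omega> \<kappa> H) v)"


section \<open>Matrices and the preconditioned operator\<close>

definition gram_mat ::
  "(('a \<Rightarrow> real) \<Rightarrow> ('a \<Rightarrow> real) \<Rightarrow> real) \<Rightarrow> ('a \<Rightarrow> real) list \<Rightarrow> real mat" where
  "gram_mat b bs = Matrix.mat (length bs) (length bs) (\<lambda>(k, l). b (bs ! k) (bs ! l))"

text \<open>The matrix, with respect to the bases \<open>us\<close> and \<open>bs\<close>, of the inclusion of the span of \<open>us\<close>
  in the span of \<open>bs\<close>. Local functions are extended by zero already, so this also is the matrix of
  extension by zero.\<close>

definition inclusion_mat :: "('a \<Rightarrow> real) list \<Rightarrow> ('a \<Rightarrow> real) list \<Rightarrow> real mat" where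
  "inclusion_mat bs us = Matrix.mat (length bs) (length us)
     (\<lambda>(k, l). fspace.representation (set bs) (us ! l) (bs ! k))"

text \<open>For \<open>E = R\<^sup>T\<close>: the subspace solver \<open>R\<^sup>T (R B R\<^sup>T)\<^sup>-\<^sup>1 R\<close>.\<close>

definition subspace_solver :: "real mat \<Rightarrow> real mat \<Rightarrow> real mat" where
  "subspace_solver B E = E * the (mat_inverse (transpose_mat E * B * E)) * transpose_mat E"

definition additive_schwarz :: "real mat \<Rightarrow> real mat \<Rightarrow> real mat list \<Rightarrow> real mat" where
  "additive_schwarz B E0 Es = foldl (\<lambda>S E. S + subspace_solver B E) (subspace_solver B E0) Es"

definition cond_number :: "real mat \<Rightarrow> real" where
  "cond_number B = Max (spectrum B) / Min (spectrum B)"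

end

theory Submission
  imports Defs
begin

text \<open>The eigenvalues of the preconditioned operator are bounded above by the finite overlap and below
  by a stable decomposition. To decompose \<open>v\<close>, write \<open>\<pi> v = \<psi>\<^sub>1 + \<psi>\<^sub>2\<close> and let \<open>v\<^sub>0\<close> be the multiscale
  function of \<open>\<psi>\<^sub>1\<close>. Subtracting the multiscale function of \<open>\<pi> v\<close> from \<open>v\<close> leaves a remainder
  controlled by \<open>\<parallel>v\<parallel>\<^sub>a\<close>, uniformly in the contrast. The discarded function of \<open>\<psi>\<^sub>2\<close> lives on the
  low-permeability part, where \<open>\<kappa> \<le> \<kappa>\<^sub>0\<close>, so \<open>\<Delta>t \<parallel>\<psi>\<^sub>2\<parallel>\<^sub>s\<^sup>2 \<le> C\<^sub>t \<kappa>\<^sub>0 \<parallel>v\<parallel>\<^sup>2\<close> and the mass term absorbs it.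
  Hence \<open>|||v - v\<^sub>0||| \<lesssim> \<parallel>v\<parallel>\<close> in the norm of \<open>\<Delta>t a + (\<sqdot>,\<sqdot>)\<close>. Replacing \<open>v\<^sub>0\<close> by \<open>T\<^sub>m v\<^sub>0\<close> costs at most
  \<open>\<epsilon>\<^sub>m \<parallel>v\<^sub>0\<parallel>\<close>, and the nodal interpolants of \<open>\<chi>\<^sub>i (v - T\<^sub>m v\<^sub>0)\<close> split the rest.\<close>

section \<open>Semidefinite forms on function spaces\<close>

text \<open>Three obstacles shape the details. Functions that agree almost everywhere are different
  objects, so \<open>s\<close> is only semidefinite on the auxiliary space; projections are handled
  through orthogonality relations, never through linearity of the chosen representative. The
  approximation property is assumed for weakly differentiable functions, so finite element
  functions, whose gradient exists only off the element boundaries, must first be shown to satisfy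
  \<open>H1_with_gradient\<close>. And the local spaces ask for vanishing outside an open union of
  elements, which interpolated cutoffs satisfy because the mesh is conforming. Quantitatively,
  \<open>\<kappa>\<close> is bounded from above only on the low-permeability part;
  \<open>\<kappa>max\<close> enters just through integrability. From below, the mass form is at most
  \<open>H\<^sup>2 / \<kappa>min\<close> times \<open>s\<close>, and
  \<open>c\<^sub>t * H\<^sup>2 \<le> dt\<close> turns this into the term
  \<open>1 / (\<kappa>min * c\<^sub>t)\<close> of the constants. The mass norm of the interpolants
  takes the same detour, since their stability is assumed in the \<open>a\<close> and
  \<open>s\<close> norms.\<close>

locale psd_form =
  fixes V :: "('a \<Rightarrow> real) set" and b :: "('a \<Rightarrow> real) \<Rightarrow> ('a \<Rightarrow> real) \<Rightarrow> real"
  assumes subspace: "fspace.subspace V"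
    and add_left: "\<lbrakk>u \<in> V; v \<in> V; w \<in> V\<rbrakk> \<Longrightarrow> b (u + v) w = b u w + b v w"
    and scale_left: "\<lbrakk>u \<in> V; w \<in> V\<rbrakk> \<Longrightarrow> b (\<lambda>x. c * u x) w = c * b u w"
    and sym: "\<lbrakk>u \<in> V; v \<in> V\<rbrakk> \<Longrightarrow> b u v = b v u"
    and nonneg: "u \<in> V \<Longrightarrow> 0 \<le> b u u"
begin

lemma mem_zero: "0 \<in> V" using fspace.subspace_0[OF subspace] by simp
lemma mem_add: "u \<in> V \<Longrightarrow> v \<in> V \<Longrightarrow> u + v \<in> V" by (rule fspace.subspace_add[OF subspace])
lemma mem_diff: "u \<in> V \<Longrightarrow> v \<in> V \<Longrightarrow> u - v \<in> V" by (rule fspace.subspace_diff[OF subspace])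
lemma mem_scale: "u \<in> V \<Longrightarrow> (\<lambda>x. c * u x) \<in> V" by (rule fspace.subspace_scale[OF subspace])
lemma mem_sum: "(\<And>i. i \<in> I \<Longrightarrow> f i \<in> V) \<Longrightarrow> sum f I \<in> V" by (rule fspace.subspace_sum[OF subspace])
lemma mem_span: "B \<subseteq> V \<Longrightarrow> u \<in> fspace.span B \<Longrightarrow> u \<in> V"
  using fspace.span_minimal[OF _ subspace] by blast

lemma add_right: "\<lbrakk>u \<in> V; v \<in> V; w \<in> V\<rbrakk> \<Longrightarrow> b w (u + v) = b w u + b w v"
  using add_left sym mem_add by metis

lemma scale_right: "\<lbrakk>u \<in> V; w \<in> V\<rbrakk> \<Longrightarrow> b w (\<lambda>x. c * u x) = c * b w u"
  using scale_left sym mem_scale by metis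

lemma diff_left: "\<lbrakk>u \<in> V; v \<in> V; w \<in> V\<rbrakk> \<Longrightarrow> b (u - v) w = b u w - b v w"
  using add_left[of "u - v" v w] mem_diff by simp

lemma diff_right: "\<lbrakk>u \<in> V; v \<in> V; w \<in> V\<rbrakk> \<Longrightarrow> b w (u - v) = b w u - b w v"
  using diff_left sym mem_diff by metis

lemma zero_left: "w \<in> V \<Longrightarrow> b 0 w = 0"
  using add_left[of 0 0 w] mem_zero by simp

lemma zero_right: "w \<in> V \<Longrightarrow> b w 0 = 0"
  using zero_left sym mem_zero by metis

lemma sum_left: "w \<in> V \<Longrightarrow> (\<And>i. i \<in> I \<Longrightarrow> f i \<in> V) \<Longrightarrow> b (sum f I) w = (\<Sum>i\<in>I. b (f i) w)"
  by (induction I rule: infinite_finite_induct) (auto simp: zero_left add_left mem_sum)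

lemma sum_right: "w \<in> V \<Longrightarrow> (\<And>i. i \<in> I \<Longrightarrow> f i \<in> V) \<Longrightarrow> b w (sum f I) = (\<Sum>i\<in>I. b w (f i))"
  by (induction I rule: infinite_finite_induct) (auto simp: zero_right add_right mem_sum)

text \<open>Expands \<open>b\<close> at \<open>u - t v\<close>. The free parameter gives
  Cauchy-Schwarz by optimization, and \<open>t = 1\<close> is the version of Young's inequality used
  in the stability estimates.\<close>

lemma square_diff_scale:
  assumes "u \<in> V" "v \<in> V"
  shows "0 \<le> b u u - 2 * t * b u v + t\<^sup>2 * b v v"
proof -
  define w where "w = (\<lambda>x. t * v x)"
  have w: "w \<in> V" unfolding w_def using assms mem_scale by blast
  have "0 \<le> b (u - w) (u - w)" using nonneg mem_diff assms w by blast
  also have "\<dots> = b u u - 2 * b u w + b w w"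
    using assms w by (simp add: diff_left diff_right mem_diff sym[of w u])
  also have "\<dots> = b u u - 2 * t * b u v + t\<^sup>2 * b v v"
    using assms w scale_left[of v w t] scale_right[of v u t] scale_right[of v v t]
    unfolding w_def[symmetric] by (simp add: power2_eq_square)
  finally show ?thesis .
qed

lemma Cauchy_Schwarz:
  assumes "u \<in> V" "v \<in> V"
  shows "(b u v)\<^sup>2 \<le> b u u * b v v"
proof (cases "b v v = 0")
  case True
  have "b u v = 0"
  proof (rule ccontr)
    assume n: "b u v \<noteq> 0"
    \<comment> \<open>Since \<open>v\<close> is a null vector, the expression is affine in
      \<open>t\<close>; this value of \<open>t\<close> brings it down to -1.\<close>
    have "0 \<le> b u u - 2 * ((b u u + 1) / (2 * b u v)) * b u v"
      using square_diff_scale[OF assms, of "(b u u + 1) / (2 * b u v)"] True by simp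
    also have "\<dots> = - 1" using n by (simp add: field_simps)
    finally show False by simp
  qed
  then show ?thesis using True by simp
next
  case False
  then have p: "b v v > 0" using nonneg[OF assms(2)] by simp
  have "0 \<le> b u u - 2 * (b u v / b v v) * b u v + (b u v / b v v)\<^sup>2 * b v v"
    by (rule square_diff_scale[OF assms])
  also have "\<dots> = b u u - (b u v)\<^sup>2 / b v v" using p by (simp add: field_simps power2_eq_square)
  finally show ?thesis using p by (simp add: field_simps)
qed

lemma null_right: "\<lbrakk>u \<in> V; v \<in> V; b v v = 0\<rbrakk> \<Longrightarrow> b u v = 0"
  using Cauchy_Schwarz[of u v] by simp

lemma le_form_norm: "\<lbrakk>u \<in> V; v \<in> V\<rbrakk> \<Longrightarrow> b u v \<le> form_norm b u * form_norm b v"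
  unfolding form_norm_def
  by (metis Cauchy_Schwarz real_le_rsqrt real_sqrt_mult)

lemma form_norm_nonneg: "u \<in> V \<Longrightarrow> 0 \<le> form_norm b u"
  by (simp add: form_norm_def nonneg)

lemma form_norm_square: "u \<in> V \<Longrightarrow> (form_norm b u)\<^sup>2 = b u u"
  by (simp add: form_norm_def nonneg)

lemma form_norm_triangle:
  assumes "u \<in> V" "v \<in> V"
  shows "form_norm b (u + v) \<le> form_norm b u + form_norm b v"
proof -
  have "b (u + v) (u + v) = b u u + 2 * b u v + b v v"
    using assms by (simp add: add_left add_right mem_add sym[of v u])
  also have "\<dots> \<le> (form_norm b u + form_norm b v)\<^sup>2"
    using le_form_norm[OF assms] form_norm_square assms by (simp add: power2_sum)
  finally show ?thesis
    using form_norm_nonneg assms unfolding form_norm_def[of b "u + v"]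
    by (intro real_le_lsqrt) (auto simp: add_nonneg_nonneg)
qed

lemma quadratic_add_le:
  assumes "u \<in> V" "v \<in> V"
  shows "b (u + v) (u + v) \<le> 2 * b u u + 2 * b v v"
proof -
  have "2 * b u v \<le> b u u + b v v" using square_diff_scale[OF assms, of 1] by simp
  then show ?thesis using assms by (simp add: add_left add_right mem_add sym[of v u])
qed

lemma form_norm_diff_commute:
  assumes "u \<in> V" "v \<in> V"
  shows "form_norm b (u - v) = form_norm b (v - u)"
  using assms by (simp add: form_norm_def diff_left diff_right mem_diff sym[of v u])

text \<open>Gram-Schmidt without definiteness. The generators may be dependent and null vectors may
  occur, provided \<open>l\<close> vanishes on the latter; hence existence without uniqueness. The
  induction hypothesis is used twice: for \<open>b x\<close>, to project the new generator, and for
  \<open>l\<close> itself.\<close>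

lemma Riesz_representation:
  assumes "finite B" "B \<subseteq> V"
    and "\<And>u v. u \<in> fspace.span B \<Longrightarrow> v \<in> fspace.span B \<Longrightarrow> l (u + v) = l u + l v"
    and "\<And>c u. u \<in> fspace.span B \<Longrightarrow> l (\<lambda>x. c * u x) = c * l u"
    and "\<And>v. v \<in> fspace.span B \<Longrightarrow> b v v = 0 \<Longrightarrow> l v = 0"
  shows "\<exists>p\<in>fspace.span B. \<forall>v\<in>fspace.span B. b p v = l v"
  using assms
proof (induction B arbitrary: l rule: finite_induct)
  case empty
  have "l 0 = 0" using empty(3)[of 0 0] by (simp add: zero_fun_def)
  then show ?case using zero_left mem_zero by (simp flip: zero_fun_def)
next
  case (insert x B)
  have xV: "x \<in> V" and BV: "B \<subseteq> V" using insert by auto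
  note sp = mem_span[OF BV]
  have mono: "fspace.span B \<subseteq> fspace.span (insert x B)" by (rule fspace.span_mono) auto
  have "\<exists>p\<in>fspace.span B. \<forall>v\<in>fspace.span B. b p v = b x v"
    by (rule insert.IH[of "b x"]; (rule BV add_right scale_right null_right)?; (rule xV sp)?; assumption?)
  then obtain q where q: "q \<in> fspace.span B" "\<And>v. v \<in> fspace.span B \<Longrightarrow> b q v = b x v" by auto
  have "\<exists>p\<in>fspace.span B. \<forall>v\<in>fspace.span B. b p v = l v"
    by (rule insert.IH[of l]; (rule BV insert.prems(2-4) subsetD[OF mono])?; assumption?;
        (rule subsetD[OF mono])?; assumption?)
  then obtain p0 where p0: "p0 \<in> fspace.span B" "\<And>v. v \<in> fspace.span B \<Longrightarrow> b p0 v = l v" by auto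
  define y where "y = x - q"
  have yV: "y \<in> V" unfolding y_def using xV q sp mem_diff by blast
  have ysp: "y \<in> fspace.span (insert x B)" unfolding y_def
    by (rule fspace.span_diff[OF fspace.span_base[OF insertI1] subsetD[OF mono q(1)]])
  have orth: "b y v = 0" if "v \<in> fspace.span B" for v
    unfolding y_def using diff_left[OF xV sp[OF q(1)] sp[OF that]] q(2)[OF that] by simp
  \<comment> \<open>If \<open>b y y = 0\<close>, division by zero makes \<open>c = 0\<close>, and
    \<open>c * b y y = l y\<close> still holds because \<open>l\<close> vanishes on null
    vectors.\<close>
  define c where "c = l y / b y y"
  define p where "p = p0 + (\<lambda>z. c * y z)"
  have p_span: "p \<in> fspace.span (insert x B)" unfolding p_def
    by (rule fspace.span_add[OF subsetD[OF mono p0(1)] fspace.span_scale[OF ysp]])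
  have "b p v = l v" if v: "v \<in> fspace.span (insert x B)" for v
  proof -
    obtain k where k: "v - (\<lambda>z. k * x z) \<in> fspace.span B"
      using v fspace.span_breakdown_eq by blast
    define r where "r = (v - (\<lambda>z. k * x z)) + (\<lambda>z. k * q z)"
    have r: "r \<in> fspace.span B" unfolding r_def
      using k q(1) fspace.span_add fspace.span_scale by blast
    have v_eq: "v = r + (\<lambda>z. k * y z)" unfolding r_def y_def by (auto simp: fun_eq_iff algebra_simps)
    have rV: "r \<in> V" and p0V: "p0 \<in> V" using sp r p0 by auto
    have kyV: "(\<lambda>z. k * y z) \<in> V" using yV mem_scale by blast
    have cyV: "(\<lambda>z. c * y z) \<in> V" using yV by (rule mem_scale)
    have "b p v = b p0 r + k * b p0 y + (c * b y r + c * (k * b y y))"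
      unfolding p_def v_eq using rV p0V yV kyV cyV
      by (simp add: add_left add_right scale_right scale_left mem_add distrib_left)
    also have "\<dots> = l r + k * (c * b y y)"
      using p0 r orth[OF r] orth[OF p0(1)] sym[OF yV p0V] by simp
    also have "c * b y y = l y" unfolding c_def using insert.prems(4)[OF ysp] by auto
    also have "l r + k * l y = l v" unfolding v_eq
      by (simp only: insert.prems(2)[OF subsetD[OF mono r] fspace.span_scale[OF ysp]]
          insert.prems(3)[OF ysp])
    finally show ?thesis .
  qed
  then show ?case using p_span by blast
qed

text \<open>The choice in \<open>orth_proj\<close> is from a nonempty set: apply Riesz to the
  functional \<open>b u\<close>, which kills null vectors by Cauchy-Schwarz.\<close>

lemma orth_proj_span:
  assumes "finite B" "B \<subseteq> V" "u \<in> V"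
  shows "orth_proj b (fspace.span B) u \<in> fspace.span B"
    and "w \<in> fspace.span B \<Longrightarrow> b (orth_proj b (fspace.span B) u) w = b u w"
proof -
  note sp = mem_span[OF assms(2)]
  have "\<exists>p\<in>fspace.span B. \<forall>v\<in>fspace.span B. b p v = b u v"
    by (rule Riesz_representation[where l = "b u"];
      (rule assms(1,2) add_right scale_right null_right)?; (rule assms(3) sp)?; assumption?)
  then have "\<exists>p. p \<in> fspace.span B \<and> (\<forall>w\<in>fspace.span B. b (u - p) w = 0)"
    using diff_left[OF assms(3)] sp by auto
  from someI_ex[OF this] have *: "orth_proj b (fspace.span B) u \<in> fspace.span B"
    "\<forall>w\<in>fspace.span B. b (u - orth_proj b (fspace.span B) u) w = 0"
    unfolding orth_proj_def by auto
  show "orth_proj b (fspace.span B) u \<in> fspace.span B" by (rule *)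
  show "b (orth_proj b (fspace.span B) u) w = b u w" if "w \<in> fspace.span B"
    using *(2)[rule_format, OF that] diff_left[OF assms(3) sp[OF *(1)] sp[OF that]] by simp
qed

lemma orth_proj_best:
  assumes "finite B" "B \<subseteq> V" "u \<in> V" "q \<in> fspace.span B"
  defines "p \<equiv> orth_proj b (fspace.span B) u"
  shows "b (u - p) (u - p) \<le> b (u - q) (u - q)"
proof -
  note sp = mem_span[OF assms(2)] and P = orth_proj_span[OF assms(1-3), folded p_def]
  have pV: "p \<in> V" and qV: "q \<in> V" using P sp assms by auto
  have d: "p - q \<in> fspace.span B" using P assms fspace.span_diff by blast
  have 0: "b (u - p) (p - q) = 0" using P(2)[OF d] diff_left assms(3) pV sp[OF d] by simp
  have *: "b (y + z) (y + z) = b y y + b z z" if "y \<in> V" "z \<in> V" "b y z = 0" for y z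
    using that by (simp add: add_left add_right mem_add sym[of z y])
  have "b (u - q) (u - q) = b (u - p) (u - p) + b (p - q) (p - q)"
    using *[of "u - p" "p - q"] 0 assms(3) pV qV mem_diff by simp
  then show ?thesis using nonneg[of "p - q"] pV qV mem_diff by auto
qed

end

text \<open>The weights stay free so that one rule covers \<open>tilde_form\<close>,
  \<open>triple_form\<close> and, with second weight 0, the rescaling inside
  \<open>s_form\<close>.\<close>

lemma psd_form_add:
  assumes "psd_form V b" "psd_form V c" "0 \<le> k" "0 \<le> m"
  shows "psd_form V (\<lambda>u v. k * b u v + m * c u v)"
proof -
  interpret b: psd_form V b by fact
  interpret c: psd_form V c by fact
  show ?thesis
    by unfold_locales
      (auto simp: b.subspace b.add_left c.add_left b.scale_left c.scale_left b.sym c.sym b.nonneg c.nonneg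
        algebra_simps assms(3,4))
qed

lemma psd_form_subset:
  assumes "psd_form V b" "W \<subseteq> V" "fspace.subspace W"
  shows "psd_form W b"
proof -
  interpret b: psd_form V b by fact
  show ?thesis using assms
    by unfold_locales (auto intro: b.add_left b.scale_left b.sym b.nonneg)
qed

section \<open>The additive Schwarz operator\<close>

no_notation inner (infix \<open>\<bullet>\<close> 70)
no_notation Finite_Cartesian_Product.vec_nth (infixl \<open>$\<close> 90)

lemma sum_apply: "(sum f I) x = (\<Sum>i\<in>I. f i x)"
  by (induction I rule: infinite_finite_induct) auto

section \<open>Coordinates with respect to a list of functions\<close>

definition vec_fun :: "('a \<Rightarrow> real) list \<Rightarrow> real Matrix.vec \<Rightarrow> 'a \<Rightarrow> real" where
  "vec_fun us x = (\<Sum>k<length us. (\<lambda>z. x $ k * (us ! k) z))"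

lemma vec_fun_add:
  assumes "x \<in> carrier_vec (length us)" "y \<in> carrier_vec (length us)"
  shows "vec_fun us (x + y) = vec_fun us x + vec_fun us y"
proof -
  have "vec_fun us (x + y) = (\<Sum>k<length us. (\<lambda>z. x $ k * (us ! k) z) + (\<lambda>z. y $ k * (us ! k) z))"
    unfolding vec_fun_def using assms
    by (intro sum.cong) (auto simp: fun_eq_iff distrib_right)
  then show ?thesis by (simp add: vec_fun_def sum.distrib)
qed

lemma vec_fun_smult:
  assumes "x \<in> carrier_vec (length us)"
  shows "vec_fun us (c \<cdot>\<^sub>v x) = (\<lambda>z. c * vec_fun us x z)"
proof
  fix z
  show "vec_fun us (c \<cdot>\<^sub>v x) z = c * vec_fun us x z"
    unfolding vec_fun_def sum_apply sum_distrib_left using assms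
    by (intro sum.cong) auto
qed

lemma vec_fun_span: "set us \<subseteq> fspace.span B \<Longrightarrow> vec_fun us x \<in> fspace.span B"
  unfolding vec_fun_def
  by (intro fspace.span_sum fspace.span_scale) (metis lessThan_iff nth_mem subsetD)

lemma sum_nth_distinct:
  "distinct us \<Longrightarrow> (\<Sum>k<length us. f (us ! k)) = (\<Sum>u\<in>set us. f u)"
  by (rule sum.reindex_bij_betw) (simp add: bij_betw_nth)

lemma vec_fun_representation:
  assumes "basis_list us V" "v \<in> V"
  shows "vec_fun us (Matrix.vec (length us) (\<lambda>k. fspace.representation (set us) v (us ! k))) = v"
proof -
  have "vec_fun us (Matrix.vec (length us) (\<lambda>k. fspace.representation (set us) v (us ! k)))
    = (\<Sum>k<length us. (\<lambda>z. fspace.representation (set us) v (us ! k) * (us ! k) z))"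
    unfolding vec_fun_def by (intro sum.cong) auto
  also have "\<dots> = (\<Sum>u\<in>set us. (\<lambda>z. fspace.representation (set us) v u * u z))"
    using assms(1)
    by (intro sum_nth_distinct[where f = "\<lambda>u z. fspace.representation (set us) v u * u z"])
      (auto simp: basis_list_def)
  also have "\<dots> = v" using assms
    by (intro fspace.sum_representation_eq) (auto simp: basis_list_def)
  finally show ?thesis .
qed

lemma vec_fun_eq_0:
  assumes "basis_list us V" "x \<in> carrier_vec (length us)" "vec_fun us x = 0"
  shows "x = 0\<^sub>v (length us)"
proof (rule eq_vecI)
  fix k assume k: "k < dim_vec (0\<^sub>v (length us) :: real Matrix.vec)"
  have d: "distinct us" "fspace.independent (set us)" using assms(1) by (auto simp: basis_list_def)
  \<comment> \<open>Coordinates are indexed by position, linear independence by basis elements;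
    distinctness of the list makes the translation well defined.\<close>
  define f where "f u = x $ (THE j. j < length us \<and> us ! j = u)" for u
  have f: "f (us ! j) = x $ j" if "j < length us" for j
  proof -
    have "(THE i. i < length us \<and> us ! i = us ! j) = j"
      using that d(1) by (auto simp: nth_eq_iff_index_eq)
    then show ?thesis by (simp add: f_def)
  qed
  have "(\<Sum>u\<in>set us. (\<lambda>z. f u * u z)) = (\<Sum>j<length us. (\<lambda>z. f (us ! j) * (us ! j) z))"
    by (rule sum_nth_distinct[OF d(1), where f = "\<lambda>u z. f u * u z", symmetric])
  also have "\<dots> = vec_fun us x" unfolding vec_fun_def by (intro sum.cong) (auto simp: f)
  finally have "(\<Sum>u\<in>set us. (\<lambda>z. f u * u z)) = 0" using assms(3) by simp
  then have "f (us ! k) = 0"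
    using fspace.independentD[OF d(2), of "set us" f "us ! k"] k by (auto simp: zero_fun_def)
  then show "x $ k = 0\<^sub>v (length us) $ k" using f k by simp
qed (use assms(2) in auto)

lemma inclusion_mat_carrier [simp]: "inclusion_mat bs us \<in> carrier_mat (length bs) (length us)"
  by (simp add: inclusion_mat_def)

lemma gram_mat_carrier [simp]: "gram_mat b bs \<in> carrier_mat (length bs) (length bs)"
  by (simp add: gram_mat_def)

lemma vec_fun_inclusion_mat:
  assumes "basis_list bs V" "set us \<subseteq> V" "y \<in> carrier_vec (length us)"
  shows "vec_fun bs (inclusion_mat bs us *\<^sub>v y) = vec_fun us y"
proof
  fix z
  let ?r = "\<lambda>l k. fspace.representation (set bs) (us ! l) (bs ! k)"
  have "vec_fun bs (inclusion_mat bs us *\<^sub>v y) z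
      = (\<Sum>k<length bs. (\<Sum>l<length us. ?r l k * y $ l) * (bs ! k) z)"
    unfolding vec_fun_def sum_apply
    using assms(3)
    by (intro sum.cong) (auto simp: inclusion_mat_def scalar_prod_def atLeast0LessThan)
  also have "\<dots> = (\<Sum>l<length us. y $ l * (\<Sum>k<length bs. ?r l k * (bs ! k) z))"
    unfolding sum_distrib_left sum_distrib_right
    by (subst sum.swap) (simp add: mult_ac)
  also have "\<dots> = (\<Sum>l<length us. y $ l * (us ! l) z)"
  proof (intro sum.cong refl)
    fix l assume "l \<in> {..<length us}"
    then have "us ! l \<in> V" using assms(2) by auto
    from fun_cong[OF vec_fun_representation[OF assms(1) this], of z]
    show "y $ l * (\<Sum>k<length bs. ?r l k * (bs ! k) z) = y $ l * (us ! l) z"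
      by (simp add: vec_fun_def sum_apply)
  qed
  also have "\<dots> = vec_fun us y z" by (simp add: vec_fun_def sum_apply)
  finally show "vec_fun bs (inclusion_mat bs us *\<^sub>v y) z = vec_fun us y z" .
qed

context psd_form
begin

lemma add_sum_left:
  "\<lbrakk>u0 \<in> V; \<And>i. i \<in> I \<Longrightarrow> u i \<in> V; w \<in> V\<rbrakk>
    \<Longrightarrow> b (u0 + (\<Sum>i\<in>I. u i)) w = b u0 w + (\<Sum>i\<in>I. b (u i) w)"
  using add_left[OF _ mem_sum[of I u]] sum_left[of w I u] by simp

lemma add_sum_right:
  "\<lbrakk>u0 \<in> V; \<And>i. i \<in> I \<Longrightarrow> u i \<in> V; w \<in> V\<rbrakk>
    \<Longrightarrow> b w (u0 + (\<Sum>i\<in>I. u i)) = b w u0 + (\<Sum>i\<in>I. b w (u i))"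
  using add_right[OF _ mem_sum[of I u]] sum_right[of w I u] by simp

lemma vec_fun_mem: "set us \<subseteq> V \<Longrightarrow> vec_fun us x \<in> V"
  by (rule mem_span[OF _ vec_fun_span[OF fspace.span_superset]])

lemma gram_mat_scalar_prod:
  assumes "set us \<subseteq> V" "x \<in> carrier_vec (length us)" "y \<in> carrier_vec (length us)"
  shows "x \<bullet> (gram_mat b us *\<^sub>v y) = b (vec_fun us x) (vec_fun us y)"
proof -
  have us: "us ! k \<in> V" if "k < length us" for k using assms(1) that by auto
  have sc: "(\<lambda>z. c * (us ! k) z) \<in> V" if "k < length us" for k c using us[OF that] by (rule mem_scale)
  have "b (vec_fun us x) (vec_fun us y)
      = (\<Sum>k<length us. \<Sum>l<length us. x $ k * (y $ l * b (us ! k) (us ! l)))"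
    unfolding vec_fun_def
    by (subst sum_left, (auto intro!: mem_sum sc)[2], intro sum.cong refl,
        subst sum_right, (auto intro!: sc)[2], intro sum.cong refl)
      (auto simp: scale_left scale_right us sc)
  also have "\<dots> = x \<bullet> (gram_mat b us *\<^sub>v y)"
    using assms(2,3)
    by (auto simp: scalar_prod_def gram_mat_def sum_distrib_left atLeast0LessThan mult_ac intro!: sum.cong)
  finally show ?thesis by simp
qed

end

text \<open>Injectivity makes the determinant nonzero, so \<open>mat_inverse\<close> returns a value
  and \<open>the\<close> in \<open>subspace_solver\<close> is meaningful.\<close>

lemma mat_inverse_right:
  fixes G :: "real mat"
  assumes G: "G \<in> carrier_mat n n"
    and inj: "\<And>y. y \<in> carrier_vec n \<Longrightarrow> G *\<^sub>v y = 0\<^sub>v n \<Longrightarrow> y = 0\<^sub>v n"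
  shows "the (mat_inverse G) \<in> carrier_mat n n" "G * the (mat_inverse G) = 1\<^sub>m n"
proof -
  have "Determinant.det G \<noteq> 0" using det_0_iff_vec_prod_zero[OF G] inj by blast
  then have "mat_inverse G \<noteq> None"
    using det_non_zero_imp_unit[OF G, of "()"] mat_inverse(1)[OF G, of "()"] by blast
  then obtain B where "mat_inverse G = Some B" by auto
  with mat_inverse(2)[OF G this] show "the (mat_inverse G) \<in> carrier_mat n n"
    "G * the (mat_inverse G) = 1\<^sub>m n" by auto
qed

section \<open>Subspace solvers as orthogonal projections\<close>

locale definite_form = psd_form +
  assumes definite: "\<lbrakk>u \<in> V; b u u = 0\<rbrakk> \<Longrightarrow> u = 0"
begin

lemma definite_pos: "\<lbrakk>u \<in> V; u \<noteq> 0\<rbrakk> \<Longrightarrow> 0 < b u u"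
  using definite nonneg by (metis order_le_less)

text \<open>Galerkin's method in matrix form: \<open>E\<^sup>T * B * E\<close> is the Gram matrix of
  the subspace basis, invertible because \<open>b\<close> is definite. Solving with right-hand side
  \<open>E\<^sup>T (B x)\<close> therefore yields the \<open>b\<close>-orthogonal projection onto
  \<open>W\<close> of the function with coordinates \<open>x\<close>.\<close>

lemma subspace_solver_projection:
  assumes bs: "basis_list bs V" and us: "basis_list us W" and WV: "W \<subseteq> V"
    and x: "x \<in> carrier_vec (length bs)"
  defines "z \<equiv> subspace_solver (gram_mat b bs) (inclusion_mat bs us) *\<^sub>v (gram_mat b bs *\<^sub>v x)"
  shows "subspace_solver (gram_mat b bs) (inclusion_mat bs us) \<in> carrier_mat (length bs) (length bs)"
    "vec_fun bs z \<in> W"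
    "w \<in> W \<Longrightarrow> b (vec_fun bs z) w = b (vec_fun bs x) w"
proof -
  let ?E = "inclusion_mat bs us" and ?B = "gram_mat b bs"
  let ?n = "length bs" and ?m = "length us"
  have spW: "fspace.span (set us) = W" and spV: "fspace.span (set bs) = V"
    using us bs by (auto simp: basis_list_def)
  have usW: "set us \<subseteq> W" and bsV: "set bs \<subseteq> V" using spW spV fspace.span_superset by blast+
  have usV: "set us \<subseteq> V" using usW WV by blast
  have E [simp]: "?E \<in> carrier_mat ?n ?m" and ET_carrier: "?E\<^sup>T \<in> carrier_mat ?m ?n"
    and B [simp]: "?B \<in> carrier_mat ?n ?n" by auto
  define G where "G = ?E\<^sup>T * ?B * ?E"
  have ETB: "?E\<^sup>T * ?B \<in> carrier_mat ?m ?n" by (rule mult_carrier_mat[OF ET_carrier B])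
  have G: "G \<in> carrier_mat ?m ?m" unfolding G_def by (rule mult_carrier_mat[OF ETB E])
  have Ey: "?E *\<^sub>v y \<in> carrier_vec ?n" if "y \<in> carrier_vec ?m" for y
    by (rule mult_mat_vec_carrier[OF E that])
  have By: "?B *\<^sub>v y \<in> carrier_vec ?n" if "y \<in> carrier_vec ?n" for y
    by (rule mult_mat_vec_carrier[OF B that])
  have ET: "q \<bullet> (?E\<^sup>T *\<^sub>v y) = (?E *\<^sub>v q) \<bullet> y"
    if q: "q \<in> carrier_vec ?m" and y: "y \<in> carrier_vec ?n" for q y
    using transpose_vec_mult_scalar[OF E q y]
      comm_scalar_prod[OF q mult_mat_vec_carrier[OF ET_carrier y]] comm_scalar_prod[OF Ey[OF q] y]
    by simp
  have Gy: "G *\<^sub>v y = ?E\<^sup>T *\<^sub>v (?B *\<^sub>v (?E *\<^sub>v y))" if y: "y \<in> carrier_vec ?m" for y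
    unfolding G_def assoc_mult_mat_vec[OF ETB E y] assoc_mult_mat_vec[OF ET_carrier B Ey[OF y]] ..
  have qGy: "q \<bullet> (G *\<^sub>v y) = b (vec_fun us q) (vec_fun us y)"
    if "q \<in> carrier_vec ?m" "y \<in> carrier_vec ?m" for q y
    using that gram_mat_scalar_prod[OF bsV Ey Ey, OF that]
    by (simp add: Gy ET By Ey vec_fun_inclusion_mat[OF bs usV])
  have inj: "y = 0\<^sub>v ?m" if y: "y \<in> carrier_vec ?m" "G *\<^sub>v y = 0\<^sub>v ?m" for y
  proof -
    have "b (vec_fun us y) (vec_fun us y) = 0" using qGy[OF y(1) y(1)] y by simp
    then show ?thesis using definite vec_fun_mem[OF usV] vec_fun_eq_0[OF us y(1)] by blast
  qed
  define I where "I = the (mat_inverse G)"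
  have I: "I \<in> carrier_mat ?m ?m" "G * I = 1\<^sub>m ?m"
    unfolding I_def using mat_inverse_right[OF G inj] by auto
  define r where "r = ?E\<^sup>T *\<^sub>v (?B *\<^sub>v x)"
  have r: "r \<in> carrier_vec ?m" unfolding r_def by (rule mult_mat_vec_carrier[OF ET_carrier By[OF x]])
  define y where "y = I *\<^sub>v r"
  have y: "y \<in> carrier_vec ?m" unfolding y_def by (rule mult_mat_vec_carrier[OF I(1) r])
  have z: "z = ?E *\<^sub>v y"
    unfolding z_def y_def r_def subspace_solver_def G_def[symmetric] I_def[symmetric]
    assoc_mult_mat_vec[OF mult_carrier_mat[OF E I(1)] ET_carrier By[OF x]]
    assoc_mult_mat_vec[OF E I(1) r[unfolded r_def]] ..
  have Gr: "G *\<^sub>v y = r" unfolding y_def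
    using assoc_mult_mat_vec[OF G I(1) r] I(2) r by simp
  have zf: "vec_fun bs z = vec_fun us y" unfolding z by (rule vec_fun_inclusion_mat[OF bs usV y])
  show "subspace_solver ?B ?E \<in> carrier_mat ?n ?n"
    unfolding subspace_solver_def G_def[symmetric] I_def[symmetric]
    by (rule mult_carrier_mat[OF mult_carrier_mat[OF E I(1)] ET_carrier])
  show "vec_fun bs z \<in> W" unfolding zf spW[symmetric] by (rule vec_fun_span[OF fspace.span_superset])
  show "b (vec_fun bs z) w = b (vec_fun bs x) w" if "w \<in> W"
  proof -
    define q where "q = Matrix.vec (length us) (\<lambda>k. fspace.representation (set us) w (us ! k))"
    have q: "q \<in> carrier_vec ?m" "vec_fun us q = w"
      unfolding q_def using vec_fun_representation[OF us that] by auto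
    have "b w (vec_fun us y) = (?E *\<^sub>v q) \<bullet> (?B *\<^sub>v x)"
      using qGy[OF q(1) y] Gr q ET[OF q(1) By[OF x]] by (simp add: r_def)
    also have "\<dots> = b w (vec_fun bs x)"
      using gram_mat_scalar_prod[OF bsV Ey[OF q(1)] x] vec_fun_inclusion_mat[OF bs usV q(1)] q(2) by simp
    finally show ?thesis
      unfolding zf using sym[of w] vec_fun_mem[OF usV] vec_fun_mem[OF bsV] subsetD[OF WV that] by simp
  qed
qed

end

lemma additive_schwarz_carrier:
  assumes "subspace_solver B E0 \<in> carrier_mat n n"
    and "\<And>E. E \<in> set Es \<Longrightarrow> subspace_solver B E \<in> carrier_mat n n"
  shows "additive_schwarz B E0 Es \<in> carrier_mat n n"
  using assms(2)
proof (induction Es rule: rev_induct)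
  case Nil
  show ?case using assms(1) by (simp add: additive_schwarz_def)
next
  case (snoc E Es)
  then have "additive_schwarz B E0 Es + subspace_solver B E \<in> carrier_mat n n"
    by (intro add_carrier_mat) simp
  then show ?case by (simp add: additive_schwarz_def)
qed

lemma vec_fun_additive_schwarz:
  assumes "subspace_solver B E0 \<in> carrier_mat (length bs) (length bs)"
    and "\<And>E. E \<in> set Es \<Longrightarrow> subspace_solver B E \<in> carrier_mat (length bs) (length bs)"
    and y: "y \<in> carrier_vec (length bs)"
  shows "vec_fun bs (additive_schwarz B E0 Es *\<^sub>v y) = vec_fun bs (subspace_solver B E0 *\<^sub>v y)
    + (\<Sum>i<length Es. vec_fun bs (subspace_solver B (Es ! i) *\<^sub>v y))"
  using assms(2)
proof (induction Es rule: rev_induct)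
  case Nil
  then show ?case by (simp add: additive_schwarz_def)
next
  case (snoc E Es)
  have E: "subspace_solver B E \<in> carrier_mat (length bs) (length bs)" using snoc.prems by simp
  have S: "additive_schwarz B E0 Es \<in> carrier_mat (length bs) (length bs)"
    using additive_schwarz_carrier[OF assms(1)] snoc.prems by simp
  have "additive_schwarz B E0 (Es @ [E]) *\<^sub>v y
      = additive_schwarz B E0 Es *\<^sub>v y + subspace_solver B E *\<^sub>v y"
    using add_mult_distrib_mat_vec[OF S E y] by (simp add: additive_schwarz_def)
  then have "vec_fun bs (additive_schwarz B E0 (Es @ [E]) *\<^sub>v y)
      = vec_fun bs (additive_schwarz B E0 Es *\<^sub>v y) + vec_fun bs (subspace_solver B E *\<^sub>v y)"
    using mult_mat_vec_carrier[OF S y] mult_mat_vec_carrier[OF E y] by (simp add: vec_fun_add)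
  moreover have "(\<Sum>i<length (Es @ [E]). vec_fun bs (subspace_solver B ((Es @ [E]) ! i) *\<^sub>v y))
      = (\<Sum>i<length Es. vec_fun bs (subspace_solver B (Es ! i) *\<^sub>v y)) + vec_fun bs (subspace_solver B E *\<^sub>v y)"
    by (simp add: nth_append)
  ultimately show ?case using snoc.IH snoc.prems by (simp add: add.assoc)
qed

section \<open>Spectrum of the preconditioned operator\<close>

locale schwarz_spaces = definite_form +
  fixes bs cs :: "('a \<Rightarrow> real) list" and ls :: "nat \<Rightarrow> ('a \<Rightarrow> real) list"
    and W0 :: "('a \<Rightarrow> real) set" and W :: "nat \<Rightarrow> ('a \<Rightarrow> real) set" and N :: nat and Q :: "real mat"
  defines "Q \<equiv> additive_schwarz (gram_mat b bs) (inclusion_mat bs cs)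
      (map (\<lambda>i. inclusion_mat bs (ls i)) [0..<N]) * gram_mat b bs"
  assumes bs: "basis_list bs V" and cs: "basis_list cs W0" and W0: "W0 \<subseteq> V"
    and ls: "\<And>i. i < N \<Longrightarrow> basis_list (ls i) (W i)" and W: "\<And>i. i < N \<Longrightarrow> W i \<subseteq> V"
begin

lemma bs_mem: "set bs \<subseteq> V"
  using bs fspace.span_superset unfolding basis_list_def by blast

lemma Q_carrier: "Q \<in> carrier_mat (length bs) (length bs)"
proof -
  have *: "0\<^sub>v (length bs) \<in> carrier_vec (length bs)" by simp
  have "additive_schwarz (gram_mat b bs) (inclusion_mat bs cs)
      (map (\<lambda>i. inclusion_mat bs (ls i)) [0..<N]) \<in> carrier_mat (length bs) (length bs)"
    by (rule additive_schwarz_carrier)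
      (use subspace_solver_projection(1)[OF bs cs W0 *] subspace_solver_projection(1)[OF bs ls W *] in auto)
  then show ?thesis unfolding Q_def by (rule mult_carrier_mat) simp
qed

text \<open>On functions, \<open>Q\<close> is the sum of the \<open>b\<close>-orthogonal projections
  onto \<open>W0\<close> and the \<open>W i\<close>. Symmetry and the eigenvalue bounds see
  \<open>Q\<close> only through this description.\<close>

lemma Q_decomposition:
  assumes x: "x \<in> carrier_vec (length bs)"
  obtains u0 u where "u0 \<in> W0" "\<And>i. i < N \<Longrightarrow> u i \<in> W i"
    "vec_fun bs (Q *\<^sub>v x) = u0 + (\<Sum>i<N. u i)"
    "\<And>w. w \<in> W0 \<Longrightarrow> b u0 w = b (vec_fun bs x) w"
    "\<And>i w. i < N \<Longrightarrow> w \<in> W i \<Longrightarrow> b (u i) w = b (vec_fun bs x) w"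
proof
  let ?B = "gram_mat b bs"
  let ?u = "\<lambda>us. vec_fun bs (subspace_solver ?B (inclusion_mat bs us) *\<^sub>v (?B *\<^sub>v x))"
  note p0 = subspace_solver_projection[OF bs cs W0 x]
    and p = subspace_solver_projection[OF bs ls W x]
  show "?u cs \<in> W0" "\<And>w. w \<in> W0 \<Longrightarrow> b (?u cs) w = b (vec_fun bs x) w"
    using p0 by auto
  show "\<And>i. i < N \<Longrightarrow> ?u (ls i) \<in> W i"
    "\<And>i w. i < N \<Longrightarrow> w \<in> W i \<Longrightarrow> b (?u (ls i)) w = b (vec_fun bs x) w"
    using p by auto
  let ?Es = "map (\<lambda>i. inclusion_mat bs (ls i)) [0..<N]"
  have Es: "subspace_solver ?B E \<in> carrier_mat (length bs) (length bs)" if "E \<in> set ?Es" for E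
    using that p(1) by auto
  have Bx: "?B *\<^sub>v x \<in> carrier_vec (length bs)" by (rule mult_mat_vec_carrier[OF gram_mat_carrier x])
  have "Q *\<^sub>v x = additive_schwarz ?B (inclusion_mat bs cs) ?Es *\<^sub>v (?B *\<^sub>v x)"
    unfolding Q_def
    by (rule assoc_mult_mat_vec[OF additive_schwarz_carrier[OF p0(1) Es] gram_mat_carrier x])
  then show "vec_fun bs (Q *\<^sub>v x) = ?u cs + (\<Sum>i<N. ?u (ls i))"
    using vec_fun_additive_schwarz[where Es = ?Es, OF p0(1) Es Bx] by (simp cong: sum.cong_simp)
qed

text \<open>Testing each projection of one vector against the matching projection of the other turns
  both sides into \<open>b u0 v0 + (\<Sum>i<N. b (u i) (v i))\<close>.\<close>

lemma Q_symmetric: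
  assumes x: "x \<in> carrier_vec (length bs)" and y: "y \<in> carrier_vec (length bs)"
  shows "b (vec_fun bs (Q *\<^sub>v x)) (vec_fun bs y) = b (vec_fun bs x) (vec_fun bs (Q *\<^sub>v y))"
proof -
  from Q_decomposition[OF x] obtain u0 u where u: "u0 \<in> W0" "\<And>i. i < N \<Longrightarrow> u i \<in> W i"
    "vec_fun bs (Q *\<^sub>v x) = u0 + (\<Sum>i<N. u i)"
    "\<And>w. w \<in> W0 \<Longrightarrow> b u0 w = b (vec_fun bs x) w"
    "\<And>i w. i < N \<Longrightarrow> w \<in> W i \<Longrightarrow> b (u i) w = b (vec_fun bs x) w" by metis
  from Q_decomposition[OF y] obtain v0 v where v: "v0 \<in> W0" "\<And>i. i < N \<Longrightarrow> v i \<in> W i"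
    "vec_fun bs (Q *\<^sub>v y) = v0 + (\<Sum>i<N. v i)"
    "\<And>w. w \<in> W0 \<Longrightarrow> b v0 w = b (vec_fun bs y) w"
    "\<And>i w. i < N \<Longrightarrow> w \<in> W i \<Longrightarrow> b (v i) w = b (vec_fun bs y) w" by metis
  have V: "u0 \<in> V" "v0 \<in> V" "\<And>i. i < N \<Longrightarrow> u i \<in> V" "\<And>i. i < N \<Longrightarrow> v i \<in> V"
    "vec_fun bs x \<in> V" "vec_fun bs y \<in> V"
    using u v W0 W vec_fun_mem[OF bs_mem] by blast+
  have "b (vec_fun bs (Q *\<^sub>v x)) (vec_fun bs y) = b u0 (vec_fun bs y) + (\<Sum>i<N. b (u i) (vec_fun bs y))"
    unfolding u(3) by (rule add_sum_left) (use V in auto)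
  also have "\<dots> = b u0 v0 + (\<Sum>i<N. b (u i) (v i))"
    using v(4)[OF u(1)] v(5)[OF _ u(2)] V by (simp add: sym[of _ "vec_fun bs y"] sym[of v0] sym[of "v _"])
  also have "\<dots> = b (vec_fun bs x) v0 + (\<Sum>i<N. b (vec_fun bs x) (v i))"
    using u(4)[OF v(1)] u(5)[OF _ v(2)] by simp
  also have "\<dots> = b (vec_fun bs x) (vec_fun bs (Q *\<^sub>v y))"
    unfolding v(3) by (rule add_sum_right[symmetric]) (use V in auto)
  finally show ?thesis .
qed

lemma vec_fun_nonzero:
  assumes "x \<in> carrier_vec (length bs)" "x \<noteq> 0\<^sub>v (length bs)"
  shows "0 < b (vec_fun bs x) (vec_fun bs x)"
  using definite_pos vec_fun_mem[OF bs_mem] vec_fun_eq_0[OF bs assms(1)] assms(2) by blast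

text \<open>The \<open>spectrum\<close> of a real matrix collects real eigenvalues only and could be
  empty. A complex eigenvalue always exists, and symmetry of \<open>Q\<close> with respect to
  \<open>b\<close> forces it to be real; then the real or the imaginary part of the eigenvector
  serves as a real one.\<close>

lemma spectrum_nonempty:
  assumes "bs \<noteq> []"
  shows "spectrum Q \<noteq> {}"
proof -
  let ?n = "length bs" and ?f = "vec_fun bs"
  define Qc where "Qc = map_mat complex_of_real Q"
  have Qc: "Qc \<in> carrier_mat ?n ?n" using Q_carrier by (simp add: Qc_def)
  obtain \<mu> z where z: "z \<in> carrier_vec ?n" "z \<noteq> 0\<^sub>v ?n" "Qc *\<^sub>v z = \<mu> \<cdot>\<^sub>v z"
    using spectrum_non_empty[OF Qc] assms Qc
    by (auto simp: spectrum_def eigenvalue_def eigenvector_def)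
  define x y where "x = map_vec Re z" and "y = map_vec Im z"
  have x: "x \<in> carrier_vec ?n" and y: "y \<in> carrier_vec ?n" using z(1) by (auto simp: x_def y_def)
  have ri: "Re ((Qc *\<^sub>v z) $ i) = (Q *\<^sub>v x) $ i" "Im ((Qc *\<^sub>v z) $ i) = (Q *\<^sub>v y) $ i" if "i < ?n" for i
    using that Q_carrier z(1) by (auto simp: Qc_def x_def y_def scalar_prod_def)
  have Qx: "Q *\<^sub>v x = Re \<mu> \<cdot>\<^sub>v x + (- Im \<mu>) \<cdot>\<^sub>v y"
    using z ri Q_carrier x y by (intro eq_vecI) (auto simp: x_def y_def simp flip: ri)
  have Qy: "Q *\<^sub>v y = Re \<mu> \<cdot>\<^sub>v y + Im \<mu> \<cdot>\<^sub>v x"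
    using z ri Q_carrier x y by (intro eq_vecI) (auto simp: x_def y_def simp flip: ri)
  have V: "?f x \<in> V" "?f y \<in> V" using vec_fun_mem[OF bs_mem] by auto
  have "b (?f (Q *\<^sub>v x)) (?f y) = Re \<mu> * b (?f x) (?f y) - Im \<mu> * b (?f y) (?f y)"
    unfolding Qx using x y V scale_left[of _ _ "- Im \<mu>"]
    by (simp add: vec_fun_add vec_fun_smult add_left mem_scale scale_left mem_scale[of _ "- Im \<mu>", simplified])
  moreover have "b (?f x) (?f (Q *\<^sub>v y)) = Re \<mu> * b (?f x) (?f y) + Im \<mu> * b (?f x) (?f x)"
    unfolding Qy using x y V
    by (simp add: vec_fun_add vec_fun_smult add_right mem_scale scale_right)
  \<comment> \<open>The two sides of the symmetry relation for \<open>x\<close> and \<open>y\<close>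
    differ by exactly this product.\<close>
  ultimately have "Im \<mu> * (b (?f x) (?f x) + b (?f y) (?f y)) = 0"
    using Q_symmetric[OF x y] by (simp add: algebra_simps)
  moreover have "x \<noteq> 0\<^sub>v ?n \<or> y \<noteq> 0\<^sub>v ?n"
  proof (rule ccontr)
    assume "\<not> ?thesis"
    then have "Re (z $ i) = 0" "Im (z $ i) = 0" if "i < ?n" for i
      using that z(1) by (auto simp: x_def y_def dest!: arg_cong[where f = "\<lambda>v. v $ i"])
    then have "z = 0\<^sub>v ?n" using z(1) by (intro eq_vecI) (auto simp: complex_eq_iff)
    then show False using z(2) by simp
  qed
  moreover have "0 \<le> b (?f x) (?f x)" "0 \<le> b (?f y) (?f y)" using nonneg V by auto
  ultimately have "Im \<mu> = 0" "x \<noteq> 0\<^sub>v ?n \<or> y \<noteq> 0\<^sub>v ?n"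
    using vec_fun_nonzero[OF x] vec_fun_nonzero[OF y] by (auto simp: add_nonneg_eq_0_iff)
  then have "eigenvector Q x (Re \<mu>) \<or> eigenvector Q y (Re \<mu>)"
    using Qx Qy x y Q_carrier by (auto simp: eigenvector_def)
  then show ?thesis by (auto simp: spectrum_def eigenvalue_def)
qed

text \<open>For an eigenfunction \<open>v\<close>, the energies of its projections add up to
  \<open>\<mu> * b v v\<close>. Comparing this sum with the energy of \<open>Q v\<close>, which is
  \<open>\<mu>\<^sup>2 * b v v\<close>, gives the upper bound; pairing the projections with the
  parts of a stable decomposition of \<open>v\<close> gives the lower one.\<close>

lemma spectrum_bounds:
  assumes lam: "\<mu> \<in> spectrum Q"
    and upper: "\<And>u0 u. u0 \<in> W0 \<Longrightarrow> (\<And>i. i < N \<Longrightarrow> u i \<in> W i) \<Longrightarrow>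
      b (u0 + (\<Sum>i<N. u i)) (u0 + (\<Sum>i<N. u i)) \<le> C1 * (b u0 u0 + (\<Sum>i<N. b (u i) (u i)))"
    and lower: "\<And>v. v \<in> V \<Longrightarrow> \<exists>u0 u. u0 \<in> W0 \<and> (\<forall>i<N. u i \<in> W i) \<and> v = u0 + (\<Sum>i<N. u i) \<and>
      b u0 u0 + (\<Sum>i<N. b (u i) (u i)) \<le> C0 * b v v"
    and C0: "0 < C0"
  shows "1 / C0 \<le> \<mu>" "\<mu> \<le> C1"
proof -
  obtain x where "eigenvector Q x \<mu>" using lam by (auto simp: spectrum_def eigenvalue_def)
  then have x: "x \<in> carrier_vec (length bs)" "x \<noteq> 0\<^sub>v (length bs)" "Q *\<^sub>v x = \<mu> \<cdot>\<^sub>v x"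
    unfolding eigenvector_def carrier_matD(1)[OF Q_carrier] by blast+
  define v where "v = vec_fun bs x"
  have v: "v \<in> V" "0 < b v v" unfolding v_def using vec_fun_mem[OF bs_mem] vec_fun_nonzero x by auto
  from Q_decomposition[OF x(1)] obtain u0 u where u: "u0 \<in> W0" "\<And>i. i < N \<Longrightarrow> u i \<in> W i"
    "vec_fun bs (Q *\<^sub>v x) = u0 + (\<Sum>i<N. u i)"
    "\<And>w. w \<in> W0 \<Longrightarrow> b u0 w = b v w"
    "\<And>i w. i < N \<Longrightarrow> w \<in> W i \<Longrightarrow> b (u i) w = b v w" unfolding v_def by metis
  have V: "u0 \<in> V" "\<And>i. i < N \<Longrightarrow> u i \<in> V" using u W0 W by blast+
  have lv: "u0 + (\<Sum>i<N. u i) = (\<lambda>z. \<mu> * v z)"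
    using u(3) x vec_fun_smult[OF x(1)] by (simp add: v_def)
  define S where "S = b u0 u0 + (\<Sum>i<N. b (u i) (u i))"
  have "S = b v u0 + (\<Sum>i<N. b v (u i))"
    unfolding S_def using u(4)[OF u(1)] u(5)[OF _ u(2)] by simp
  also have "\<dots> = b v (u0 + (\<Sum>i<N. u i))"
    by (rule add_sum_right[symmetric]) (use V v in auto)
  also have "\<dots> = \<mu> * b v v" unfolding lv using v by (simp add: scale_right)
  finally have S: "S = \<mu> * b v v" .
  obtain w0 w where w: "w0 \<in> W0" "\<And>i. i < N \<Longrightarrow> w i \<in> W i" "v = w0 + (\<Sum>i<N. w i)"
    "b w0 w0 + (\<Sum>i<N. b (w i) (w i)) \<le> C0 * b v v" using lower[OF v(1)] by blast
  have wV: "w0 \<in> V" "\<And>i. i < N \<Longrightarrow> w i \<in> V" using w W0 W by blast+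
  \<comment> \<open>The weight \<open>C0\<close> is chosen so that the parts of the decomposition
    contribute at most \<open>b v v\<close> in total, which is absorbed by half of
    \<open>2 * b v v\<close>.\<close>
  have young: "2 * b p q \<le> C0 * b p p + b q q / C0" if "p \<in> V" "q \<in> V" for p q
  proof -
    have "0 \<le> C0 * (b p p - 2 * (1 / C0) * b p q + (1 / C0)\<^sup>2 * b q q)"
      by (intro mult_nonneg_nonneg square_diff_scale[OF that]) (use C0 in simp)
    also have "\<dots> = C0 * b p p - 2 * b p q + b q q / C0"
      using C0 by (simp add: field_simps power2_eq_square)
    finally show ?thesis by simp
  qed
  have "b v v = b v (w0 + (\<Sum>i<N. w i))" by (rule arg_cong[OF w(3)])
  also have "\<dots> = b v w0 + (\<Sum>i<N. b v (w i))" by (rule add_sum_right) (use wV v in auto)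
  also have "\<dots> = b u0 w0 + (\<Sum>i<N. b (u i) (w i))"
    using u(4)[OF w(1)] u(5)[OF _ w(2)] by simp
  finally have "2 * b v v = 2 * b u0 w0 + (\<Sum>i<N. 2 * b (u i) (w i))"
    by (simp add: sum_distrib_left)
  also have "\<dots> \<le> (C0 * b u0 u0 + b w0 w0 / C0) + (\<Sum>i<N. C0 * b (u i) (u i) + b (w i) (w i) / C0)"
    by (intro add_mono sum_mono young) (use V wV in auto)
  also have "\<dots> = C0 * S + (b w0 w0 + (\<Sum>i<N. b (w i) (w i))) / C0"
    by (simp add: S_def sum.distrib sum_distrib_left sum_divide_distrib distrib_left add_divide_distrib)
  also have "\<dots> \<le> C0 * S + b v v"
    using w(4) C0 by (simp add: pos_divide_le_eq mult.commute)
  finally have "b v v \<le> C0 * \<mu> * b v v" by (simp add: S)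
  then have "1 \<le> C0 * \<mu>" using v(2) by (simp add: mult_le_cancel_right1)
  then show low: "1 / C0 \<le> \<mu>" using C0 by (simp add: pos_divide_le_eq mult.commute)
  \<comment> \<open>The lower bound already gives positivity, which allows one factor
    \<open>\<mu>\<close> to be cancelled in the upper estimate.\<close>
  have lpos: "0 < \<mu>" by (rule less_le_trans[OF _ low]) (use C0 in simp)
  have "\<mu> * (\<mu> * b v v) = b (u0 + (\<Sum>i<N. u i)) (u0 + (\<Sum>i<N. u i))"
    unfolding lv using v mem_scale by (simp add: scale_left scale_right)
  also have "\<dots> \<le> C1 * (\<mu> * b v v)" unfolding S[symmetric] S_def by (rule upper[OF u(1,2)])
  finally show "\<mu> \<le> C1" using lpos v(2) by (simp add: mult_le_cancel_right)
qed

text \<open>\<open>Min\<close> and \<open>Max\<close> are eigenvalues because the spectrum is finite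
  and nonempty. Positivity of the minimum is part of the conclusion, so that the quotient is a
  genuine condition number.\<close>

lemma cond_number_bound:
  assumes "bs \<noteq> []"
    and upper: "\<And>u0 u. u0 \<in> W0 \<Longrightarrow> (\<And>i. i < N \<Longrightarrow> u i \<in> W i) \<Longrightarrow>
      b (u0 + (\<Sum>i<N. u i)) (u0 + (\<Sum>i<N. u i)) \<le> C1 * (b u0 u0 + (\<Sum>i<N. b (u i) (u i)))"
    and lower: "\<And>v. v \<in> V \<Longrightarrow> \<exists>u0 u. u0 \<in> W0 \<and> (\<forall>i<N. u i \<in> W i) \<and> v = u0 + (\<Sum>i<N. u i) \<and>
      b u0 u0 + (\<Sum>i<N. b (u i) (u i)) \<le> C0 * b v v"
    and C0: "0 < C0"
  shows "0 < Min (spectrum Q)" "cond_number Q \<le> C1 * C0"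
proof -
  note bounds = spectrum_bounds[OF _ upper lower C0]
  have fin: "finite (spectrum Q)" using card_finite_spectrum(1)[OF Q_carrier] .
  note ne = spectrum_nonempty[OF assms(1)]
  have Min: "1 / C0 \<le> Min (spectrum Q)" and Max: "Max (spectrum Q) \<le> C1"
    using Min_in[OF fin ne] Max_in[OF fin ne] bounds by blast+
  show pos: "0 < Min (spectrum Q)" by (rule less_le_trans[OF _ Min]) (use C0 in simp)
  have "Min (spectrum Q) \<le> Max (spectrum Q)" using Min_le[OF fin Max_in[OF fin ne]] .
  then have "0 < C1" using pos Max by simp
  have "Max (spectrum Q) / Min (spectrum Q) \<le> C1 / (1 / C0)"
    by (rule frac_le) (use Min Max \<open>0 < C1\<close> C0 in auto)
  then show "cond_number Q \<le> C1 * C0" by (simp add: cond_number_def)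
qed

end

section \<open>Conforming meshes and nodal interpolation\<close>

lemma gderiv_unique: "GDERIV u x :> a \<Longrightarrow> GDERIV u x :> b \<Longrightarrow> a = b"
proof -
  assume a: "GDERIV u x :> a" "GDERIV u x :> b"
  then have "(\<lambda>h. inner h a) = (\<lambda>h. inner h b)" unfolding gderiv_def by (rule has_derivative_unique)
  then have "inner (a - b) (a - b) = 0" by (metis inner_diff_right right_minus_eq)
  then show ?thesis by simp
qed

lemma grad_eq: "GDERIV u x :> g \<Longrightarrow> grad u x = g"
  unfolding grad_def using gderiv_unique by blast

lemma gderiv_open_affine:
  assumes "open U" "x \<in> U" "\<And>y. y \<in> U \<Longrightarrow> u y = inner b y + c"
  shows "GDERIV u x :> b"
proof -
  have "((\<lambda>y. inner b y + c) has_derivative (\<lambda>h. inner h b)) (at x)"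
    by (auto intro!: derivative_eq_intros simp: inner_commute)
  then show ?thesis unfolding gderiv_def
    by (rule has_derivative_transform_within_open[OF _ assms(1,2)]) (simp add: assms(3))
qed

locale mesh =
  fixes \<Omega> :: "'a::euclidean_space set" and \<T> :: "'a set set"
  assumes fine_mesh: "fine_mesh \<Omega> \<T>"
begin

lemma finite_mesh: "finite \<T>" and simplex: "T \<in> \<T> \<Longrightarrow> int DIM('a) simplex T"
  and face: "T \<in> \<T> \<Longrightarrow> T' \<in> \<T> \<Longrightarrow> (T \<inter> T') face_of T" and interior_Union: "interior (\<Union>\<T>) = \<Omega>"
  using fine_mesh by (auto simp: fine_mesh_def triangulation_def)

lemma face': "T \<in> \<T> \<Longrightarrow> T' \<in> \<T> \<Longrightarrow> (T \<inter> T') face_of T'"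
  using face[of T' T] by (simp add: Int_commute)

lemma convex_T: "T \<in> \<T> \<Longrightarrow> convex T" and compact_T: "T \<in> \<T> \<Longrightarrow> compact T" and closed_T: "T \<in> \<T> \<Longrightarrow> closed T"
  and aff_dim_T: "T \<in> \<T> \<Longrightarrow> aff_dim T = DIM('a)"
  using simplex convex_simplex compact_simplex closed_simplex aff_dim_simplex by blast+

lemma interior_T: "T \<in> \<T> \<Longrightarrow> interior T \<noteq> {}"
  by (metis aff_dim_T aff_dim_eq_full aff_dim_empty convex_T interior_rel_interior of_nat_0_le_iff
      rel_interior_eq_empty neg_0_le_iff_le not_one_le_zero)

lemma closure_interior_T: "T \<in> \<T> \<Longrightarrow> closure (interior T) = T"
  using convex_closure_interior[OF convex_T interior_T] closed_T by auto

text \<open>By conformity the intersection is a face of both elements. It is not all of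
  \<open>T\<close>, since a face of \<open>T'\<close> other than \<open>T'\<close> has smaller
  dimension; and a face of \<open>T\<close> other than \<open>T\<close> misses the interior of
  \<open>T\<close>.\<close>

lemma interior_T_disjoint:
  assumes "T \<in> \<T>" "T' \<in> \<T>" "T \<noteq> T'"
  shows "interior T \<inter> T' = {}"
proof (cases "T \<inter> T' = T")
  case True
  then have "T face_of T'" using face' assms by metis
  then have "aff_dim T < aff_dim T'" using face_of_aff_dim_lt convex_T assms by blast
  then show ?thesis using aff_dim_T assms by simp
next
  case False
  then have "T \<inter> T' \<inter> interior T = {}" using face_of_disjoint_interior face assms by blast
  then show ?thesis using interior_subset by blast
qed

lemma compact_Union: "compact (\<Union>\<T>)"
  using finite_mesh compact_T by (rule compact_Union)

lemma open_Omega: "open \<Omega>" using interior_Union by auto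

lemma interior_subset_Omega: "T \<in> \<T> \<Longrightarrow> interior T \<subseteq> \<Omega>"
  using interior_Union interior_mono[of T "\<Union>\<T>"] by auto

lemma Omega_subset: "\<Omega> \<subseteq> \<Union>\<T>" using interior_Union interior_subset by auto

lemma closure_Omega: "closure \<Omega> = \<Union>\<T>"
proof
  show "closure \<Omega> \<subseteq> \<Union>\<T>" using Omega_subset compact_Union compact_imp_closed closure_minimal by blast
  show "\<Union>\<T> \<subseteq> closure \<Omega>"
    by (rule Union_least) (metis closure_interior_T closure_mono interior_subset_Omega)
qed

lemma frontier_Omega: "frontier \<Omega> = \<Union>\<T> - \<Omega>"
  using closure_Omega open_Omega by (simp add: frontier_def interior_open)

text \<open>Around each of these points every finite element function is affine, and what is left of
  the mesh is negligible. Almost-everywhere statements are proved by restricting to this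
  set.\<close>

definition mesh_interior :: "'a set" where "mesh_interior = (\<Union>T\<in>\<T>. interior T)"

lemma mesh_interiorE:
  assumes "x \<in> mesh_interior" obtains T where "T \<in> \<T>" "x \<in> interior T"
  using assms unfolding mesh_interior_def by auto

lemma mesh_interior_subset: "mesh_interior \<subseteq> \<Omega>"
  unfolding mesh_interior_def using interior_subset_Omega by auto

lemma negligible_skeleton: "negligible (\<Union>\<T> - mesh_interior)"
proof -
  have "negligible (\<Union>T\<in>\<T>. frontier T)"
    by (rule negligible_Union) (use finite_mesh convex_T negligible_convex_frontier in auto)
  moreover have "\<Union>\<T> - mesh_interior \<subseteq> (\<Union>T\<in>\<T>. frontier T)"
    unfolding mesh_interior_def frontier_def using closure_subset by blast
  ultimately show ?thesis by (rule negligible_subset)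
qed

section \<open>Unions of elements\<close>

definition mesh_union :: "'a set \<Rightarrow> bool" where
  "mesh_union S \<longleftrightarrow> S = \<Union>{T\<in>\<T>. T \<subseteq> S}"

lemma mesh_unionI: "A \<subseteq> \<T> \<Longrightarrow> mesh_union (\<Union>A)" unfolding mesh_union_def by blast

lemma mesh_union_add_layers: "mesh_union S \<Longrightarrow> mesh_union (add_layers \<T> l S)"
  by (cases l) (auto intro!: mesh_unionI)

lemma mesh_union_subset: "mesh_union S \<Longrightarrow> S \<subseteq> \<Union>\<T>" unfolding mesh_union_def by blast

lemma mesh_unionE:
  assumes "mesh_union S" "x \<in> S" obtains T where "T \<in> \<T>" "T \<subseteq> S" "x \<in> T"
  using assms unfolding mesh_union_def by blast

text \<open>A union of elements cannot cut through an element. This puts almost every point either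
  inside a coarse element or subdomain, or in an open set disjoint from it.\<close>

lemma mesh_union_cases:
  assumes "mesh_union S" "T \<in> \<T>"
  shows "interior T \<subseteq> interior S \<or> interior T \<inter> S = {}"
proof (cases "T \<subseteq> S")
  case True then show ?thesis using interior_mono by blast
next
  case False
  have "interior T \<inter> T' = {}" if "T' \<in> \<T>" "T' \<subseteq> S" for T'
    using interior_T_disjoint[OF assms(2) that(1)] that False by blast
  then show ?thesis using assms(1) unfolding mesh_union_def by blast
qed

lemma mesh_union_closed: "mesh_union S \<Longrightarrow> closed S"
  unfolding mesh_union_def
  by (erule ssubst) (intro closed_Union, use finite_mesh closed_T in auto)

lemma mesh_union_interior_subset: "mesh_union S \<Longrightarrow> interior S \<subseteq> \<Omega>"
  using interior_mono[OF mesh_union_subset] interior_Union by blast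

text \<open>By conformity, an element that contains a point \<open>y\<close> of the open segment also contains \<open>z\<close>; the
  homothety with centre \<open>z\<close> that takes \<open>y\<close> to \<open>x\<close> therefore maps the star of \<open>y\<close> into \<open>S\<close>.\<close>

lemma interior_open_segment:
  assumes S: "mesh_union S" and T: "T \<in> \<T>" "v \<in> T" "z \<in> T" and v: "v \<in> interior S"
    and x: "x \<in> open_segment v z"
  shows "x \<in> interior S"
proof -
  obtain m where m: "0 < m" "m < 1" "x = (1 - m) *\<^sub>R v + m *\<^sub>R z" and vz: "v \<noteq> z"
    using x by (auto simp: in_segment)
  obtain e where e: "e > 0" "ball v e \<subseteq> S" using v by (auto simp: mem_interior)
  \<comment> \<open>\<open>t \<le> m\<close> keeps \<open>y\<close> from passing beyond
    \<open>x\<close>; the other bound keeps it in the ball around \<open>v\<close> inside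
    \<open>S\<close>.\<close>
  define t where "t = min m (e / (2 * norm (z - v)))"
  have t: "0 < t" "t \<le> m" "t < 1" using m e vz by (auto simp: t_def)
  have "t * norm (z - v) \<le> e / (2 * norm (z - v)) * norm (z - v)"
    by (rule mult_right_mono) (auto simp: t_def)
  also have "\<dots> < e" using e vz by simp
  finally have te: "t * norm (z - v) < e" .
  define y where "y = (1 - t) *\<^sub>R v + t *\<^sub>R z"
  have "y - v = t *\<^sub>R (z - v)" by (simp add: y_def algebra_simps)
  then have "norm (y - v) = t * norm (z - v)" using t by simp
  then have y_ball: "y \<in> ball v e" using te by (simp add: dist_norm norm_minus_commute[of v y])
  have y_seg: "y \<in> open_segment v z" using t vz by (auto simp: in_segment y_def)
  have yT: "y \<in> T" using convex_T[OF T(1)] T t unfolding y_def by (intro convexD) auto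
  have z: "z \<in> T'" if "T' \<in> \<T>" "y \<in> T'" for T'
    using face[OF T(1) that(1)] y_seg yT that T unfolding face_of_def by blast
  \<comment> \<open>These are finitely many closed sets, so a small ball around \<open>y\<close>
    meets only elements that contain \<open>y\<close>, and hence \<open>z\<close>.\<close>
  define A where "A = {T'\<in>\<T>. y \<notin> T'}"
  have "open (ball v e - \<Union>A)"
    unfolding A_def by (intro open_Diff closed_Union) (use finite_mesh closed_T in auto)
  moreover have "y \<in> ball v e - \<Union>A" using y_ball by (auto simp: A_def)
  ultimately obtain r where r: "r > 0" "ball y r \<subseteq> ball v e - \<Union>A"
    by (meson open_contains_ball)
  define k where "k = (1 - m) / (1 - t)"
  have k: "0 < k" "k \<le> 1" using m t by (auto simp: k_def divide_simps)
  have kt: "k * (1 - t) = 1 - m" using t by (simp add: k_def)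
  have kt': "k * t + (1 - k) = m" using kt by (simp add: algebra_simps)
  have x_eq: "x = k *\<^sub>R y + (1 - k) *\<^sub>R z"
  proof -
    have "k *\<^sub>R y + (1 - k) *\<^sub>R z = (k * (1 - t)) *\<^sub>R v + (k * t + (1 - k)) *\<^sub>R z"
      by (simp add: y_def algebra_simps)
    then show ?thesis using m(3) by (simp only: kt kt')
  qed
  have "ball x (k * r) \<subseteq> S"
  proof
    fix p assume p: "p \<in> ball x (k * r)"
    define q where "q = y + (1 / k) *\<^sub>R (p - x)"
    have "norm ((1 / k) *\<^sub>R (p - x)) < r"
      unfolding norm_scaleR using p k
      by (simp add: dist_norm norm_minus_commute[of x p] pos_divide_less_eq mult.commute)
    then have "q \<in> ball y r" by (simp add: q_def dist_norm)
    then have "q \<in> S" "q \<notin> \<Union>A" using r e by auto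
    then obtain T' where T': "T' \<in> \<T>" "T' \<subseteq> S" "q \<in> T'" using mesh_unionE[OF S] by blast
    then have "y \<in> T'" using \<open>q \<notin> \<Union>A\<close> by (auto simp: A_def)
    then have "z \<in> T'" using z T' by blast
    then have "k *\<^sub>R q + (1 - k) *\<^sub>R z \<in> T'" using convex_T[OF T'(1)] T' k by (intro convexD) auto
    also have "k *\<^sub>R q + (1 - k) *\<^sub>R z = p"
      using k by (simp add: q_def x_eq algebra_simps)
    finally show "p \<in> S" using T' by blast
  qed
  then show ?thesis using k r by (meson mem_interior mult_pos_pos)
qed

section \<open>Nodal values and nodal interpolation\<close>

lemma Vh_affine:
  assumes "u \<in> Vh \<T>" "T \<in> \<T>" obtains b c where "\<And>x. x \<in> T \<Longrightarrow> u x = inner b x + c"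
  using assms unfolding Vh_def by auto

lemma simplex_vertices:
  assumes "T \<in> \<T>"
  obtains C where "finite C" "\<not> affine_dependent C" "T = convex hull C" "C \<noteq> {}"
    "\<And>p. p extreme_point_of T \<longleftrightarrow> p \<in> C"
proof -
  obtain C where C: "finite C" "\<not> affine_dependent C" "T = convex hull C"
    using simplex[OF assms] unfolding Polytope.simplex by blast
  moreover have "C \<noteq> {}" using interior_T[OF assms] C by auto
  moreover have "p extreme_point_of T \<longleftrightarrow> p \<in> C" for p
    using extreme_point_of_convex_hull_affine_independent C by auto
  ultimately show ?thesis using that by blast
qed

lemma vertices_extreme: "T \<in> \<T> \<Longrightarrow> p extreme_point_of T \<Longrightarrow> p \<in> vertices \<T>"
  unfolding vertices_def by blast

lemma affine_eq_on_hull: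
  fixes b b' :: 'a
  assumes "\<And>p. p \<in> C \<Longrightarrow> inner b p + c = inner b' p + c'" "x \<in> convex hull C"
  shows "inner b x + c = inner b' x + c'"
proof -
  have "convex {x. inner (b - b') x = c' - c}" by (rule convex_hyperplane)
  moreover have "C \<subseteq> {x. inner (b - b') x = c' - c}" using assms(1) by (auto simp: inner_diff_left algebra_simps)
  ultimately have "x \<in> {x. inner (b - b') x = c' - c}" using assms(2) hull_minimal by blast
  then show ?thesis by (simp add: inner_diff_left algebra_simps)
qed

lemma Vh_eqI:
  assumes u: "u \<in> Vh \<T>" and w: "w \<in> Vh \<T>" and eq: "\<And>p. p \<in> vertices \<T> \<Longrightarrow> u p = w p"
  shows "u = w"
proof
  fix x show "u x = w x"
  proof (cases "x \<in> \<Union>\<T>")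
    case True
    then obtain T where T: "T \<in> \<T>" "x \<in> T" by blast
    obtain C where C: "T = convex hull C" "\<And>p. p extreme_point_of T \<longleftrightarrow> p \<in> C"
      using simplex_vertices[OF T(1)] by metis
    obtain b c where bc: "\<And>x. x \<in> T \<Longrightarrow> u x = inner b x + c" using Vh_affine[OF u T(1)] by blast
    obtain b' c' where bc': "\<And>x. x \<in> T \<Longrightarrow> w x = inner b' x + c'" using Vh_affine[OF w T(1)] by blast
    have "inner b p + c = inner b' p + c'" if "p \<in> C" for p
      using eq[OF vertices_extreme[OF T(1)]] C that bc bc' hull_subset by (metis subsetD)
    then show ?thesis using affine_eq_on_hull[of C b c b' c' x] C T bc bc' by auto
  next
    case False then show ?thesis using u w by (simp add: Vh_def)
  qed
qed

text \<open>The vertices are affinely independent, so their differences from one vertex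
  \<open>a\<close> are linearly independent and carry a linear functional \<open>g\<close> with
  prescribed values. Its representing vector is \<open>adjoint g 1\<close>.\<close>

lemma affine_interpolant:
  assumes T: "T \<in> \<T>"
  shows "\<exists>b c. \<forall>p. p extreme_point_of T \<longrightarrow> inner b p + c = f p"
proof -
  obtain C where C: "finite C" "\<not> affine_dependent C" "T = convex hull C" "C \<noteq> {}"
    "\<And>p. p extreme_point_of T \<longleftrightarrow> p \<in> C" using simplex_vertices[OF T] by metis
  obtain a where a: "a \<in> C" using C by blast
  have "independent ((\<lambda>x. x - a) ` (C - {a}))"
    using affine_dependent_iff_dependent2[OF a] C(2) by (simp add: dependent_raw_def)
  then obtain g where g: "linear g" "\<forall>x\<in>(\<lambda>x. x - a) ` (C - {a}). g x = f (x + a) - f a"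
    using linear_independent_extend[of _ "\<lambda>x. f (x + a) - f a"] by blast
  have "inner (adjoint g 1) p + (f a - g a) = f p" if "p \<in> C" for p
  proof (cases "p = a")
    case True then show ?thesis using adjoint_works[OF g(1), of p 1] by (simp add: inner_commute)
  next
    case False
    then have "g (p - a) = f p - f a" using g(2) that by force
    then show ?thesis using adjoint_works[OF g(1), of p 1] linear_diff[OF g(1)] by (simp add: inner_commute)
  qed
  then show ?thesis using C(5) by blast
qed

text \<open>The affine pieces glue: a common face of two elements is the convex hull of its extreme
  points, which are vertices of both elements, and there the pieces agree. Continuity follows from
  the finite closed cover by elements.\<close>

lemma nodal_interp_exists: "\<exists>w. w \<in> Vh \<T> \<and> (\<forall>p\<in>vertices \<T>. w p = v p)"
proof -
  have "\<forall>T. \<exists>b c. T \<in> \<T> \<longrightarrow> (\<forall>p. p extreme_point_of T \<longrightarrow> inner b p + c = v p)"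
    using affine_interpolant by blast
  then obtain b c where bc: "\<And>T p. T \<in> \<T> \<Longrightarrow> p extreme_point_of T \<Longrightarrow> inner (b T) p + c T = v p"
    by metis
  define w where "w x = (if x \<in> \<Union>\<T> then let T = (SOME T. T \<in> \<T> \<and> x \<in> T) in inner (b T) x + c T else 0)" for x
  have agree: "inner (b T) x + c T = inner (b T') x + c T'"
    if T: "T \<in> \<T>" "T' \<in> \<T>" "x \<in> T" "x \<in> T'" for T T' x
  proof -
    let ?F = "T \<inter> T'"
    have "compact ?F" "convex ?F" using compact_T convex_T T by (auto intro: compact_Int convex_Int)
    then have "?F = convex hull {p. p extreme_point_of ?F}" by (rule Krein_Milman_Minkowski)
    then have "x \<in> convex hull {p. p extreme_point_of ?F}" using T by blast
    then show ?thesis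
    proof (rule affine_eq_on_hull[rotated])
      fix p assume "p \<in> {p. p extreme_point_of ?F}"
      then have "p extreme_point_of T" "p extreme_point_of T'"
        using extreme_point_of_face[OF face] extreme_point_of_face[OF face'] T by blast+
      then show "inner (b T) p + c T = inner (b T') p + c T'" using bc T by simp
    qed
  qed
  have w: "w x = inner (b T) x + c T" if "T \<in> \<T>" "x \<in> T" for T x
  proof -
    have "(SOME T. T \<in> \<T> \<and> x \<in> T) \<in> \<T> \<and> x \<in> (SOME T. T \<in> \<T> \<and> x \<in> T)" by (rule someI2[of _ T]) (use that in auto)
    then show ?thesis using agree[of T "SOME T. T \<in> \<T> \<and> x \<in> T" x] that by (auto simp: w_def Let_def)
  qed
  have "continuous_on (\<Union>T\<in>\<T>. T) w"
  proof (rule continuous_on_closed_Union[OF finite_mesh closed_T])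
    fix T assume "T \<in> \<T>"
    then show "continuous_on T w"
      using w by (subst continuous_on_cong[OF refl, of T w "\<lambda>x. inner (b T) x + c T"]) (auto intro!: continuous_intros)
  qed
  then have "w \<in> Vh \<T>" unfolding Vh_def using w by (auto simp: w_def)
  moreover have "w p = v p" if "p \<in> vertices \<T>" for p
    using that bc w unfolding vertices_def extreme_point_of_def by (smt (verit) mem_Collect_eq extreme_point_of_def)
  ultimately show ?thesis by blast
qed

lemma nodal_interp: "nodal_interp \<T> v \<in> Vh \<T>" "p \<in> vertices \<T> \<Longrightarrow> nodal_interp \<T> v p = v p"
proof -
  have "\<exists>!w. w \<in> Vh \<T> \<and> (\<forall>p\<in>vertices \<T>. w p = v p)"
    using nodal_interp_exists[of v] by (auto intro: Vh_eqI)
  from theI'[OF this] show "nodal_interp \<T> v \<in> Vh \<T>" "p \<in> vertices \<T> \<Longrightarrow> nodal_interp \<T> v p = v p"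
    unfolding nodal_interp_def by auto
qed

text \<open>Write \<open>x\<close> in barycentric coordinates of an element. A vertex in
  \<open>interior S\<close> cannot carry positive weight: otherwise \<open>x\<close> is that vertex
  or lies on an open segment from it inside the element, and so belongs to \<open>interior S\<close>
  by \<open>interior_open_segment\<close>. Only vertices where \<open>w\<close> vanishes
  remain.\<close>

lemma Vh_zero_outside:
  assumes w: "w \<in> Vh \<T>" and S: "mesh_union S"
    and zero: "\<And>p. p \<in> vertices \<T> \<Longrightarrow> p \<notin> interior S \<Longrightarrow> w p = 0"
    and x: "x \<notin> interior S"
  shows "w x = 0"
proof (cases "x \<in> \<Union>\<T>")
  case False then show ?thesis using w by (simp add: Vh_def)
next
  case True
  then obtain T where T: "T \<in> \<T>" "x \<in> T" by blast
  obtain C where C: "finite C" "T = convex hull C" "\<And>p. p extreme_point_of T \<longleftrightarrow> p \<in> C"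
    using simplex_vertices[OF T(1)] by metis
  have CT: "C \<subseteq> T" using C hull_subset by metis
  obtain l where l: "\<And>p. p \<in> C \<Longrightarrow> 0 \<le> l p" "sum l C = 1" "(\<Sum>p\<in>C. l p *\<^sub>R p) = x"
    using T(2) C unfolding C(2) convex_hull_finite[OF C(1)] by auto
  obtain b c where bc: "\<And>x. x \<in> T \<Longrightarrow> w x = inner b x + c" using Vh_affine[OF w T(1)] by blast
  have "w x = inner b (\<Sum>p\<in>C. l p *\<^sub>R p) + sum l C * c"
    unfolding l(2,3) using bc[OF T(2)] by simp
  also have "\<dots> = (\<Sum>p\<in>C. l p * (inner b p)) + sum l C * c"
    by (simp add: inner_sum_right)
  also have "\<dots> = (\<Sum>p\<in>C. l p * (inner b p + c))"
    by (simp add: distrib_left sum.distrib flip: sum_distrib_right)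
  also have "\<dots> = (\<Sum>p\<in>C. l p * w p)"
    by (intro sum.cong refl) (use bc CT in auto)
  also have "\<dots> = 0"
  proof (intro sum.neutral ballI)
    fix p assume p: "p \<in> C"
    show "l p * w p = 0"
    proof (cases "l p = 0 \<or> p \<notin> interior S")
      case True
      then show ?thesis using zero vertices_extreme T(1) C(3) p by auto
    next
      case False
      then have lp: "0 < l p" and pS: "p \<in> interior S" using l(1)[OF p] by auto
      have le: "l p \<le> 1" using member_le_sum[of p C l] p l C by auto
      have rest: "sum l (C - {p}) = 1 - l p" using l C p by (simp add: sum_diff1)
      have restx: "(\<Sum>q\<in>C - {p}. l q *\<^sub>R q) = x - l p *\<^sub>R p" using l C p by (simp add: sum_diff1)
      have "l p \<noteq> 1"
      proof
        assume 1: "l p = 1"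
        have "l q = 0" if "q \<in> C - {p}" for q
          using sum_nonneg_eq_0_iff[of "C - {p}" l] rest 1 that l(1) C(1) by auto
        then have "(\<Sum>q\<in>C - {p}. l q *\<^sub>R q) = 0" by (intro sum.neutral) auto
        then show False using restx 1 pS x by simp
      qed
      then have lp1: "l p < 1" using le by simp
      \<comment> \<open>The other vertices with renormalized weights: \<open>z\<close> is the point
        where the ray from \<open>p\<close> through \<open>x\<close> meets the opposite
        face.\<close>
      define z where "z = (\<Sum>q\<in>C - {p}. (l q / (1 - l p)) *\<^sub>R q)"
      have zx: "(1 - l p) *\<^sub>R z = x - l p *\<^sub>R p"
        using lp1 by (simp add: z_def scaleR_sum_right flip: restx)
      have "z \<in> T" unfolding z_def
      proof (rule convex_sum)
        show "(\<Sum>q\<in>C - {p}. l q / (1 - l p)) = 1"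
          using rest lp1 by (simp flip: sum_divide_distrib)
      qed (use C l CT convex_T[OF T(1)] lp1 in auto)
      have x_eq: "x = (1 - (1 - l p)) *\<^sub>R p + (1 - l p) *\<^sub>R z" using zx by simp
      have "p \<noteq> z"
      proof
        assume "p = z"
        then have "x = p" using zx by (simp add: algebra_simps)
        then show False using pS x by simp
      qed
      then have "x \<in> open_segment p z" unfolding in_segment
        using x_eq lp lp1 by (intro conjI exI[of _ "1 - l p"]) auto
      then have "x \<in> interior S" using interior_open_segment[OF S T(1) _ \<open>z \<in> T\<close> pS] CT p by blast
      then show ?thesis using x by simp
    qed
  qed
  finally show ?thesis .
qed

end

section \<open>Gradients of finite element functions\<close>

text \<open>A common carrier for finite element functions and characteristic functions. It is closed
  under products, and its members are integrable over bounded sets, also with the weight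
  \<open>\<kappa>\<close>, so the mass forms need no further integrability conditions.\<close>

definition bdd_borel :: "('a::topological_space \<Rightarrow> real) set" where
  "bdd_borel = {u. u \<in> borel_measurable borel \<and> (\<exists>B. \<forall>x. \<bar>u x\<bar> \<le> B)}"

lemma bdd_borelE:
  assumes "u \<in> bdd_borel"
  obtains B where "0 \<le> B" "\<And>x. \<bar>u x\<bar> \<le> B" "u \<in> borel_measurable borel"
proof -
  obtain B where "\<forall>x. \<bar>u x\<bar> \<le> B" "u \<in> borel_measurable borel" using assms unfolding bdd_borel_def by blast
  moreover from this have "0 \<le> B" using order_trans[OF abs_ge_zero] by blast
  ultimately show ?thesis using that by blast
qed

lemma bdd_borel_mult:
  assumes "u \<in> bdd_borel" "v \<in> bdd_borel"
  shows "(\<lambda>x. u x * v x) \<in> bdd_borel"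
proof -
  obtain A where A: "0 \<le> A" "\<And>x. \<bar>u x\<bar> \<le> A" "u \<in> borel_measurable borel" using bdd_borelE[OF assms(1)] by blast
  obtain B where B: "0 \<le> B" "\<And>x. \<bar>v x\<bar> \<le> B" "v \<in> borel_measurable borel" using bdd_borelE[OF assms(2)] by blast
  have "\<bar>u x * v x\<bar> \<le> A * B" for x unfolding abs_mult using A B by (intro mult_mono) auto
  then show ?thesis using borel_measurable_times[OF A(3) B(3)] unfolding bdd_borel_def by auto
qed

lemma subspace_bdd_borel: "fspace.subspace bdd_borel"
proof (rule fspace.subspaceI)
  show "0 \<in> bdd_borel" unfolding bdd_borel_def by (auto simp: zero_fun_def)
  show "u + v \<in> bdd_borel" if "u \<in> bdd_borel" "v \<in> bdd_borel" for u v :: "'a \<Rightarrow> real"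
    using that
  proof (elim bdd_borelE)
    fix A B assume *: "\<And>x. \<bar>u x\<bar> \<le> A" "u \<in> borel_measurable borel"
      "\<And>x. \<bar>v x\<bar> \<le> B" "v \<in> borel_measurable borel"
    have "\<bar>u x + v x\<bar> \<le> A + B" for x using *(1)[of x] *(3)[of x] by linarith
    then show ?thesis using * unfolding bdd_borel_def by (auto simp: plus_fun_def)
  qed
  show "(\<lambda>x. c * u x) \<in> bdd_borel" if u: "u \<in> bdd_borel" for c and u :: "'a \<Rightarrow> real"
  proof -
    obtain B where "0 \<le> B" "\<And>x. \<bar>u x\<bar> \<le> B" "u \<in> borel_measurable borel" using bdd_borelE[OF u] by blast
    then have "\<bar>c * u x\<bar> \<le> \<bar>c\<bar> * B" for x unfolding abs_mult by (intro mult_left_mono) auto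
    then show ?thesis using \<open>u \<in> borel_measurable borel\<close> unfolding bdd_borel_def by auto
  qed
qed

lemma indicat_bdd_borel: "A \<in> sets borel \<Longrightarrow> indicat_real A \<in> bdd_borel"
  unfolding bdd_borel_def by (auto intro!: exI[of _ 1] borel_measurable_indicator simp: indicator_def)

context mesh
begin

lemma subspace_Vh: "fspace.subspace (Vh \<T>)"
proof (rule fspace.subspaceI)
  show "0 \<in> Vh \<T>" unfolding Vh_def
    by (auto simp: zero_fun_def intro!: exI[of _ 0])
  show "u + v \<in> Vh \<T>" if u: "u \<in> Vh \<T>" and v: "v \<in> Vh \<T>" for u v
  proof -
    have "\<exists>b c. \<forall>x\<in>T. (u + v) x = inner b x + c" if "T \<in> \<T>" for T
    proof -
      obtain b c b' c' where "\<forall>x\<in>T. u x = inner b x + c" "\<forall>x\<in>T. v x = inner b' x + c'"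
        using Vh_affine[OF u \<open>T \<in> \<T>\<close>] Vh_affine[OF v \<open>T \<in> \<T>\<close>] by metis
      then show ?thesis by (intro exI[of _ "b + b'"] exI[of _ "c + c'"]) (simp add: inner_add_left)
    qed
    then show ?thesis using u v unfolding Vh_def by (auto simp: plus_fun_def intro: continuous_on_add)
  qed
  show "(\<lambda>x. k * u x) \<in> Vh \<T>" if u: "u \<in> Vh \<T>" for k u
  proof -
    have "\<exists>b c. \<forall>x\<in>T. k * u x = inner b x + c" if "T \<in> \<T>" for T
    proof -
      obtain b c where "\<forall>x\<in>T. u x = inner b x + c" using Vh_affine[OF u \<open>T \<in> \<T>\<close>] by metis
      then show ?thesis by (intro exI[of _ "k *\<^sub>R b"] exI[of _ "k * c"]) (simp add: distrib_left)
    qed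
    then show ?thesis using u unfolding Vh_def by (auto intro: continuous_intros)
  qed
qed

lemma subspace_Vh0_local: "fspace.subspace (Vh0_local \<Omega> \<T> \<omega>)"
proof (rule fspace.subspaceI)
  show "0 \<in> Vh0_local \<Omega> \<T> \<omega>"
    using fspace.subspace_0[OF subspace_Vh] by (simp add: Vh0_local_def Vh0_def zero_fun_def)
  show "u + v \<in> Vh0_local \<Omega> \<T> \<omega>" if "u \<in> Vh0_local \<Omega> \<T> \<omega>" "v \<in> Vh0_local \<Omega> \<T> \<omega>" for u v
    using fspace.subspace_add[OF subspace_Vh, of u v] that by (simp add: Vh0_local_def Vh0_def)
  show "(\<lambda>x. c * u x) \<in> Vh0_local \<Omega> \<T> \<omega>" if "u \<in> Vh0_local \<Omega> \<T> \<omega>" for c u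
    using fspace.subspace_scale[OF subspace_Vh, of u c] that by (simp add: Vh0_local_def Vh0_def)
qed

lemma subspace_Vh0: "fspace.subspace (Vh0 \<Omega> \<T>)"
proof -
  have "Vh0_local \<Omega> \<T> UNIV = Vh0 \<Omega> \<T>" by (auto simp: Vh0_local_def)
  then show ?thesis using subspace_Vh0_local[of UNIV] by simp
qed

lemma Vh0_subset: "Vh0 \<Omega> \<T> \<subseteq> Vh \<T>" unfolding Vh0_def by auto

lemma Vh0_local_subset: "Vh0_local \<Omega> \<T> \<omega> \<subseteq> Vh0 \<Omega> \<T>" unfolding Vh0_local_def by auto

lemma Vh0_zero: "u \<in> Vh0 \<Omega> \<T> \<Longrightarrow> x \<notin> \<Omega> \<Longrightarrow> u x = 0"
  unfolding Vh0_def Vh_def frontier_Omega by (cases "x \<in> \<Union>\<T>") auto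

lemma borel_Union: "\<Union>\<T> \<in> sets borel"
  by (rule borel_compact[OF compact_Union])

lemma Vh_bdd_borel: "u \<in> Vh \<T> \<Longrightarrow> u \<in> bdd_borel"
proof -
  assume u: "u \<in> Vh \<T>"
  then have c: "continuous_on (\<Union>\<T>) u" and z: "\<And>x. x \<notin> \<Union>\<T> \<Longrightarrow> u x = 0" by (auto simp: Vh_def)
  have "(\<lambda>x. indicator (\<Union>\<T>) x *\<^sub>R u x) \<in> borel_measurable borel"
    by (rule borel_measurable_continuous_on_indicator[OF borel_Union c])
  also have "(\<lambda>x. indicator (\<Union>\<T>) x *\<^sub>R u x) = u" using z by (auto simp: fun_eq_iff indicator_def)
  finally have m: "u \<in> borel_measurable borel" .
  have "bounded (u ` \<Union>\<T>)" using compact_continuous_image[OF c compact_Union] compact_imp_bounded by blast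
  then obtain B where B: "\<And>x. x \<in> \<Union>\<T> \<Longrightarrow> \<bar>u x\<bar> \<le> B" unfolding bounded_iff real_norm_def by blast
  have "\<bar>u x\<bar> \<le> max B 0" for x using B[of x] z[of x] by (cases "x \<in> \<Union>\<T>") auto
  then show ?thesis using m unfolding bdd_borel_def by blast
qed

definition slope :: "('a \<Rightarrow> real) \<Rightarrow> 'a set \<Rightarrow> 'a" where
  "slope u T = (SOME b. \<exists>c. \<forall>x\<in>T. u x = inner b x + c)"

lemma slope:
  assumes "u \<in> Vh \<T>" "T \<in> \<T>"
  obtains c where "\<And>x. x \<in> T \<Longrightarrow> u x = inner (slope u T) x + c"
proof -
  have "\<exists>b c. \<forall>x\<in>T. u x = inner b x + c" using Vh_affine[OF assms] by metis
  from someI_ex[OF this] show ?thesis using that unfolding slope_def by blast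
qed

lemma gderiv_Vh:
  assumes "u \<in> Vh \<T>" "T \<in> \<T>" "x \<in> interior T"
  shows "GDERIV u x :> slope u T"
proof -
  obtain c where "\<And>x. x \<in> T \<Longrightarrow> u x = inner (slope u T) x + c" using slope assms by blast
  then show ?thesis
    using gderiv_open_affine[OF open_interior assms(3)] interior_subset by (metis subsetD)
qed

lemma grad_slope: "u \<in> Vh \<T> \<Longrightarrow> T \<in> \<T> \<Longrightarrow> x \<in> interior T \<Longrightarrow> grad u x = slope u T"
  by (rule grad_eq[OF gderiv_Vh])

lemma gderiv_grad:
  assumes "u \<in> Vh \<T>" "x \<in> mesh_interior"
  shows "GDERIV u x :> grad u x"
proof -
  obtain T where "T \<in> \<T>" "x \<in> interior T" by (rule mesh_interiorE[OF assms(2)])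
  then show ?thesis using gderiv_Vh[OF assms(1)] grad_slope[OF assms(1)] by simp
qed

lemma gderiv_outside:
  assumes "u \<in> Vh \<T>" "x \<notin> \<Union>\<T>"
  shows "GDERIV u x :> 0"
proof (rule gderiv_open_affine[of "- \<Union>\<T>" _ _ _ 0])
  show "open (- \<Union>\<T>)" using compact_Union compact_imp_closed by blast
  show "u y = inner 0 y + 0" if "y \<in> - \<Union>\<T>" for y
    using assms(1) that unfolding Vh_def by simp
qed (use assms(2) in simp)

lemma grad_add:
  assumes "u \<in> Vh \<T>" "v \<in> Vh \<T>" "x \<in> mesh_interior"
  shows "grad (u + v) x = grad u x + grad v x"
  using GDERIV_add[OF gderiv_grad[OF assms(1,3)] gderiv_grad[OF assms(2,3)]]
  unfolding plus_fun_def by (rule grad_eq)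

lemma grad_scale:
  assumes "u \<in> Vh \<T>" "x \<in> mesh_interior"
  shows "grad (\<lambda>x. c * u x) x = c *\<^sub>R grad u x"
  using GDERIV_mult[OF GDERIV_const[of c] gderiv_grad[OF assms]] by (intro grad_eq) simp

text \<open>A Borel version of the gradient with a definite value everywhere. The values of
  \<open>grad\<close> on the skeleton are unspecified, so its measurability and bounds are obtained
  through almost-everywhere equality with this function.\<close>

definition pw_grad :: "('a \<Rightarrow> real) \<Rightarrow> 'a \<Rightarrow> 'a" where
  "pw_grad u x = (\<Sum>T\<in>\<T>. indicat_real (interior T) x *\<^sub>R slope u T)"

lemma pw_grad_borel [measurable]: "pw_grad u \<in> borel_measurable borel"
  unfolding pw_grad_def
  by (intro borel_measurable_sum borel_measurable_scaleR borel_measurable_indicator) auto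

lemma pw_grad_interior:
  assumes "T \<in> \<T>" "x \<in> interior T"
  shows "pw_grad u x = slope u T"
proof -
  have "indicat_real (interior T') x = 0" if "T' \<in> \<T> - {T}" for T'
    using interior_T_disjoint[OF assms(1), of T'] that assms interior_subset[of T'] by (auto simp: indicator_def)
  then have "(\<Sum>T'\<in>\<T> - {T}. indicat_real (interior T') x *\<^sub>R slope u T') = 0" by simp
  then show ?thesis unfolding pw_grad_def
    using sum.remove[OF finite_mesh assms(1), of "\<lambda>T. indicat_real (interior T) x *\<^sub>R slope u T"] assms(2) by simp
qed

lemma pw_grad_outside: "x \<notin> \<Union>\<T> \<Longrightarrow> pw_grad u x = 0"
  unfolding pw_grad_def
proof (intro sum.neutral ballI)
  fix T assume "x \<notin> \<Union>\<T>" "T \<in> \<T>"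
  then have "x \<notin> interior T" using interior_subset[of T] by blast
  then show "indicat_real (interior T) x *\<^sub>R slope u T = 0" by simp
qed

lemma pw_grad_eq:
  assumes "u \<in> Vh \<T>" "x \<notin> \<Union>\<T> - mesh_interior"
  shows "GDERIV u x :> pw_grad u x" "grad u x = pw_grad u x"
proof -
  show "GDERIV u x :> pw_grad u x"
  proof (cases "x \<in> \<Union>\<T>")
    case True
    then obtain T where "T \<in> \<T>" "x \<in> interior T" using assms(2) mesh_interiorE by blast
    then show ?thesis using gderiv_Vh[OF assms(1)] pw_grad_interior by simp
  next
    case False
    then show ?thesis using gderiv_outside[OF assms(1)] pw_grad_outside by simp
  qed
  then show "grad u x = pw_grad u x" by (rule grad_eq)
qed

lemma AE_skeleton: "AE x in lebesgue. x \<notin> \<Union>\<T> - mesh_interior"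
  by (rule AE_not_in) (simp add: negligible_skeleton flip: negligible_iff_null_sets)

lemma pw_grad_bound: "norm (pw_grad u x) \<le> (\<Sum>T\<in>\<T>. norm (slope u T))"
  unfolding pw_grad_def
  by (rule order_trans[OF norm_sum sum_mono]) (auto simp: indicator_def)

lemma grad_measurable: "u \<in> Vh \<T> \<Longrightarrow> grad u \<in> borel_measurable lebesgue"
proof (rule borel_measurable_AE[of "pw_grad u"])
  show "pw_grad u \<in> borel_measurable lebesgue" by (intro measurable_completion) simp
  show "u \<in> Vh \<T> \<Longrightarrow> AE x in lebesgue. pw_grad u x = grad u x"
    using AE_skeleton by eventually_elim (simp add: pw_grad_eq)
qed

text \<open>The domain need not be convex, so the segment from \<open>x\<close> to \<open>y\<close>
  may leave it. Along the segment, the elements and the complement of \<open>\<Omega>\<close> form a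
  finite closed cover; \<open>u\<close> is affine on the former and, by its boundary values, zero on
  the latter. Lipschitz bounds on the pieces of an interval combine.\<close>

lemma Vh0_Lipschitz:
  assumes u: "u \<in> Vh0 \<Omega> \<T>"
  shows "\<bar>u y - u x\<bar> \<le> (\<Sum>T\<in>\<T>. norm (slope u T)) * norm (y - x)"
proof -
  define L where "L = (\<Sum>T\<in>\<T>. norm (slope u T))"
  have L0: "0 \<le> L" by (simp add: L_def sum_nonneg)
  have uV: "u \<in> Vh \<T>" using u Vh0_subset by blast
  define p where "p t = x + t *\<^sub>R (y - x)" for t :: real
  have cp: "continuous_on UNIV p" unfolding p_def by (intro continuous_intros)
  have "(L * norm (y - x))-lipschitz_on {0..1} (u \<circ> p)"
  proof (rule lipschitz_on_closed_Union[of "insert (- \<Omega>) \<T>" _ "\<lambda>S. p -` S"])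
    fix S assume S: "S \<in> insert (- \<Omega>) \<T>"
    show "closed (p -` S)"
      using S closed_T open_Omega cp by (intro continuous_closed_vimage) (auto simp: continuous_on_eq_continuous_at)
    show "(L * norm (y - x))-lipschitz_on (p -` S) (u \<circ> p)"
    proof (cases "S = - \<Omega>")
      case True
      then have "u (p t) = 0" if "t \<in> p -` S" for t using that Vh0_zero[OF u] by auto
      then show ?thesis using L0 by (intro lipschitz_onI) (auto intro!: mult_nonneg_nonneg)
    next
      case False
      then have T: "S \<in> \<T>" using S by blast
      obtain c where c: "\<And>x. x \<in> S \<Longrightarrow> u x = inner (slope u S) x + c" using slope uV T by blast
      have sL: "norm (slope u S) \<le> L" unfolding L_def
        by (rule member_le_sum[OF T _ finite_mesh, of "\<lambda>T. norm (slope u T)"]) auto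
      show ?thesis
      proof (rule lipschitz_onI)
        fix s t assume st: "s \<in> p -` S" "t \<in> p -` S"
        have "u (p s) - u (p t) = (s - t) * inner (slope u S) (y - x)"
          using st c by (simp add: p_def inner_add_right algebra_simps)
        then have "dist ((u \<circ> p) s) ((u \<circ> p) t) = \<bar>inner (slope u S) (y - x)\<bar> * dist s t"
          by (simp add: dist_real_def abs_mult)
        also have "\<dots> \<le> (norm (slope u S) * norm (y - x)) * dist s t"
          by (intro mult_right_mono Cauchy_Schwarz_ineq2) auto
        also have "\<dots> \<le> L * norm (y - x) * dist s t"
          using sL by (intro mult_right_mono) auto
        finally show "dist ((u \<circ> p) s) ((u \<circ> p) t) \<le> L * norm (y - x) * dist s t" .
      qed (use L0 in auto)
    qed
  next
    show "{0..1} \<subseteq> (\<Union>S\<in>insert (- \<Omega>) \<T>. p -` S)" using Omega_subset by auto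
  qed (use finite_mesh L0 in auto)
  from lipschitz_onD[OF this, of 1 0] show ?thesis by (simp add: p_def dist_real_def L_def)
qed

end

section \<open>Weak gradients of finite element functions\<close>

lemma integrable_compact_support:
  fixes g :: "'a::euclidean_space \<Rightarrow> real"
  assumes "g \<in> borel_measurable borel" "compact S" "\<And>x. \<bar>g x\<bar> \<le> C" "\<And>x. x \<notin> S \<Longrightarrow> g x = 0"
  shows "integrable lborel g"
proof (rule Bochner_Integration.integrable_bound)
  have "emeasure lborel S < \<infinity>" using emeasure_bounded_finite[OF compact_imp_bounded[OF assms(2)]] by simp
  then have "integrable lborel (indicat_real S)"
    using borel_compact[OF assms(2)] by (intro integrable_real_indicator) auto
  then show "integrable lborel (\<lambda>x. C * indicat_real S x)" by (rule integrable_mult_right)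
  show "g \<in> borel_measurable lborel" using assms(1) by simp
  have "norm (g x) \<le> norm (C * indicat_real S x)" for x
    using assms(3)[of x] assms(4)[of x] by (cases "x \<in> S") auto
  then show "AE x in lborel. norm (g x) \<le> norm (C * indicat_real S x)" by simp
qed

text \<open>Extracts from the tree \<open>D\<close> of iterated derivatives what integration by
  parts uses: a compact support, continuity, and bounds for \<open>\<phi>\<close> and one
  directional derivative.\<close>

lemma test_function_props:
  fixes \<phi> :: "'a::euclidean_space \<Rightarrow> real"
  assumes "\<phi> \<in> test_functions U"
  obtains S B B' where "compact S" "S \<subseteq> U" "\<And>x. x \<notin> S \<Longrightarrow> \<phi> x = 0" "\<And>x. x \<notin> S \<Longrightarrow> grad \<phi> x = 0"
    "continuous_on UNIV \<phi>" "continuous_on UNIV (\<lambda>x. inner (grad \<phi> x) b)"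
    "\<And>x. GDERIV \<phi> x :> grad \<phi> x" "\<And>x. \<bar>\<phi> x\<bar> \<le> B" "\<And>x. \<bar>inner (grad \<phi> x) b\<bar> \<le> B'"
proof -
  obtain D where D: "D [] = \<phi>" "\<And>vs x. (D vs has_derivative (\<lambda>v. D (v # vs) x)) (at x)"
    and S': "compact (closure {x. \<phi> x \<noteq> 0})" "closure {x. \<phi> x \<noteq> 0} \<subseteq> U"
    using assms unfolding test_functions_def by blast
  define S where "S = closure {x. \<phi> x \<noteq> 0}"
  have S: "compact S" "S \<subseteq> U" "closed S" using S' by (auto simp: S_def)
  have d: "(\<phi> has_derivative (\<lambda>v. D [v] x)) (at x)" for x using D(2)[of "[]" x] D(1) by simp
  have lin: "linear (\<lambda>v. D [v] x)" for x using has_derivative_linear[OF d] .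
  have g: "GDERIV \<phi> x :> adjoint (\<lambda>v. D [v] x) 1" for x
    unfolding gderiv_def adjoint_works[OF lin] using d[of x] by simp
  have ge: "grad \<phi> x = adjoint (\<lambda>v. D [v] x) 1" for x using grad_eq[OF g] .
  have gb: "inner (grad \<phi> x) b = D [b] x" for x
    unfolding ge using adjoint_works[OF lin, of b x 1] by (simp add: inner_commute)
  have cont: "continuous_on UNIV (D vs)" for vs
    by (rule continuous_at_imp_continuous_on) (use has_derivative_continuous[OF D(2)] in blast)
  have c1: "continuous_on UNIV \<phi>" using cont[of "[]"] D(1) by simp
  have c2: "continuous_on UNIV (\<lambda>x. inner (grad \<phi> x) b)" unfolding gb using cont[of "[b]"] .
  have z1: "\<phi> x = 0" if "x \<notin> S" for x using that closure_subset[of "{x. \<phi> x \<noteq> 0}"] unfolding S_def by blast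
  have z2: "grad \<phi> x = 0" if "x \<notin> S" for x
  proof (rule grad_eq)
    show "GDERIV \<phi> x :> 0"
    proof (rule gderiv_open_affine[of "- S" _ _ _ 0])
      show "\<phi> y = inner 0 y + 0" if "y \<in> - S" for y using z1[of y] that by simp
    qed (use S(3) that in auto)
  qed
  have bd: "\<exists>B. \<forall>x. \<bar>h x\<bar> \<le> B" if "continuous_on UNIV h" "\<And>x. x \<notin> S \<Longrightarrow> h x = 0" for h :: "'a \<Rightarrow> real"
  proof -
    have "bounded (h ` S)"
      using compact_continuous_image[OF continuous_on_subset[OF that(1)] S(1)] compact_imp_bounded by blast
    then obtain B where B: "\<And>x. x \<in> S \<Longrightarrow> \<bar>h x\<bar> \<le> B" unfolding bounded_iff real_norm_def by blast
    have "\<bar>h x\<bar> \<le> max B 0" for x using B[of x] that(2)[of x] by (cases "x \<in> S") auto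
    then show ?thesis by blast
  qed
  obtain B where B: "\<And>x. \<bar>\<phi> x\<bar> \<le> B" using bd[OF c1 z1] by blast
  have "\<exists>B'. \<forall>x. \<bar>inner (grad \<phi> x) b\<bar> \<le> B'" by (rule bd[OF c2]) (simp add: z2)
  then obtain B' where B': "\<And>x. \<bar>inner (grad \<phi> x) b\<bar> \<le> B'" by blast
  show ?thesis by (rule that[OF S(1,2) z1 z2 c1 c2 _ B B']) (use g ge in simp_all)
qed

lemma gderiv_direction:
  assumes "GDERIV f x :> g"
  shows "((\<lambda>t. f (x + t *\<^sub>R b)) has_real_derivative inner b g) (at 0)"
proof -
  have "((\<lambda>t. x + t *\<^sub>R b) has_derivative (\<lambda>t. t *\<^sub>R b)) (at 0)"
    by (auto intro!: derivative_eq_intros)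
  moreover have "(f has_derivative (\<lambda>h. inner h g)) (at (x + 0 *\<^sub>R b))" using assms by (simp add: gderiv_def)
  ultimately have "((\<lambda>t. f (x + t *\<^sub>R b)) has_derivative (\<lambda>t. inner (t *\<^sub>R b) g)) (at 0)"
    by (rule has_derivative_compose)
  moreover have "(\<lambda>t. inner (t *\<^sub>R b) g) = (*) (inner b g)" by (auto simp: fun_eq_iff)
  ultimately show ?thesis by (simp add: has_field_derivative_def)
qed

lemma integral_lborel_translation:
  fixes f :: "'a::euclidean_space \<Rightarrow> real"
  assumes "f \<in> borel_measurable borel"
  shows "(LINT x|lborel. f (x + a)) = (LINT x|lborel. f x)"
proof -
  have "(LINT x|lborel. f x) = (LINT x|distr lborel borel ((+) a). f x)" by (simp add: lborel_distr_plus)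
  also have "\<dots> = (LINT x|lborel. f (a + x))" by (rule integral_distr) (use assms in auto)
  finally show ?thesis by (simp add: add.commute)
qed

lemma integrable_lborel_translation:
  fixes f :: "'a::euclidean_space \<Rightarrow> real"
  assumes "integrable lborel f"
  shows "integrable lborel (\<lambda>x. f (x + a))"
proof -
  have "integrable (distr lborel borel ((+) a)) f" using assms by (simp add: lborel_distr_plus)
  then have "integrable lborel (\<lambda>x. f (a + x))"
    by (subst (asm) integrable_distr_eq) (use borel_measurable_integrable[OF assms] in auto)
  then show ?thesis by (simp add: add.commute)
qed

context mesh
begin

lemma Vh0_continuous: "u \<in> Vh0 \<Omega> \<T> \<Longrightarrow> continuous_on UNIV u"
proof -
  assume u: "u \<in> Vh0 \<Omega> \<T>"
  have "(\<Sum>T\<in>\<T>. norm (slope u T))-lipschitz_on UNIV u"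
    by (rule lipschitz_onI) (use Vh0_Lipschitz[OF u] in \<open>auto simp: dist_norm sum_nonneg\<close>)
  then show ?thesis by (rule lipschitz_on_continuous_on)
qed

text \<open>The difference quotients of \<open>u \<phi>\<close> are uniformly bounded because \<open>u\<close> is Lipschitz, and their
  integrals vanish by translation invariance.\<close>

lemma Vh0_integral_by_parts:
  assumes u: "u \<in> Vh0 \<Omega> \<T>" and \<phi>: "\<phi> \<in> test_functions U"
  shows "(LINT x|lborel. u x * inner (grad \<phi> x) b + inner (pw_grad u x) b * \<phi> x) = 0"
proof -
  obtain S B0 B1 where S: "compact S" "S \<subseteq> U" "\<And>x. x \<notin> S \<Longrightarrow> \<phi> x = 0" "\<And>x. x \<notin> S \<Longrightarrow> grad \<phi> x = 0"
    and c: "continuous_on UNIV \<phi>" "continuous_on UNIV (\<lambda>x. inner (grad \<phi> x) b)"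
    and g: "\<And>x. GDERIV \<phi> x :> grad \<phi> x" and B0: "\<And>x. \<bar>\<phi> x\<bar> \<le> B0" and B1: "\<And>x. \<bar>inner (grad \<phi> x) b\<bar> \<le> B1"
    by (rule test_function_props[OF \<phi>, where b = b]) (rule that; assumption)
  have uV: "u \<in> Vh \<T>" using u Vh0_subset by blast
  obtain Bu where Bu: "0 \<le> Bu" "\<And>x. \<bar>u x\<bar> \<le> Bu" "u \<in> borel_measurable borel"
    using bdd_borelE[OF Vh_bdd_borel[OF uV]] by blast
  have m\<phi> [measurable]: "\<phi> \<in> borel_measurable borel" "(\<lambda>x. inner (grad \<phi> x) b) \<in> borel_measurable borel"
    using c by (auto intro: borel_measurable_continuous_onI)
  note Bu(3) [measurable]
  define L where "L = (\<Sum>T\<in>\<T>. norm (slope u T))"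
  have L: "\<bar>u y - u x\<bar> \<le> L * norm (y - x)" for x y unfolding L_def by (rule Vh0_Lipschitz[OF u])
  have L0: "0 \<le> L" by (simp add: L_def sum_nonneg)
  have B00: "0 \<le> B0" using B0[of undefined] by linarith
  have B10: "0 \<le> B1" using B1[of undefined] by linarith
  define f where "f x = u x * \<phi> x" for x
  have fm [measurable]: "f \<in> borel_measurable borel" unfolding f_def by measurable
  have fi: "integrable lborel f"
  proof (rule integrable_compact_support[OF fm S(1)])
    show "\<bar>f x\<bar> \<le> Bu * B0" for x
      unfolding f_def abs_mult by (rule mult_mono) (use Bu B0 in auto)
    show "f x = 0" if "x \<notin> S" for x using S(3)[OF that] by (simp add: f_def)
  qed
  define h where "h n = inverse (real (Suc n))" for n
  have h: "0 < h n" "h n \<le> 1" "real (Suc n) * h n = 1" for n by (auto simp: h_def divide_simps)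
  define q where "q n x = real (Suc n) * (f (x + h n *\<^sub>R b) - f x)" for n x
  have q0: "(LINT x|lborel. q n x) = 0" for n
    unfolding q_def using fi integrable_lborel_translation[OF fi] integral_lborel_translation[OF fm]
    by simp
  have phi_diff: "\<bar>\<phi> (x + t *\<^sub>R b) - \<phi> x\<bar> \<le> t * B1" if t: "0 < t" for x t
  proof -
    have deriv: "((\<lambda>t. \<phi> (x + t *\<^sub>R b)) has_real_derivative inner b (grad \<phi> (x + s *\<^sub>R b))) (at s)" for s
    proof -
      have "(\<lambda>t. \<phi> (x + s *\<^sub>R b + t *\<^sub>R b)) = (\<lambda>t. \<phi> (x + (t + s) *\<^sub>R b))"
        by (simp add: scaleR_add_left add_ac)
      then show ?thesis
        using gderiv_direction[OF g, of "x + s *\<^sub>R b" b] DERIV_shift[of "\<lambda>t. \<phi> (x + t *\<^sub>R b)" _ 0 s]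
        by simp
    qed
    obtain z where "\<phi> (x + t *\<^sub>R b) - \<phi> (x + 0 *\<^sub>R b) = (t - 0) * inner b (grad \<phi> (x + z *\<^sub>R b))"
      using MVT2[OF t, of "\<lambda>t. \<phi> (x + t *\<^sub>R b)" "\<lambda>s. inner b (grad \<phi> (x + s *\<^sub>R b))"] deriv by blast
    then have "\<bar>\<phi> (x + t *\<^sub>R b) - \<phi> x\<bar> = t * \<bar>inner (grad \<phi> (x + z *\<^sub>R b)) b\<bar>"
      using t by (simp add: abs_mult inner_commute)
    then show ?thesis using B1 t by simp
  qed
  define C where "C = Bu * B1 + B0 * (L * norm b)"
  have f_diff: "\<bar>f (x + t *\<^sub>R b) - f x\<bar> \<le> t * C" if t: "0 < t" for x t
  proof -
    have "f (x + t *\<^sub>R b) - f x = u (x + t *\<^sub>R b) * (\<phi> (x + t *\<^sub>R b) - \<phi> x) + \<phi> x * (u (x + t *\<^sub>R b) - u x)"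
      by (simp add: f_def algebra_simps)
    also have "\<bar>\<dots>\<bar> \<le> \<bar>u (x + t *\<^sub>R b)\<bar> * \<bar>\<phi> (x + t *\<^sub>R b) - \<phi> x\<bar> + \<bar>\<phi> x\<bar> * \<bar>u (x + t *\<^sub>R b) - u x\<bar>"
      by (simp add: abs_triangle_ineq flip: abs_mult)
    also have "\<dots> \<le> Bu * (t * B1) + B0 * (L * norm (t *\<^sub>R b))"
    proof (intro add_mono mult_mono)
      show "\<bar>u (x + t *\<^sub>R b) - u x\<bar> \<le> L * norm (t *\<^sub>R b)" using L[of "x + t *\<^sub>R b" x] by simp
    qed (use Bu B0 phi_diff t B00 in auto)
    also have "\<dots> = t * C" using t by (simp add: C_def algebra_simps)
    finally show ?thesis .
  qed
  obtain R where R: "\<And>x. x \<in> S \<Longrightarrow> norm x \<le> R"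
    using compact_imp_bounded[OF S(1)] unfolding bounded_iff by blast
  \<comment> \<open>Dominating function for the difference quotients. Since
    \<open>h n \<le> 1\<close>, the shifts of the support stay in one ball, and \<open>C\<close> is
    the bound from \<open>f_diff\<close>.\<close>
  define w where "w x = C * indicat_real (cball 0 (R + norm b)) x" for x :: 'a
  have wi: "integrable lborel w"
  proof (rule integrable_compact_support)
    show "\<bar>w x\<bar> \<le> \<bar>C\<bar>" for x by (simp add: w_def indicator_def)
    show "w x = 0" if "x \<notin> cball 0 (R + norm b)" for x using that by (simp add: w_def)
    show "w \<in> borel_measurable borel" unfolding w_def
      by (intro borel_measurable_times borel_measurable_const borel_measurable_indicator borel_closed closed_cball)
  qed simp
  have bound: "norm (q n x) \<le> w x" for n x
  proof (cases "x \<in> cball 0 (R + norm b)")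
    case True
    have "norm (q n x) = real (Suc n) * \<bar>f (x + h n *\<^sub>R b) - f x\<bar>" by (simp add: q_def abs_mult)
    also have "\<dots> \<le> real (Suc n) * (h n * C)" by (intro mult_left_mono f_diff h) simp
    also have "\<dots> = (real (Suc n) * h n) * C" by (simp only: mult.assoc)
    finally show ?thesis using True unfolding h(3) w_def by simp
  next
    case False
    have "norm x \<le> norm (x + h n *\<^sub>R b) + norm (h n *\<^sub>R b)" using norm_triangle_ineq4[of "x + h n *\<^sub>R b" "h n *\<^sub>R b"] by simp
    also have "norm (h n *\<^sub>R b) \<le> norm b" using h[of n] by (simp add: mult_left_le_one_le)
    finally have n: "norm x \<le> norm (x + h n *\<^sub>R b) + norm b" by simp
    have x: "R + norm b < norm x" using False by simp
    have "x + h n *\<^sub>R b \<notin> S" using R[of "x + h n *\<^sub>R b"] n x by linarith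
    moreover have "x \<notin> S" using R[of x] x norm_ge_zero[of b] by linarith
    ultimately have "q n x = 0" using S(3) by (simp add: q_def f_def)
    then show ?thesis using False by (simp add: w_def)
  qed
  define F where "F x = u x * inner (grad \<phi> x) b + inner (pw_grad u x) b * \<phi> x" for x
  have lim: "(\<lambda>n. q n x) \<longlonglongrightarrow> F x" if x: "x \<notin> \<Union>\<T> - mesh_interior" for x
  proof -
    have "GDERIV f x :> u x *\<^sub>R grad \<phi> x + \<phi> x *\<^sub>R pw_grad u x"
      unfolding f_def by (rule GDERIV_mult[OF pw_grad_eq(1)[OF uV x] g])
    from gderiv_direction[OF this, of b]
    have "((\<lambda>t. f (x + t *\<^sub>R b)) has_real_derivative F x) (at 0)"
      by (simp add: F_def inner_add_right inner_commute mult.commute)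
    then have *: "(\<lambda>t. (f (x + t *\<^sub>R b) - f x) / t) \<midarrow>0\<rightarrow> F x" by (simp add: DERIV_def)
    have "h \<longlonglongrightarrow> 0" unfolding h_def[abs_def] by (rule LIMSEQ_inverse_real_of_nat)
    moreover have "h n \<noteq> 0" for n using h(1)[of n] by simp
    ultimately have "filterlim h (at 0) sequentially" by (simp add: filterlim_at)
    from filterlim_compose[OF * this]
    have "(\<lambda>n. (f (x + h n *\<^sub>R b) - f x) / h n) \<longlonglongrightarrow> F x" .
    moreover have "q n x = (f (x + h n *\<^sub>R b) - f x) / h n" for n
      unfolding q_def by (simp add: h_def divide_inverse mult.commute)
    ultimately show ?thesis by simp
  qed
  have "(\<lambda>n. LINT x|lborel. q n x) \<longlonglongrightarrow> (LINT x|lborel. F x)"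
  proof (rule integral_dominated_convergence[OF _ _ wi])
    show "F \<in> borel_measurable lborel" unfolding F_def by measurable
    show "q n \<in> borel_measurable lborel" for n unfolding q_def by measurable
    have "AE x in lebesgue. (\<lambda>n. q n x) \<longlonglongrightarrow> F x" using AE_skeleton by eventually_elim (rule lim)
    then show "AE x in lborel. (\<lambda>n. q n x) \<longlonglongrightarrow> F x" by (simp add: AE_completion_iff)
    show "AE x in lborel. norm (q n x) \<le> w x" for n using bound by simp
  qed
  then show ?thesis using q0 LIMSEQ_const_iff[of "0::real"] unfolding F_def by simp
qed

lemma lmeasurable_subset: "D \<in> sets lebesgue \<Longrightarrow> D \<subseteq> \<Union>\<T> \<Longrightarrow> D \<in> lmeasurable"
  using bounded_set_imp_lmeasurable bounded_subset compact_imp_bounded[OF compact_Union] by blast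

lemma integrable_lebesgue_on_bounded:
  fixes f :: "'a \<Rightarrow> real"
  assumes D: "D \<in> sets lebesgue" "D \<subseteq> \<Union>\<T>" and f: "f \<in> borel_measurable lebesgue"
    and B: "AE x in lebesgue. \<bar>f x\<bar> \<le> B"
  shows "integrable (lebesgue_on D) f"
proof (rule Bochner_Integration.integrable_bound)
  have "finite_measure (lebesgue_on D)"
    using lmeasurable_subset[OF D] by (simp add: finite_measure_lebesgue_on)
  then show "integrable (lebesgue_on D) (\<lambda>x. B)" by (rule finite_measure.integrable_const)
  show "f \<in> borel_measurable (lebesgue_on D)" using f by (rule measurable_restrict_space1)
  have "AE x in lebesgue_on D. \<bar>f x\<bar> \<le> B"
    using B D by (subst AE_restrict_space_iff) (auto elim: eventually_mono)
  then show "AE x in lebesgue_on D. norm (f x) \<le> norm B" by eventually_elim simp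
qed

lemma borel_lebesgue: "f \<in> borel_measurable borel \<Longrightarrow> f \<in> borel_measurable lebesgue"
  by (intro measurable_completion) simp

lemma integral_lebesgue_on_support:
  fixes g :: "'a \<Rightarrow> real"
  assumes "U \<in> sets lebesgue" "g \<in> borel_measurable borel" "\<And>x. x \<notin> U \<Longrightarrow> g x = 0"
  shows "(LINT x|lebesgue_on U. g x) = (LINT x|lborel. g x)"
proof -
  have "(LINT x|lebesgue_on U. g x) = (LINT x|lebesgue. indicat_real U x *\<^sub>R g x)"
    using assms(1) by (intro integral_restrict_space) simp
  also have "(\<lambda>x. indicat_real U x *\<^sub>R g x) = g" using assms(3) by (auto simp: indicator_def fun_eq_iff)
  also have "(LINT x|lebesgue. g x) = (LINT x|lborel. g x)"
    by (rule integral_completion) (use assms(2) in simp)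
  finally show ?thesis .
qed

text \<open>Makes the approximation hypothesis, stated for weakly differentiable functions on the
  interiors of coarse elements, applicable to finite element functions. Test functions supported in
  \<open>U\<close> turn integrals over \<open>U\<close> into integrals over the whole space.\<close>

lemma Vh0_H1:
  assumes u: "u \<in> Vh0 \<Omega> \<T>" and U: "open U" "U \<subseteq> \<Union>\<T>"
  shows "H1_with_gradient U u (grad u)"
proof -
  have uV: "u \<in> Vh \<T>" using u Vh0_subset by blast
  have UL: "U \<in> sets lebesgue" using U(1) by (simp add: borel_open)
  obtain Bu where Bu: "0 \<le> Bu" "\<And>x. \<bar>u x\<bar> \<le> Bu" "u \<in> borel_measurable borel"
    using bdd_borelE[OF Vh_bdd_borel[OF uV]] by blast
  note Bu(3) [measurable]
  have um: "u \<in> borel_measurable lebesgue" by (rule borel_lebesgue[OF Bu(3)])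
  note gm = grad_measurable[OF uV]
  have "sq_integrable U u" unfolding sq_integrable_def
  proof
    show "u \<in> borel_measurable (lebesgue_on U)" using um by (rule measurable_restrict_space1)
    show "integrable (lebesgue_on U) (\<lambda>x. (norm (u x))\<^sup>2)"
      by (rule integrable_lebesgue_on_bounded[OF UL U(2), of _ "Bu\<^sup>2"])
        (use um Bu in \<open>auto simp: abs_le_square_iff[symmetric] intro!: borel_measurable_power\<close>)
  qed
  moreover have "sq_integrable U (grad u)" unfolding sq_integrable_def
  proof
    show "grad u \<in> borel_measurable (lebesgue_on U)" using gm by (rule measurable_restrict_space1)
    have "AE x in lebesgue. \<bar>(norm (grad u x))\<^sup>2\<bar> \<le> (\<Sum>T\<in>\<T>. norm (slope u T))\<^sup>2"
      using AE_skeleton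
    proof eventually_elim
      case (elim x)
      then show ?case using pw_grad_bound[of u x] by (simp add: pw_grad_eq(2)[OF uV] power_mono)
    qed
    then show "integrable (lebesgue_on U) (\<lambda>x. (norm (grad u x))\<^sup>2)"
      by (rule integrable_lebesgue_on_bounded[OF UL U(2), rotated])
        (intro borel_measurable_power measurable_compose[OF gm] borel_measurable_norm measurable_ident)
  qed
  moreover have "(LINT x|lebesgue_on U. u x * inner (grad \<phi> x) b)
      = - (LINT x|lebesgue_on U. inner (grad u x) b * \<phi> x)" if \<phi>: "\<phi> \<in> test_functions U" for \<phi> b
  proof -
    obtain S B0 B1 where S: "compact S" "S \<subseteq> U" "\<And>x. x \<notin> S \<Longrightarrow> \<phi> x = 0" "\<And>x. x \<notin> S \<Longrightarrow> grad \<phi> x = 0"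
      and c: "continuous_on UNIV \<phi>" "continuous_on UNIV (\<lambda>x. inner (grad \<phi> x) b)"
      and g: "\<And>x. GDERIV \<phi> x :> grad \<phi> x" and B0: "\<And>x. \<bar>\<phi> x\<bar> \<le> B0" and B1: "\<And>x. \<bar>inner (grad \<phi> x) b\<bar> \<le> B1"
      by (rule test_function_props[OF \<phi>, where b = b]) (rule that; assumption)
    have m\<phi> [measurable]: "\<phi> \<in> borel_measurable borel" "(\<lambda>x. inner (grad \<phi> x) b) \<in> borel_measurable borel"
      using c by (auto intro: borel_measurable_continuous_onI)
    have B00: "0 \<le> B0" using B0[of undefined] by linarith
    have zU: "grad \<phi> x = 0" "\<phi> x = 0" if "x \<notin> U" for x using that S by blast+
    have i1: "integrable lborel (\<lambda>x. u x * inner (grad \<phi> x) b)"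
    proof (rule integrable_compact_support[OF _ S(1)])
      show "\<bar>u x * inner (grad \<phi> x) b\<bar> \<le> Bu * B1" for x
        unfolding abs_mult by (rule mult_mono) (use Bu B1 in auto)
    qed (use S in auto)
    have i2: "integrable lborel (\<lambda>x. inner (pw_grad u x) b * \<phi> x)"
    proof (rule integrable_compact_support[OF _ S(1)])
      show "\<bar>inner (pw_grad u x) b * \<phi> x\<bar> \<le> ((\<Sum>T\<in>\<T>. norm (slope u T)) * norm b) * B0" for x
        unfolding abs_mult
        by (intro mult_mono B0 order_trans[OF Cauchy_Schwarz_ineq2] pw_grad_bound)
          (auto intro!: mult_nonneg_nonneg sum_nonneg)
    qed (use S in auto)
    have e1: "(LINT x|lebesgue_on U. u x * inner (grad \<phi> x) b) = (LINT x|lborel. u x * inner (grad \<phi> x) b)"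
      by (rule integral_lebesgue_on_support[OF UL]) (auto simp: zU)
    \<comment> \<open>Only the Borel version \<open>pw_grad\<close> can be integrated against
      \<open>lborel\<close>, where translation invariance was used.\<close>
    have "(LINT x|lebesgue_on U. inner (grad u x) b * \<phi> x) = (LINT x|lebesgue_on U. inner (pw_grad u x) b * \<phi> x)"
    proof (rule integral_cong_AE)
      show "(\<lambda>x. inner (grad u x) b * \<phi> x) \<in> borel_measurable (lebesgue_on U)"
        by (intro measurable_restrict_space1 borel_measurable_times borel_measurable_inner gm
            borel_measurable_const borel_lebesgue m\<phi>)
      show "(\<lambda>x. inner (pw_grad u x) b * \<phi> x) \<in> borel_measurable (lebesgue_on U)"
        by (intro measurable_restrict_space1 borel_lebesgue) measurable
      have "AE x in lebesgue. inner (grad u x) b * \<phi> x = inner (pw_grad u x) b * \<phi> x"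
        using AE_skeleton by eventually_elim (simp add: pw_grad_eq(2)[OF uV])
      then show "AE x in lebesgue_on U. inner (grad u x) b * \<phi> x = inner (pw_grad u x) b * \<phi> x"
        using UL by (subst AE_restrict_space_iff) (auto elim: eventually_mono)
    qed
    also have "\<dots> = (LINT x|lborel. inner (pw_grad u x) b * \<phi> x)"
      by (rule integral_lebesgue_on_support[OF UL]) (auto simp: zU)
    finally show ?thesis
      using Vh0_integral_by_parts[OF u \<phi>, of b] i1 i2 e1 by simp
  qed
  ultimately show ?thesis unfolding H1_with_gradient_def by blast
qed

end

section \<open>Energy and weighted mass forms\<close>

text \<open>One scheme for the energy form, with \<open>F = grad\<close>, and the mass forms, with
  \<open>F\<close> the identity. Linearity of \<open>F\<close> is required almost everywhere because
  \<open>grad\<close> is unspecified on the skeleton.\<close>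

lemma psd_form_integral:
  fixes F :: "('a \<Rightarrow> real) \<Rightarrow> 'b \<Rightarrow> 'c::real_inner" and w :: "'b \<Rightarrow> real"
  assumes V: "fspace.subspace V"
    and int: "\<And>u v. u \<in> V \<Longrightarrow> v \<in> V \<Longrightarrow> integrable M (\<lambda>x. w x * inner (F u x) (F v x))"
    and w: "AE x in M. 0 \<le> w x"
    and add: "\<And>u v. u \<in> V \<Longrightarrow> v \<in> V \<Longrightarrow> AE x in M. F (u + v) x = F u x + F v x"
    and scale: "\<And>c u. u \<in> V \<Longrightarrow> AE x in M. F (\<lambda>y. c * u y) x = c *\<^sub>R F u x"
  shows "psd_form V (\<lambda>u v. LINT x|M. w x * inner (F u x) (F v x))"
proof
  fix u v z :: "'a \<Rightarrow> real" assume uvz: "u \<in> V" "v \<in> V" "z \<in> V"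
  have "(LINT x|M. w x * inner (F (u + v) x) (F z x))
      = (LINT x|M. w x * inner (F u x) (F z x) + w x * inner (F v x) (F z x))"
  proof (rule integral_cong_AE)
    show "(\<lambda>x. w x * inner (F (u + v) x) (F z x)) \<in> borel_measurable M"
      by (rule borel_measurable_integrable[OF int[OF fspace.subspace_add[OF V uvz(1,2)] uvz(3)]])
    show "(\<lambda>x. w x * inner (F u x) (F z x) + w x * inner (F v x) (F z x)) \<in> borel_measurable M"
      by (intro borel_measurable_add borel_measurable_integrable int uvz)
    show "AE x in M. w x * inner (F (u + v) x) (F z x)
        = w x * inner (F u x) (F z x) + w x * inner (F v x) (F z x)"
      using add[OF uvz(1,2)] by eventually_elim (simp add: inner_add_left distrib_left)
  qed
  then show "(LINT x|M. w x * inner (F (u + v) x) (F z x))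
      = (LINT x|M. w x * inner (F u x) (F z x)) + (LINT x|M. w x * inner (F v x) (F z x))"
    using int uvz by simp
next
  fix u z :: "'a \<Rightarrow> real" and c assume uz: "u \<in> V" "z \<in> V"
  have "(LINT x|M. w x * inner (F (\<lambda>y. c * u y) x) (F z x)) = (LINT x|M. c * (w x * inner (F u x) (F z x)))"
  proof (rule integral_cong_AE)
    show "(\<lambda>x. w x * inner (F (\<lambda>y. c * u y) x) (F z x)) \<in> borel_measurable M"
      by (rule borel_measurable_integrable[OF int[OF fspace.subspace_scale[OF V uz(1)] uz(2)]])
    show "(\<lambda>x. c * (w x * inner (F u x) (F z x))) \<in> borel_measurable M"
      by (intro borel_measurable_times borel_measurable_const borel_measurable_integrable int uz)
    show "AE x in M. w x * inner (F (\<lambda>y. c * u y) x) (F z x) = c * (w x * inner (F u x) (F z x))"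
      using scale[OF uz(1), of c] by eventually_elim simp
  qed
  then show "(LINT x|M. w x * inner (F (\<lambda>y. c * u y) x) (F z x)) = c * (LINT x|M. w x * inner (F u x) (F z x))"
    by simp
next
  fix u v :: "'a \<Rightarrow> real"
  show "(LINT x|M. w x * inner (F u x) (F v x)) = (LINT x|M. w x * inner (F v x) (F u x))"
    by (simp add: inner_commute)
next
  fix u :: "'a \<Rightarrow> real"
  show "0 \<le> (LINT x|M. w x * inner (F u x) (F u x))"
    by (rule integral_nonneg_AE) (use w in eventually_elim, simp)
qed (rule V)

context mesh
begin

lemma AE_mesh_interior:
  assumes "D \<in> sets lebesgue" "D \<subseteq> \<Union>\<T>"
  shows "AE x in lebesgue_on D. x \<in> mesh_interior"
proof -
  have "AE x in lebesgue. x \<in> D \<longrightarrow> x \<in> mesh_interior"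
    using AE_skeleton by eventually_elim (use assms(2) in blast)
  then show ?thesis using assms(1) by (subst AE_restrict_space_iff) auto
qed

lemma Omega_lebesgue: "\<Omega> \<in> sets lebesgue" using open_Omega by (simp add: borel_open)

lemma psd_L2: "psd_form bdd_borel (L2_form \<Omega>)"
proof -
  have "psd_form bdd_borel (\<lambda>u v :: 'a \<Rightarrow> real. LINT x|lebesgue_on \<Omega>. 1 * inner (u x) (v x))"
  proof (rule psd_form_integral[OF subspace_bdd_borel])
    fix u v :: "'a \<Rightarrow> real" assume "u \<in> bdd_borel" "v \<in> bdd_borel"
    then obtain B where "\<And>x. \<bar>u x * v x\<bar> \<le> B" "(\<lambda>x. u x * v x) \<in> borel_measurable borel"
      using bdd_borelE[OF bdd_borel_mult] by blast
    then show "integrable (lebesgue_on \<Omega>) (\<lambda>x. 1 * inner (u x) (v x))"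
      by (intro integrable_lebesgue_on_bounded[OF Omega_lebesgue Omega_subset, of _ B])
        (auto intro: borel_lebesgue)
  qed auto
  moreover have "(\<lambda>u v. LINT x|lebesgue_on \<Omega>. 1 * inner (u x) (v x)) = L2_form \<Omega>"
    by (simp add: L2_form_def fun_eq_iff)
  ultimately show ?thesis by simp
qed

text \<open>The zero extension of \<open>u\<close> is continuous on the whole space, so the set
  where it is nonzero is open; a negligible open set is empty. Definiteness thus holds for
  functions, not just up to null sets.\<close>

lemma L2_definite:
  assumes u: "u \<in> Vh0 \<Omega> \<T>" and 0: "L2_form \<Omega> u u = 0"
  shows "u = 0"
proof -
  have bu: "u \<in> bdd_borel" using Vh_bdd_borel u Vh0_subset by blast
  then obtain B where B: "\<And>x. \<bar>u x * u x\<bar> \<le> B" "(\<lambda>x. u x * u x) \<in> borel_measurable borel"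
    using bdd_borelE[OF bdd_borel_mult] by blast
  have int: "integrable (lebesgue_on \<Omega>) (\<lambda>x. u x * u x)"
    by (intro integrable_lebesgue_on_bounded[OF Omega_lebesgue Omega_subset, of _ B])
      (use B in \<open>auto intro: borel_lebesgue\<close>)
  have "AE x in lebesgue_on \<Omega>. u x * u x = 0"
    using integral_nonneg_eq_0_iff_AE[OF int] 0 by (simp add: L2_form_def)
  then have "AE x in lebesgue. x \<in> \<Omega> \<longrightarrow> u x * u x = 0"
    using Omega_lebesgue by (subst (asm) AE_restrict_space_iff) auto
  then have "AE x in lebesgue. x \<notin> {x. u x \<noteq> 0}"
    by eventually_elim (use Vh0_zero[OF u] in auto)
  moreover have o: "open {x. u x \<noteq> 0}"
    by (rule open_Collect_neq[OF Vh0_continuous[OF u] continuous_on_const])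
  ultimately have "{x. u x \<noteq> 0} \<in> null_sets lebesgue"
    by (subst AE_iff_null_sets) (auto simp: borel_open)
  then have "negligible {x. u x \<noteq> 0}" by (simp add: negligible_iff_null_sets)
  then have "{x. u x \<noteq> 0} = {}" using open_not_negligible[OF o] by blast
  then show ?thesis by (auto simp: fun_eq_iff zero_fun_def)
qed

end

section \<open>Forms weighted by the coefficient\<close>

locale fem = mesh \<Omega> \<T> for \<Omega> :: "'a::euclidean_space set" and \<T> +
  fixes \<kappa> :: "'a \<Rightarrow> real" and \<kappa>min \<kappa>max H :: real
  assumes coefficient: "coefficient \<Omega> \<kappa>min \<kappa>max \<kappa>" and H: "0 < H"
begin

lemma kappa_min: "0 < \<kappa>min" using coefficient by (simp add: coefficient_def)

lemma AE_kappa: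
  assumes "D \<in> sets lebesgue" "D \<subseteq> \<Union>\<T>"
  shows "AE x in lebesgue_on D. x \<in> mesh_interior \<and> \<kappa>min \<le> \<kappa> x \<and> \<kappa> x \<le> \<kappa>max"
proof -
  have "AE x in lebesgue_on \<Omega>. \<kappa>min \<le> \<kappa> x \<and> \<kappa> x \<le> \<kappa>max" using coefficient by (simp add: coefficient_def)
  then have "AE x in lebesgue. x \<in> \<Omega> \<longrightarrow> \<kappa>min \<le> \<kappa> x \<and> \<kappa> x \<le> \<kappa>max"
    using Omega_lebesgue by (subst (asm) AE_restrict_space_iff) auto
  then have "AE x in lebesgue. x \<in> D \<longrightarrow> x \<in> mesh_interior \<and> \<kappa>min \<le> \<kappa> x \<and> \<kappa> x \<le> \<kappa>max"
    using AE_skeleton by eventually_elim (use assms(2) mesh_interior_subset in blast)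
  then show ?thesis using assms(1) by (subst AE_restrict_space_iff) auto
qed

text \<open>\<open>\<kappa>\<close> is measurable only on \<open>\<Omega>\<close> and bounded only
  almost everywhere there, while \<open>D\<close> may be a closed coarse element touching the
  boundary. The zero extension \<open>k\<close> repairs this; it differs from
  \<open>\<kappa>\<close> on \<open>D\<close> only within the negligible skeleton.\<close>

lemma integrable_weighted:
  assumes D: "D \<in> sets lebesgue" "D \<subseteq> \<Union>\<T>" and h: "h \<in> borel_measurable lebesgue"
    and B: "AE x in lebesgue. \<bar>h x\<bar> \<le> B"
  shows "integrable (lebesgue_on D) (\<lambda>x. \<kappa> x * h x)"
proof -
  define k where "k x = indicat_real \<Omega> x * \<kappa> x" for x
  have "\<kappa> \<in> borel_measurable (lebesgue_on \<Omega>)" using coefficient by (simp add: coefficient_def)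
  then have k: "k \<in> borel_measurable lebesgue"
    unfolding k_def using Omega_lebesgue by (subst (asm) borel_measurable_restrict_space_iff) auto
  have "AE x in lebesgue_on \<Omega>. \<kappa>min \<le> \<kappa> x \<and> \<kappa> x \<le> \<kappa>max" using coefficient by (simp add: coefficient_def)
  then have "AE x in lebesgue. x \<in> \<Omega> \<longrightarrow> \<kappa>min \<le> \<kappa> x \<and> \<kappa> x \<le> \<kappa>max"
    using Omega_lebesgue by (subst (asm) AE_restrict_space_iff) auto
  then have bound: "AE x in lebesgue. \<bar>k x * h x\<bar> \<le> \<bar>\<kappa>max\<bar> * B"
    using B
  proof eventually_elim
    case (elim x)
    have "\<bar>k x\<bar> \<le> \<bar>\<kappa>max\<bar>" using elim kappa_min by (auto simp: k_def indicator_def)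
    then show ?case unfolding abs_mult using elim by (intro mult_mono) auto
  qed
  have kh: "integrable (lebesgue_on D) (\<lambda>x. k x * h x)"
    by (rule integrable_lebesgue_on_bounded[OF D borel_measurable_times[OF k h] bound])
  have "(\<lambda>x. indicat_real D x *\<^sub>R (\<kappa> x * h x)) \<in> borel_measurable lebesgue"
  proof (rule borel_measurable_AE)
    show "(\<lambda>x. indicat_real D x *\<^sub>R (k x * h x)) \<in> borel_measurable lebesgue"
      using D k h by (intro borel_measurable_scaleR borel_measurable_indicator borel_measurable_times)
    show "AE x in lebesgue. indicat_real D x *\<^sub>R (k x * h x) = indicat_real D x *\<^sub>R (\<kappa> x * h x)"
      using AE_skeleton
      by eventually_elim (use D(2) mesh_interior_subset in \<open>auto simp: k_def indicator_def\<close>)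
  qed
  then have m: "(\<lambda>x. \<kappa> x * h x) \<in> borel_measurable (lebesgue_on D)"
    using D(1) by (subst borel_measurable_restrict_space_iff) auto
  have "AE x in lebesgue_on D. k x * h x = \<kappa> x * h x"
    using AE_mesh_interior[OF D] by eventually_elim (use mesh_interior_subset in \<open>auto simp: k_def\<close>)
  then show ?thesis
    using integrable_cong_AE[OF borel_measurable_integrable[OF kh] m] kh by blast
qed

lemma integrable_weighted_bdd:
  assumes D: "D \<in> sets lebesgue" "D \<subseteq> \<Union>\<T>" and h: "h \<in> bdd_borel"
  shows "integrable (lebesgue_on D) (\<lambda>x. \<kappa> x * h x)"
  using bdd_borelE[OF h] by (metis (no_types, lifting) AE_I2 borel_lebesgue integrable_weighted[OF D])

lemma grad_bound: "u \<in> Vh \<T> \<Longrightarrow> AE x in lebesgue. norm (grad u x) \<le> (\<Sum>T\<in>\<T>. norm (slope u T))"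
  using AE_skeleton by eventually_elim (simp add: pw_grad_eq(2) pw_grad_bound)

lemma integrable_grad_grad:
  assumes D: "D \<in> sets lebesgue" "D \<subseteq> \<Union>\<T>" and u: "u \<in> Vh \<T>" and v: "v \<in> Vh \<T>"
    and h: "h \<in> bdd_borel"
  shows "integrable (lebesgue_on D) (\<lambda>x. \<kappa> x * (h x * inner (grad u x) (grad v x)))"
proof -
  obtain B where B: "0 \<le> B" "\<And>x. \<bar>h x\<bar> \<le> B" "h \<in> borel_measurable borel"
    using bdd_borelE[OF h] by blast
  show ?thesis
  proof (rule integrable_weighted[OF D])
    show "(\<lambda>x. h x * inner (grad u x) (grad v x)) \<in> borel_measurable lebesgue"
      by (intro borel_measurable_times borel_measurable_inner grad_measurable u v borel_lebesgue B)
    show "AE x in lebesgue. \<bar>h x * inner (grad u x) (grad v x)\<bar>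
        \<le> B * ((\<Sum>T\<in>\<T>. norm (slope u T)) * (\<Sum>T\<in>\<T>. norm (slope v T)))"
      using grad_bound[OF u] grad_bound[OF v]
    proof eventually_elim
      case (elim x)
      then have "norm (grad u x) * norm (grad v x) \<le> (\<Sum>T\<in>\<T>. norm (slope u T)) * (\<Sum>T\<in>\<T>. norm (slope v T))"
        by (intro mult_mono) (auto intro: sum_nonneg)
      then have "\<bar>inner (grad u x) (grad v x)\<bar> \<le> (\<Sum>T\<in>\<T>. norm (slope u T)) * (\<Sum>T\<in>\<T>. norm (slope v T))"
        by (rule order_trans[OF Cauchy_Schwarz_ineq2])
      from mult_mono[OF B(2) this B(1)] show ?case unfolding abs_mult by simp
    qed
  qed
qed

lemma one_bdd_borel: "(\<lambda>x. 1) \<in> bdd_borel" by (auto simp: bdd_borel_def)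

lemma psd_a:
  assumes D: "D \<in> sets lebesgue" "D \<subseteq> \<Union>\<T>"
  shows "psd_form (Vh \<T>) (a_form D \<kappa>)"
proof -
  have "psd_form (Vh \<T>) (\<lambda>u v. LINT x|lebesgue_on D. \<kappa> x * inner (grad u x) (grad v x))"
  proof (rule psd_form_integral[OF subspace_Vh])
    show "integrable (lebesgue_on D) (\<lambda>x. \<kappa> x * inner (grad u x) (grad v x))"
      if "u \<in> Vh \<T>" "v \<in> Vh \<T>" for u v
      using integrable_grad_grad[OF D that one_bdd_borel] by simp
    show "AE x in lebesgue_on D. 0 \<le> \<kappa> x"
      using AE_kappa[OF D] by eventually_elim (use kappa_min in auto)
    show "AE x in lebesgue_on D. grad (u + v) x = grad u x + grad v x" if "u \<in> Vh \<T>" "v \<in> Vh \<T>" for u v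
      using AE_mesh_interior[OF D] by eventually_elim (rule grad_add[OF that])
    show "AE x in lebesgue_on D. grad (\<lambda>y. c * u y) x = c *\<^sub>R grad u x" if "u \<in> Vh \<T>" for c u
      using AE_mesh_interior[OF D] by eventually_elim (rule grad_scale[OF that])
  qed
  then show ?thesis by (simp add: a_form_def[abs_def])
qed

lemma psd_s:
  assumes D: "D \<in> sets lebesgue" "D \<subseteq> \<Union>\<T>"
  shows "psd_form bdd_borel (s_form D \<kappa> H)"
proof -
  have "psd_form bdd_borel (\<lambda>u v :: 'a \<Rightarrow> real. LINT x|lebesgue_on D. \<kappa> x * inner (u x) (v x))"
  proof (rule psd_form_integral[OF subspace_bdd_borel])
    show "integrable (lebesgue_on D) (\<lambda>x. \<kappa> x * inner (u x) (v x))"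
      if "u \<in> bdd_borel" "v \<in> bdd_borel" for u v :: "'a \<Rightarrow> real"
      using integrable_weighted_bdd[OF D bdd_borel_mult[OF that]] by simp
    show "AE x in lebesgue_on D. 0 \<le> \<kappa> x"
      using AE_kappa[OF D] by eventually_elim (use kappa_min in auto)
  qed auto
  \<comment> \<open>The second copy has weight 0; only the factor \<open>1 / H\<^sup>2\<close> is
    wanted.\<close>
  from psd_form_add[OF this this, of "1 / H\<^sup>2" 0] show ?thesis
    by (simp add: s_form_def[abs_def] mult.assoc)
qed

lemma psd_bdd_Vh: "psd_form bdd_borel b \<Longrightarrow> psd_form (Vh \<T>) b"
  by (rule psd_form_subset[OF _ _ subspace_Vh]) (use Vh_bdd_borel in auto)

lemma psd_tilde: "0 \<le> dt \<Longrightarrow> psd_form (Vh \<T>) (tilde_form \<Omega> \<kappa> dt)"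
  using psd_form_add[OF psd_a[OF Omega_lebesgue Omega_subset] psd_bdd_Vh[OF psd_L2], of dt 1]
  by (simp add: tilde_form_def[abs_def])

lemma psd_triple: "0 \<le> dt \<Longrightarrow> psd_form (Vh \<T>) (triple_form \<Omega> \<kappa> H dt)"
  using psd_form_add[OF psd_tilde psd_bdd_Vh[OF psd_s[OF Omega_lebesgue Omega_subset]], of dt 1 dt]
  by (simp add: triple_form_def[abs_def])

lemma definite_tilde:
  assumes "0 \<le> dt"
  shows "definite_form (Vh0 \<Omega> \<T>) (tilde_form \<Omega> \<kappa> dt)"
proof -
  interpret t: psd_form "Vh0 \<Omega> \<T>" "tilde_form \<Omega> \<kappa> dt"
    by (rule psd_form_subset[OF psd_tilde[OF assms] Vh0_subset subspace_Vh0])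
  interpret a: psd_form "Vh \<T>" "a_form \<Omega> \<kappa>" by (rule psd_a[OF Omega_lebesgue Omega_subset])
  interpret l: psd_form bdd_borel "L2_form \<Omega>" by (rule psd_L2)
  show ?thesis
  proof
    fix u assume u: "u \<in> Vh0 \<Omega> \<T>" "tilde_form \<Omega> \<kappa> dt u u = 0"
    then have uV: "u \<in> Vh \<T>" using Vh0_subset by blast
    have "0 \<le> dt * a_form \<Omega> \<kappa> u u" using a.nonneg[OF uV] assms by simp
    moreover have "0 \<le> L2_form \<Omega> u u" using l.nonneg[OF Vh_bdd_borel[OF uV]] .
    ultimately have "L2_form \<Omega> u u = 0" using u(2) unfolding tilde_form_def by linarith
    then show "u = 0" by (rule L2_definite[OF u(1)])
  qed
qed

text \<open>The source of the factor \<open>1 / \<kappa>min\<close> in the constants.\<close>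

lemma L2_le_s:
  assumes u: "u \<in> bdd_borel"
  shows "\<kappa>min * L2_form \<Omega> u u \<le> H\<^sup>2 * s_form \<Omega> \<kappa> H u u"
proof -
  note O = Omega_lebesgue Omega_subset
  have uu: "(\<lambda>x. u x * u x) \<in> bdd_borel" by (rule bdd_borel_mult[OF u u])
  obtain B where B: "\<And>x. \<bar>u x * u x\<bar> \<le> B" "(\<lambda>x. u x * u x) \<in> borel_measurable borel"
    using bdd_borelE[OF uu] by blast
  have i: "integrable (lebesgue_on \<Omega>) (\<lambda>x. u x * u x)"
    by (intro integrable_lebesgue_on_bounded[OF O, of _ B]) (use B in \<open>auto intro: borel_lebesgue\<close>)
  have "(LINT x|lebesgue_on \<Omega>. \<kappa>min * (u x * u x)) \<le> (LINT x|lebesgue_on \<Omega>. \<kappa> x * (u x * u x))"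
  proof (rule integral_mono_AE)
    show "AE x in lebesgue_on \<Omega>. \<kappa>min * (u x * u x) \<le> \<kappa> x * (u x * u x)"
      using AE_kappa[OF O] by eventually_elim (auto intro: mult_right_mono)
  qed (use i integrable_weighted_bdd[OF O uu] in auto)
  then show ?thesis using H by (simp add: L2_form_def s_form_def mult.assoc)
qed

end

section \<open>The multiscale coarse space\<close>

text \<open>The finite list \<open>bs\<close> supplies the finite dimension needed to solve the
  multiscale problem by \<open>Riesz_representation\<close>. \<open>\<kappa>bar\<close> stands for
  the uniform bound on \<open>\<kappa>0\<close>.\<close>

locale coarse_fem = fem \<Omega> \<T> \<kappa> \<kappa>min \<kappa>max H
  for \<Omega> :: "'a::euclidean_space set" and \<T> \<kappa> \<kappa>min \<kappa>max H +
  fixes N :: nat and K :: "nat \<Rightarrow> 'a set" and P :: "nat \<Rightarrow> 'a set set" and C\<^sub>\<pi> \<kappa>bar :: real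
    and bs :: "('a \<Rightarrow> real) list"
  assumes coarse: "coarse_mesh \<T> N K"
    and P_finite: "\<And>i. i < N \<Longrightarrow> finite (P i)"
    and P_open: "\<And>i D. i < N \<Longrightarrow> D \<in> P i \<Longrightarrow> open D"
    and P_subset: "\<And>i D. i < N \<Longrightarrow> D \<in> P i \<Longrightarrow> D \<subseteq> K i"
    and low: "\<And>i. i < N \<Longrightarrow> AE x in lebesgue_on (low_part K P i). \<kappa> x \<le> \<kappa>bar"
    and approx: "aux_approximation N K P \<kappa> H C\<^sub>\<pi>"
    and bs: "basis_list bs (Vh0 \<Omega> \<T>)"
begin

sublocale s: psd_form bdd_borel "s_form \<Omega> \<kappa> H" by (rule psd_s[OF Omega_lebesgue Omega_subset])
sublocale a: psd_form "Vh \<T>" "a_form \<Omega> \<kappa>" by (rule psd_a[OF Omega_lebesgue Omega_subset])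
sublocale l: psd_form "bdd_borel :: ('a \<Rightarrow> real) set" "L2_form \<Omega>" by (rule psd_L2)

abbreviation "aO \<equiv> a_form \<Omega> \<kappa>"
abbreviation "sO \<equiv> s_form \<Omega> \<kappa> H"
abbreviation "W \<equiv> Vaux N K P"
abbreviation "pr \<equiv> orth_proj sO W"
abbreviation "B1 \<equiv> aux_basis1 N P"
abbreviation "B2 \<equiv> aux_basis2 N K P"
abbreviation "V0 \<equiv> Vh0 \<Omega> \<T>"

section \<open>Splitting integrals over coarse elements\<close>

lemma K_union:
  assumes "i < N"
  shows "mesh_union (K i)"
  unfolding mesh_union_def
  using coarse[unfolded coarse_mesh_def, THEN conjunct1, rule_format, OF assms] by (rule conjunct2)

lemma K_disjoint: "i < N \<Longrightarrow> j < N \<Longrightarrow> i \<noteq> j \<Longrightarrow> interior (K i) \<inter> interior (K j) = {}"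
  using coarse[unfolded coarse_mesh_def, THEN conjunct2, THEN conjunct1] by blast

lemma K_Union: "(\<Union>i<N. K i) = \<Union>\<T>"
  using coarse[unfolded coarse_mesh_def, THEN conjunct2, THEN conjunct2] .

lemma K_subset: "i < N \<Longrightarrow> K i \<subseteq> \<Union>\<T>" by (rule mesh_union_subset[OF K_union])

lemma K_lebesgue: "i < N \<Longrightarrow> K i \<in> sets lebesgue"
  using mesh_union_closed[OF K_union] by (simp add: borel_closed)

lemma K_cover:
  assumes "x \<in> mesh_interior"
  shows "\<exists>i<N. x \<in> K i"
proof -
  have "x \<in> (\<Union>i<N. K i)" unfolding K_Union using assms mesh_interior_subset Omega_subset by blast
  then show ?thesis by blast
qed

lemma K_unique:
  assumes x: "x \<in> mesh_interior" and i: "i < N" "x \<in> K i" and j: "j < N" "x \<in> K j"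
  shows "i = j"
proof (rule ccontr)
  assume ij: "i \<noteq> j"
  then have d: "interior (K i) \<inter> interior (K j) = {}" using K_disjoint i(1) j(1) ij by blast
  obtain T where T: "T \<in> \<T>" "x \<in> interior T" using mesh_interiorE[OF x] by blast
  have "x \<in> interior (K i)" "x \<in> interior (K j)"
    using mesh_union_cases[OF K_union[OF i(1)] T(1)] mesh_union_cases[OF K_union[OF j(1)] T(1)] T i j by blast+
  then show False using d by blast
qed

lemma sum_indicator_K:
  assumes "x \<in> mesh_interior"
  shows "(\<Sum>i<N. indicat_real (K i) x * c) = c"
proof -
  obtain i where i: "i < N" "x \<in> K i" using K_cover[OF assms] by blast
  have "(\<Sum>j<N. indicat_real (K j) x * c) = (\<Sum>j<N. if j = i then c else 0)"
    using K_unique[OF assms] i by (intro sum.cong) (auto simp: indicator_def)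
  then show ?thesis using i by simp
qed

text \<open>The closed coarse elements overlap only within the skeleton, so almost everywhere their
  indicators add up to the indicator of \<open>\<Omega>\<close>.\<close>

lemma integral_split:
  fixes f :: "'a \<Rightarrow> real"
  assumes int: "\<And>D. D \<in> sets lebesgue \<Longrightarrow> D \<subseteq> \<Union>\<T> \<Longrightarrow> integrable (lebesgue_on D) f"
  shows "(LINT x|lebesgue_on \<Omega>. f x) = (\<Sum>i<N. LINT x|lebesgue_on (K i). f x)"
proof -
  have i: "integrable lebesgue (\<lambda>x. indicat_real D x *\<^sub>R f x)" if "D \<in> sets lebesgue" "D \<subseteq> \<Union>\<T>" for D
    using int[OF that] that(1) integrable_restrict_space[of D lebesgue f] by simp
  have r: "(LINT x|lebesgue_on D. f x) = (LINT x|lebesgue. indicat_real D x *\<^sub>R f x)"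
    if "D \<in> sets lebesgue" for D
    using that by (intro integral_restrict_space) simp
  have "(\<Sum>i<N. LINT x|lebesgue_on (K i). f x) = (\<Sum>i<N. LINT x|lebesgue. indicat_real (K i) x *\<^sub>R f x)"
    using r K_lebesgue by simp
  also have "\<dots> = (LINT x|lebesgue. (\<Sum>i<N. indicat_real (K i) x *\<^sub>R f x))"
    by (rule Bochner_Integration.integral_sum[symmetric]) (rule i[OF K_lebesgue K_subset]; simp)
  also have "\<dots> = (LINT x|lebesgue. indicat_real \<Omega> x *\<^sub>R f x)"
  proof (rule integral_cong_AE)
    show "(\<lambda>x. \<Sum>i<N. indicat_real (K i) x *\<^sub>R f x) \<in> borel_measurable lebesgue"
      by (intro borel_measurable_sum borel_measurable_integrable i[OF K_lebesgue K_subset]; simp)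
    show "(\<lambda>x. indicat_real \<Omega> x *\<^sub>R f x) \<in> borel_measurable lebesgue"
      by (intro borel_measurable_integrable i Omega_lebesgue Omega_subset)
    show "AE x in lebesgue. (\<Sum>i<N. indicat_real (K i) x *\<^sub>R f x) = indicat_real \<Omega> x *\<^sub>R f x"
      using AE_skeleton
    proof eventually_elim
      case (elim x)
      show ?case
      proof (cases "x \<in> mesh_interior")
        case True
        then show ?thesis using sum_indicator_K[OF True, of "f x"] mesh_interior_subset by auto
      next
        case False
        then have x: "x \<notin> \<Union>\<T>" using elim by blast
        then have "x \<notin> K i" if "i < N" for i using K_subset[OF that] by blast
        moreover have "x \<notin> \<Omega>" using x Omega_subset by blast
        ultimately show ?thesis by simp
      qed
    qed
  qed
  also have "\<dots> = (LINT x|lebesgue_on \<Omega>. f x)" using r[OF Omega_lebesgue] by simp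
  finally show ?thesis by simp
qed

lemma s_split:
  assumes "u \<in> bdd_borel"
  shows "sO u u = (\<Sum>i<N. s_form (K i) \<kappa> H u u)"
  unfolding s_form_def mult.assoc
  using integral_split[of "\<lambda>x. \<kappa> x * (u x * u x)"] integrable_weighted_bdd[OF _ _ bdd_borel_mult[OF assms assms]]
  by (simp add: sum_divide_distrib)

lemma a_split:
  assumes "u \<in> Vh \<T>"
  shows "aO u u = (\<Sum>i<N. a_form (K i) \<kappa> u u)"
  unfolding a_form_def
  using integral_split[of "\<lambda>x. \<kappa> x * inner (grad u x) (grad u x)"]
    integrable_grad_grad[OF _ _ assms assms one_bdd_borel] by simp

section \<open>The auxiliary space and its projection\<close>

lemma P_borel: "i < N \<Longrightarrow> D \<in> P i \<Longrightarrow> D \<in> sets borel" using P_open by (simp add: borel_open)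

lemma low_part_borel: "i < N \<Longrightarrow> low_part K P i \<in> sets borel"
proof -
  assume i: "i < N"
  have "open (\<Union>(P i))" by (rule open_Union) (use P_open[OF i] in blast)
  then show ?thesis unfolding low_part_def
    using sets.Diff[OF borel_closed[OF mesh_union_closed[OF K_union[OF i]]] borel_open] by blast
qed

lemma finite_B1: "finite B1" unfolding aux_basis1_def using P_finite by auto

lemma finite_B: "finite (B1 \<union> B2)" using finite_B1 unfolding aux_basis2_def by auto

lemma B_bdd: "B1 \<union> B2 \<subseteq> bdd_borel"
proof
  fix f assume "f \<in> B1 \<union> B2"
  then obtain i D where "i < N" "D \<in> P i \<or> D = low_part K P i" "f = indicat_real D"
    unfolding aux_basis1_def aux_basis2_def by blast
  then show "f \<in> bdd_borel" using indicat_bdd_borel P_borel low_part_borel by metis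
qed

lemma W_bdd: "w \<in> W \<Longrightarrow> w \<in> bdd_borel"
  unfolding Vaux_def by (rule s.mem_span[OF B_bdd])

lemma V0_Vh: "u \<in> V0 \<Longrightarrow> u \<in> Vh \<T>" using Vh0_subset by blast

lemma V0_bdd: "u \<in> V0 \<Longrightarrow> u \<in> bdd_borel" by (rule Vh_bdd_borel[OF V0_Vh])

lemma pr_mem: "u \<in> bdd_borel \<Longrightarrow> pr u \<in> W"
  unfolding Vaux_def by (rule s.orth_proj_span(1)[OF finite_B B_bdd])

lemma pr_orth: "u \<in> bdd_borel \<Longrightarrow> w \<in> W \<Longrightarrow> sO (pr u) w = sO u w"
  unfolding Vaux_def by (rule s.orth_proj_span(2)[OF finite_B B_bdd])

lemma Vaux_elem_outside:
  assumes "i < N" "p \<in> Vaux_elem K P i" "x \<notin> K i"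
  shows "p x = 0"
proof -
  have "fspace.subspace {p. p x = 0}" by (rule fspace.subspaceI) (auto simp: zero_fun_def plus_fun_def)
  moreover have "indicat_real ` insert (low_part K P i) (P i) \<subseteq> {p. p x = 0}"
  proof (rule image_subsetI)
    fix D assume "D \<in> insert (low_part K P i) (P i)"
    then have "x \<notin> D" using assms(3) P_subset[OF assms(1)] unfolding low_part_def by blast
    then show "indicat_real D \<in> {p. p x = 0}" by simp
  qed
  ultimately show ?thesis using assms(2) fspace.span_minimal unfolding Vaux_elem_def by blast
qed

lemma Vaux_elem_subset: "i < N \<Longrightarrow> Vaux_elem K P i \<subseteq> W"
  unfolding Vaux_elem_def Vaux_def aux_basis1_def aux_basis2_def
  by (rule fspace.span_mono) blast

lemma aux_elem_approximation:
  assumes u: "u \<in> V0" and i: "i < N"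
  obtains p where "p \<in> Vaux_elem K P i" "s_form (K i) \<kappa> H (u - p) (u - p) \<le> C\<^sub>\<pi> * a_form (K i) \<kappa> u u"
proof
  interpret sK: psd_form bdd_borel "s_form (K i) \<kappa> H" by (rule psd_s[OF K_lebesgue[OF i] K_subset[OF i]])
  let ?B = "indicat_real ` insert (low_part K P i) (P i)"
  let ?p = "orth_proj (s_form (K i) \<kappa> H) (Vaux_elem K P i) u"
  have B: "finite ?B" "?B \<subseteq> bdd_borel"
    using P_finite[OF i] P_borel[OF i] low_part_borel[OF i] by (auto intro!: indicat_bdd_borel)
  show "?p \<in> Vaux_elem K P i"
    unfolding Vaux_elem_def by (rule sK.orth_proj_span(1)[OF B V0_bdd[OF u]])
  have "interior (K i) \<subseteq> \<Union>\<T>" using interior_subset K_subset[OF i] by blast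
  then have "H1_with_gradient (interior (K i)) u (grad u)" by (rule Vh0_H1[OF u open_interior])
  then show "s_form (K i) \<kappa> H (u - ?p) (u - ?p) \<le> C\<^sub>\<pi> * a_form (K i) \<kappa> u u"
    using approx i unfolding aux_approximation_def Let_def a_form_def
    by (simp add: power2_norm_eq_inner)
qed

text \<open>The hypothesis concerns a separate projection on each coarse element. Their sum
  \<open>q\<close> lies in the auxiliary space and agrees almost everywhere on \<open>K i\<close>
  with the local projection, since the others vanish off their own elements. The global projection
  is at least as good as \<open>q\<close>; its restrictions need not be identified.\<close>

lemma pr_approximation:
  assumes u: "u \<in> V0"
  shows "sO (u - pr u) (u - pr u) \<le> C\<^sub>\<pi> * aO u u"
proof -
  have "\<forall>i. \<exists>p. i < N \<longrightarrow> p \<in> Vaux_elem K P i \<and>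
      s_form (K i) \<kappa> H (u - p) (u - p) \<le> C\<^sub>\<pi> * a_form (K i) \<kappa> u u"
    using aux_elem_approximation[OF u] by metis
  then obtain p where p: "\<And>i. i < N \<Longrightarrow> p i \<in> Vaux_elem K P i"
    "\<And>i. i < N \<Longrightarrow> s_form (K i) \<kappa> H (u - p i) (u - p i) \<le> C\<^sub>\<pi> * a_form (K i) \<kappa> u u" by metis
  define q where "q = (\<Sum>i<N. p i)"
  have pW: "p i \<in> W" if "i < N" for i using p(1)[OF that] Vaux_elem_subset[OF that] by blast
  have qW: "q \<in> W" unfolding q_def Vaux_def by (rule fspace.span_sum) (use pW in \<open>simp add: Vaux_def\<close>)
  have uq: "u - q \<in> bdd_borel" using s.mem_diff V0_bdd[OF u] W_bdd[OF qW] by blast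
  have eq: "s_form (K i) \<kappa> H (u - q) (u - q) = s_form (K i) \<kappa> H (u - p i) (u - p i)" if i: "i < N" for i
  proof -
    have up: "u - p i \<in> bdd_borel" using s.mem_diff V0_bdd[OF u] W_bdd[OF pW[OF i]] by blast
    note D = K_lebesgue[OF i] K_subset[OF i]
    have "(LINT x|lebesgue_on (K i). \<kappa> x * ((u - q) x * (u - q) x))
        = (LINT x|lebesgue_on (K i). \<kappa> x * ((u - p i) x * (u - p i) x))"
    proof (rule integral_cong_AE)
      show "(\<lambda>x. \<kappa> x * ((u - q) x * (u - q) x)) \<in> borel_measurable (lebesgue_on (K i))"
        by (rule borel_measurable_integrable[OF integrable_weighted_bdd[OF D bdd_borel_mult[OF uq uq]]])
      show "(\<lambda>x. \<kappa> x * ((u - p i) x * (u - p i) x)) \<in> borel_measurable (lebesgue_on (K i))"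
        by (rule borel_measurable_integrable[OF integrable_weighted_bdd[OF D bdd_borel_mult[OF up up]]])
      have "AE x in lebesgue_on (K i). x \<in> K i" using D(1) by (subst AE_restrict_space_iff) auto
      then show "AE x in lebesgue_on (K i). \<kappa> x * ((u - q) x * (u - q) x) = \<kappa> x * ((u - p i) x * (u - p i) x)"
        using AE_mesh_interior[OF D]
      proof eventually_elim
        case (elim x)
        have "q x = (\<Sum>j<N. if j = i then p i x else 0)"
          unfolding q_def sum_apply
        proof (intro sum.cong refl)
          fix j assume "j \<in> {..<N}"
          then show "p j x = (if j = i then p i x else 0)"
            using Vaux_elem_outside[of j "p j" x] p(1) K_unique[OF elim(2) i elim(1)] by auto
        qed
        then have "q x = p i x" using i by simp
        then show ?case by simp
      qed
    qed
    then show ?thesis by (simp add: s_form_def mult.assoc)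
  qed
  have "sO (u - pr u) (u - pr u) \<le> sO (u - q) (u - q)"
    using s.orth_proj_best[OF finite_B B_bdd V0_bdd[OF u], of q] qW by (simp add: Vaux_def)
  also have "\<dots> = (\<Sum>i<N. s_form (K i) \<kappa> H (u - p i) (u - p i))" unfolding s_split[OF uq] using eq by simp
  also have "\<dots> \<le> (\<Sum>i<N. C\<^sub>\<pi> * a_form (K i) \<kappa> u u)" by (intro sum_mono p) simp
  also have "\<dots> = C\<^sub>\<pi> * aO u u" unfolding a_split[OF V0_Vh[OF u]] by (simp add: sum_distrib_left)
  finally show ?thesis .
qed

text \<open>The part of \<open>u\<close> outside the auxiliary space is paid for by its energy.
  \<open>max 0\<close> appears because no sign of \<open>C\<^sub>\<pi>\<close> is assumed.\<close>

lemma s_le: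
  assumes u: "u \<in> V0"
  shows "sO u u \<le> 2 * max 0 C\<^sub>\<pi> * aO u u + 2 * sO (pr u) (pr u)"
proof -
  have b: "u \<in> bdd_borel" "pr u \<in> bdd_borel" using V0_bdd[OF u] W_bdd[OF pr_mem] by blast+
  have "sO u u \<le> 2 * sO (u - pr u) (u - pr u) + 2 * sO (pr u) (pr u)"
    using s.quadratic_add_le[of "u - pr u" "pr u"] b s.mem_diff by simp
  moreover have "sO (u - pr u) (u - pr u) \<le> max 0 C\<^sub>\<pi> * aO u u"
    using pr_approximation[OF u] a.nonneg[OF V0_Vh[OF u]]
    by (meson max.cobounded2 mult_right_mono order_trans)
  ultimately show ?thesis by simp
qed

section \<open>The multiscale problem\<close>

definition ms_form :: "('a \<Rightarrow> real) \<Rightarrow> ('a \<Rightarrow> real) \<Rightarrow> real" where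
  "ms_form u v = aO u v + sO (pr u) (pr v)"

lemma s_pr_left: "u \<in> bdd_borel \<Longrightarrow> v \<in> bdd_borel \<Longrightarrow> sO (pr u) (pr v) = sO u (pr v)"
  by (rule pr_orth[OF _ pr_mem])

text \<open>The chosen representative \<open>pr u\<close> need not depend linearly on
  \<open>u\<close>. Linearity comes from \<open>s_pr_left\<close>:
  \<open>sO (pr u) (pr w) = sO u (pr w)\<close>. For definiteness, vanishing energy and projection
  force \<open>sO u u = 0\<close> by \<open>s_le\<close>, hence vanishing mass.\<close>

lemma definite_ms_form: "definite_form V0 ms_form"
proof
  show "fspace.subspace V0" by (rule subspace_Vh0)
  show "ms_form (u + v) w = ms_form u w + ms_form v w" if "u \<in> V0" "v \<in> V0" "w \<in> V0" for u v w
    using that V0_bdd[OF fspace.subspace_add[OF subspace_Vh0]] W_bdd[OF pr_mem]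
    by (simp add: ms_form_def s_pr_left V0_bdd a.add_left V0_Vh s.add_left)
  show "ms_form (\<lambda>x. c * u x) w = c * ms_form u w" if "u \<in> V0" "w \<in> V0" for c u w
    using that V0_bdd[OF fspace.subspace_scale[OF subspace_Vh0]] W_bdd[OF pr_mem]
    by (simp add: ms_form_def s_pr_left V0_bdd a.scale_left V0_Vh s.scale_left distrib_left)
  show "ms_form u v = ms_form v u" if "u \<in> V0" "v \<in> V0" for u v
    unfolding ms_form_def
    using a.sym[OF V0_Vh[OF that(1)] V0_Vh[OF that(2)]] s.sym[OF W_bdd[OF pr_mem] W_bdd[OF pr_mem]] V0_bdd that by simp
  show nn: "0 \<le> ms_form u u" if "u \<in> V0" for u
    unfolding ms_form_def using a.nonneg[OF V0_Vh[OF that]] s.nonneg[OF W_bdd[OF pr_mem[OF V0_bdd[OF that]]]] by simp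
  show "u = 0" if u: "u \<in> V0" and 0: "ms_form u u = 0" for u
  proof -
    have "aO u u = 0" "sO (pr u) (pr u) = 0"
      using a.nonneg[OF V0_Vh[OF u]] s.nonneg[OF W_bdd[OF pr_mem[OF V0_bdd[OF u]]]] 0
      unfolding ms_form_def by linarith+
    then have "sO u u \<le> 0" using s_le[OF u] by simp
    then have "\<kappa>min * L2_form \<Omega> u u \<le> 0"
      using L2_le_s[OF V0_bdd[OF u]] by (smt (verit) mult_nonneg_nonpos zero_le_power2)
    then have "L2_form \<Omega> u u = 0"
      using kappa_min l.nonneg[OF V0_bdd[OF u]] by (simp add: mult_le_0_iff)
    then show ?thesis by (rule L2_definite[OF u])
  qed
qed

sublocale ms: definite_form V0 ms_form by (rule definite_ms_form)

abbreviation "ms \<equiv> multiscale_function \<Omega> \<T> \<kappa> H W"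

lemma ms_unique:
  assumes "u \<in> V0" "u' \<in> V0" "\<And>v. v \<in> V0 \<Longrightarrow> ms_form u v = ms_form u' v"
  shows "u = u'"
proof -
  have d: "u - u' \<in> V0" using ms.mem_diff assms by blast
  have "ms_form (u - u') (u - u') = 0"
    using ms.diff_left[OF assms(1,2) d] assms(3)[OF d] by simp
  then have "u - u' = 0" by (rule ms.definite[OF d])
  then show ?thesis by simp
qed

text \<open>Existence by Riesz and uniqueness by definiteness justify the definite description in
  \<open>multiscale_function\<close>.\<close>

lemma ms_props:
  assumes \<psi>: "\<psi> \<in> W"
  shows "ms \<psi> \<in> V0" "v \<in> V0 \<Longrightarrow> ms_form (ms \<psi>) v = sO \<psi> (pr v)"
proof -
  have bsV: "set bs \<subseteq> V0" and sp: "fspace.span (set bs) = V0"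
    using bs fspace.span_superset unfolding basis_list_def by blast+
  \<comment> \<open>The right-hand side rewritten without \<open>pr\<close>, so that it is visibly
    linear in \<open>v\<close>.\<close>
  have l: "sO \<psi> (pr v) = sO v \<psi>" if "v \<in> V0" for v
    using pr_orth[OF V0_bdd[OF that] \<psi>] s.sym[OF W_bdd[OF \<psi>] W_bdd[OF pr_mem[OF V0_bdd[OF that]]]] by simp
  have "\<exists>p\<in>fspace.span (set bs). \<forall>v\<in>fspace.span (set bs). ms_form p v = sO v \<psi>"
  proof (rule ms.Riesz_representation[OF _ bsV, where l = "\<lambda>v. sO v \<psi>"])
    show "sO (u + v) \<psi> = sO u \<psi> + sO v \<psi>" if "u \<in> fspace.span (set bs)" "v \<in> fspace.span (set bs)" for u v
      by (rule s.add_left) (use that V0_bdd W_bdd[OF \<psi>] in \<open>auto simp: sp\<close>)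
    show "sO (\<lambda>x. c * u x) \<psi> = c * sO u \<psi>" if "u \<in> fspace.span (set bs)" for c u
      by (rule s.scale_left) (use that V0_bdd W_bdd[OF \<psi>] in \<open>auto simp: sp\<close>)
    show "sO v \<psi> = 0" if "v \<in> fspace.span (set bs)" "ms_form v v = 0" for v
      using ms.definite[of v] that s.zero_left[OF W_bdd[OF \<psi>]] unfolding sp by simp
  qed simp
  then obtain p where p: "p \<in> V0" "\<And>v. v \<in> V0 \<Longrightarrow> ms_form p v = sO \<psi> (pr v)" using l unfolding sp by auto
  have "\<exists>!p. p \<in> V0 \<and> (\<forall>v\<in>V0. aO p v + sO (pr p) (pr v) = sO \<psi> (pr v))"
  proof (rule ex1I[of _ p])
    show "p \<in> V0 \<and> (\<forall>v\<in>V0. aO p v + sO (pr p) (pr v) = sO \<psi> (pr v))"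
      using p by (simp add: ms_form_def)
    show "q = p" if "q \<in> V0 \<and> (\<forall>v\<in>V0. aO q v + sO (pr q) (pr v) = sO \<psi> (pr v))" for q
      by (rule ms_unique) (use that p in \<open>auto simp: ms_form_def\<close>)
  qed
  from theI'[OF this] show "ms \<psi> \<in> V0" "v \<in> V0 \<Longrightarrow> ms_form (ms \<psi>) v = sO \<psi> (pr v)"
    unfolding multiscale_function_def Let_def ms_form_def by auto
qed

lemma W_add: "\<psi> \<in> W \<Longrightarrow> \<psi>' \<in> W \<Longrightarrow> \<psi> + \<psi>' \<in> W" unfolding Vaux_def by (rule fspace.span_add)

lemma ms_add:
  assumes "\<psi> \<in> W" "\<psi>' \<in> W"
  shows "ms (\<psi> + \<psi>') = ms \<psi> + ms \<psi>'"
proof (rule ms_unique)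
  show "ms (\<psi> + \<psi>') \<in> V0" by (rule ms_props(1)[OF W_add[OF assms]])
  show "ms \<psi> + ms \<psi>' \<in> V0" using ms.mem_add ms_props(1) assms by blast
  show "ms_form (ms (\<psi> + \<psi>')) v = ms_form (ms \<psi> + ms \<psi>') v" if v: "v \<in> V0" for v
    using ms_props assms v W_add[OF assms] W_bdd pr_mem[OF V0_bdd[OF v]]
    by (simp add: ms.add_left s.add_left)
qed

lemma span_B_W: "fspace.span B1 \<subseteq> W" "fspace.span B2 \<subseteq> W"
  unfolding Vaux_def by (auto intro!: fspace.span_mono)

section \<open>The low-permeability component of the projection\<close>

definition low_set :: "'a set" where "low_set = (\<Union>i<N. low_part K P i)"

text \<open>The delicate case is the closed low part of a neighbouring coarse element. An open
  component containing one of its points would meet the interior of a fine element of that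
  neighbour, against disjointness of the interiors. Hence the two halves of the auxiliary space have
  pointwise disjoint supports.\<close>

lemma components_disjoint_low:
  assumes j: "j < N" "D \<in> P j" "x \<in> D"
  shows "x \<notin> low_set"
proof
  assume "x \<in> low_set"
  then obtain i where i: "i < N" "x \<in> low_part K P i" by (auto simp: low_set_def)
  have ij: "i \<noteq> j" using i j by (auto simp: low_part_def)
  then have d: "interior (K i) \<inter> interior (K j) = {}" using K_disjoint i(1) j(1) ij by blast
  have "x \<in> K i" using i by (simp add: low_part_def)
  then obtain T where T: "T \<in> \<T>" "T \<subseteq> K i" "x \<in> T" using mesh_unionE[OF K_union[OF i(1)]] by blast
  have "x \<in> closure (interior T)" using closure_interior_T T by simp
  then have "D \<inter> interior T \<noteq> {}" using open_Int_closure_eq_empty[OF P_open[OF j(1,2)]] j(3) by blast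
  moreover have "D \<subseteq> interior (K j)" by (rule interior_maximal[OF P_subset[OF j(1,2)] P_open[OF j(1,2)]])
  moreover have "interior T \<subseteq> interior (K i)" using T interior_mono by blast
  ultimately show False using d by blast
qed

lemma span_B1_low:
  assumes "f \<in> fspace.span B1" "x \<in> low_set" shows "f x = 0"
proof -
  have "fspace.subspace {p. p x = 0}" by (rule fspace.subspaceI) (auto simp: zero_fun_def plus_fun_def)
  moreover have "B1 \<subseteq> {p. p x = 0}"
    using components_disjoint_low assms(2) by (auto simp: aux_basis1_def indicator_def)
  ultimately show ?thesis using assms(1) fspace.span_minimal by blast
qed

lemma span_B2_high:
  assumes "f \<in> fspace.span B2" "x \<notin> low_set" shows "f x = 0"
proof -
  have "fspace.subspace {p. p x = 0}" by (rule fspace.subspaceI) (auto simp: zero_fun_def plus_fun_def)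
  moreover have "B2 \<subseteq> {p. p x = 0}"
    using assms(2) by (auto simp: aux_basis2_def indicator_def low_set_def)
  ultimately show ?thesis using assms(1) fspace.span_minimal by blast
qed

lemma AE_low: "AE x in lebesgue_on \<Omega>. x \<in> low_set \<longrightarrow> \<kappa> x \<le> \<kappa>bar"
proof -
  have "AE x in lebesgue. x \<in> low_part K P i \<longrightarrow> \<kappa> x \<le> \<kappa>bar" if "i < N" for i
    using low[OF that] low_part_borel[OF that] by (subst (asm) AE_restrict_space_iff) auto
  then have "AE x in lebesgue. \<forall>i\<in>{..<N}. x \<in> low_part K P i \<longrightarrow> \<kappa> x \<le> \<kappa>bar"
    by (intro AE_finite_allI) auto
  then have "AE x in lebesgue. x \<in> \<Omega> \<longrightarrow> x \<in> low_set \<longrightarrow> \<kappa> x \<le> \<kappa>bar"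
    by eventually_elim (auto simp: low_set_def)
  then show ?thesis using Omega_lebesgue by (subst AE_restrict_space_iff) auto
qed

text \<open>Disjoint supports make the two components orthogonal, so
  \<open>sO v \<psi>2 = sO \<psi>2 \<psi>2\<close>, and the estimate becomes an integral over the
  low part, where \<open>\<kappa>\<close> is at most \<open>\<kappa>bar\<close>. The factor
  \<open>H\<^sup>2\<close> cancels the scaling of \<open>s\<close> and leaves the plain mass
  form.\<close>

lemma low_component_bound:
  assumes v: "v \<in> bdd_borel" and \<psi>: "pr v = \<psi>1 + \<psi>2" "\<psi>1 \<in> fspace.span B1" "\<psi>2 \<in> fspace.span B2"
  shows "H\<^sup>2 * sO \<psi>2 \<psi>2 \<le> max 0 \<kappa>bar * L2_form \<Omega> v v"
proof -
  note O = Omega_lebesgue Omega_subset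
  have W: "\<psi>1 \<in> W" "\<psi>2 \<in> W" using \<psi> span_B_W by blast+
  have b: "\<psi>1 \<in> bdd_borel" "\<psi>2 \<in> bdd_borel" using W W_bdd by auto
  have "\<psi>1 x * \<psi>2 x = 0" for x using span_B1_low[OF \<psi>(2)] span_B2_high[OF \<psi>(3)] by (cases "x \<in> low_set") auto
  then have "(\<lambda>x. \<kappa> x * (\<psi>1 x * \<psi>2 x)) = (\<lambda>x. 0)" by auto
  then have "sO \<psi>1 \<psi>2 = 0" unfolding s_form_def mult.assoc by simp
  then have vp: "sO v \<psi>2 = sO \<psi>2 \<psi>2"
    using pr_orth[OF v W(2)] b unfolding \<psi>(1) by (simp add: s.add_left)
  \<comment> \<open>Orthogonality gives
    \<open>2 * sO v \<psi>2 - sO \<psi>2 \<psi>2 = sO \<psi>2 \<psi>2\<close>; completing the square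
    gives \<open>f \<le> v\<^sup>2\<close> on the low set, and \<open>f\<close> vanishes
    elsewhere.\<close>
  define f where "f x = 2 * (v x * \<psi>2 x) - \<psi>2 x * \<psi>2 x" for x
  have i1: "integrable (lebesgue_on \<Omega>) (\<lambda>x. \<kappa> x * (v x * \<psi>2 x))" "integrable (lebesgue_on \<Omega>) (\<lambda>x. \<kappa> x * (\<psi>2 x * \<psi>2 x))"
    using integrable_weighted_bdd[OF O bdd_borel_mult] v b by blast+
  have fe: "(\<lambda>x. \<kappa> x * f x) = (\<lambda>x. 2 * (\<kappa> x * (v x * \<psi>2 x)) - \<kappa> x * (\<psi>2 x * \<psi>2 x))"
    by (simp add: f_def right_diff_distrib mult.left_commute)
  have fi: "integrable (lebesgue_on \<Omega>) (\<lambda>x. \<kappa> x * f x)" unfolding fe using i1 by simp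
  have "H\<^sup>2 * (2 * sO v \<psi>2 - sO \<psi>2 \<psi>2) = (LINT x|lebesgue_on \<Omega>. \<kappa> x * f x)"
    unfolding fe using i1 H by (simp add: s_form_def mult.assoc right_diff_distrib)
  also have "\<dots> \<le> (LINT x|lebesgue_on \<Omega>. max 0 \<kappa>bar * (v x * v x))"
  proof (rule integral_mono_AE[OF fi])
    obtain B where "\<And>x. \<bar>v x * v x\<bar> \<le> B" "(\<lambda>x. v x * v x) \<in> borel_measurable borel"
      using bdd_borelE[OF bdd_borel_mult[OF v v]] by blast
    then have "integrable (lebesgue_on \<Omega>) (\<lambda>x. v x * v x)"
      by (intro integrable_lebesgue_on_bounded[OF O, of _ B]) (auto intro: borel_lebesgue)
    then show "integrable (lebesgue_on \<Omega>) (\<lambda>x. max 0 \<kappa>bar * (v x * v x))" by simp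
    show "AE x in lebesgue_on \<Omega>. \<kappa> x * f x \<le> max 0 \<kappa>bar * (v x * v x)"
      using AE_kappa[OF O] AE_low
    proof eventually_elim
      case (elim x)
      show ?case
      proof (cases "x \<in> low_set")
        case True
        have "f x \<le> v x * v x"
          using zero_le_square[of "v x - \<psi>2 x"] unfolding f_def by (simp add: algebra_simps)
        then have "\<kappa> x * f x \<le> \<kappa> x * (v x * v x)" using elim kappa_min by (intro mult_left_mono) auto
        also have "\<dots> \<le> max 0 \<kappa>bar * (v x * v x)" using elim True by (intro mult_right_mono) auto
        finally show ?thesis .
      next
        case False
        then have "f x = 0" using span_B2_high[OF \<psi>(3)] by (simp add: f_def)
        then show ?thesis by simp
      qed
    qed
  qed
  finally show ?thesis by (simp add: vp L2_form_def)
qed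

end

section \<open>Stable decomposition\<close>

lemma sqrt_le_imp_le:
  assumes "sqrt x \<le> c * sqrt y" "0 \<le> x" "0 \<le> y"
  shows "x \<le> c\<^sup>2 * y"
proof -
  have "(sqrt x)\<^sup>2 \<le> (c * sqrt y)\<^sup>2" using assms by (intro power_mono) auto
  then show ?thesis using assms by (simp add: power_mult_distrib)
qed

text \<open>Cauchy-Schwarz over the active indices alone: the factor is the overlap rather than the
  number of subdomains.\<close>

lemma norm_sum_square_le:
  fixes g :: "nat \<Rightarrow> 'a::real_normed_vector"
  assumes "card {i. i < N \<and> p i} \<le> m" "\<And>i. i < N \<Longrightarrow> \<not> p i \<Longrightarrow> g i = 0"
  shows "(norm (\<Sum>i<N. g i))\<^sup>2 \<le> real m * (\<Sum>i<N. (norm (g i))\<^sup>2)"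
proof -
  let ?J = "{i. i < N \<and> p i}"
  have "(\<Sum>i<N. g i) = (\<Sum>i\<in>?J. g i)" by (rule sum.mono_neutral_right) (use assms(2) in auto)
  then have "(norm (\<Sum>i<N. g i))\<^sup>2 \<le> (\<Sum>i\<in>?J. norm (g i))\<^sup>2"
    using norm_sum[of g ?J] by (simp add: power_mono)
  also have "\<dots> \<le> (\<Sum>i\<in>?J. (norm (g i))\<^sup>2) * card ?J" by (rule sum_squared_le_sum_of_squares)
  also have "\<dots> \<le> (\<Sum>i\<in>?J. (norm (g i))\<^sup>2) * m"
    using assms(1) by (intro mult_left_mono) (auto intro: sum_nonneg)
  also have "\<dots> \<le> (\<Sum>i<N. (norm (g i))\<^sup>2) * m"
    by (intro mult_right_mono sum_mono2) auto
  finally show ?thesis by (simp add: mult.commute)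
qed

lemma norm_add_square_le:
  fixes a c :: "'a::real_inner"
  shows "inner (a + c) (a + c) \<le> 2 * inner a a + 2 * inner c c"
proof -
  have "0 \<le> inner (a - c) (a - c)" by simp
  then show ?thesis by (simp add: inner_add_left inner_add_right inner_diff_left inner_diff_right inner_commute)
qed

locale two_level = coarse_fem \<Omega> \<T> \<kappa> \<kappa>min \<kappa>max H N K P C\<^sub>\<pi> \<kappa>bar bs
  for \<Omega> :: "'a::euclidean_space set" and \<T> \<kappa> \<kappa>min \<kappa>max H N K P C\<^sub>\<pi> \<kappa>bar bs +
  fixes layers :: "nat \<Rightarrow> nat" and \<theta> :: "nat \<Rightarrow> 'a \<Rightarrow> real" and N\<^sub>o\<^sub>v :: nat
    and C\<^sub>\<theta> C\<^sub>I dt c\<^sub>t C\<^sub>t :: real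
  assumes cover: "overlapping_cover \<Omega> N (\<lambda>i. subdomain \<T> (layers i) (K i)) N\<^sub>o\<^sub>v"
    and pou: "partition_of_unity \<Omega> \<T> N (\<lambda>i. subdomain \<T> (layers i) (K i)) \<theta> H C\<^sub>\<theta>"
    and interp: "interp_stable \<Omega> \<T> \<kappa> H C\<^sub>I"
    and ct: "0 < c\<^sub>t" and dt_lower: "c\<^sub>t * H\<^sup>2 \<le> dt" and dt_upper: "dt \<le> C\<^sub>t * H\<^sup>2"
begin

abbreviation "\<omega> i \<equiv> subdomain \<T> (layers i) (K i)"
abbreviation "lO \<equiv> L2_form \<Omega>"
abbreviation "tilde \<equiv> tilde_form \<Omega> \<kappa> dt"
abbreviation "triple \<equiv> triple_form \<Omega> \<kappa> H dt"
abbreviation "Vloc i \<equiv> Vh0_local \<Omega> \<T> (\<omega> i)"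

lemma dt_pos: "0 < dt"
proof -
  have "0 < c\<^sub>t * H\<^sup>2" using ct H by simp
  then show ?thesis using dt_lower by simp
qed

sublocale t: definite_form V0 tilde by (rule definite_tilde) (use dt_pos in simp)
sublocale r: psd_form "Vh \<T>" triple by (rule psd_triple) (use dt_pos in simp)

section \<open>Stability of the coarse component\<close>

lemma tilde_eq: "tilde u u = dt * aO u u + lO u u" by (simp add: tilde_form_def)

lemma triple_eq: "triple u u = dt * aO u u + lO u u + dt * sO u u" by (simp add: triple_form_def tilde_form_def)

lemma L2_bound:
  assumes u: "u \<in> bdd_borel"
  shows "lO u u \<le> dt * (1 / (\<kappa>min * c\<^sub>t) * sO u u)"
proof -
  have "c\<^sub>t * (\<kappa>min * lO u u) \<le> c\<^sub>t * (H\<^sup>2 * sO u u)" using L2_le_s[OF u] ct by (intro mult_left_mono) auto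
  also have "\<dots> = (c\<^sub>t * H\<^sup>2) * sO u u" by simp
  also have "\<dots> \<le> dt * sO u u" using dt_lower s.nonneg[OF u] by (rule mult_right_mono)
  finally show ?thesis using ct kappa_min by (simp add: pos_le_divide_eq mult_ac)
qed

lemma triple_le:
  assumes u: "u \<in> V0"
  shows "triple u u \<le> dt * (aO u u + (1 + 1 / (\<kappa>min * c\<^sub>t)) * sO u u)"
  using L2_bound[OF V0_bdd[OF u]] by (simp add: triple_eq distrib_left distrib_right)

lemma tilde_le_triple:
  assumes u: "u \<in> V0"
  shows "tilde u u \<le> triple u u"
  using s.nonneg[OF V0_bdd[OF u]] dt_pos by (simp add: triple_eq tilde_eq)

text \<open>Subtracting the multiscale equation for \<open>pr v\<close> from the identity defining
  \<open>ms_form v\<close> leaves \<open>ms_form z w = aO v w\<close>. The data of the remainder are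
  the energy of \<open>v\<close> alone, whence bounds free of the contrast; \<open>w = z\<close> and
  Young's inequality give them.\<close>

lemma s_aux_residual:
  assumes v: "v \<in> V0"
  defines "z \<equiv> v - ms (pr v)"
  shows "z \<in> V0" "aO z z \<le> aO v v" "sO z z \<le> (2 * max 0 C\<^sub>\<pi> + 1) * aO v v"
proof -
  have W: "pr v \<in> W" by (rule pr_mem[OF V0_bdd[OF v]])
  note m = ms_props[OF W]
  show z: "z \<in> V0" unfolding z_def using ms.mem_diff v m(1) by blast
  have "ms_form z z = ms_form v z - ms_form (ms (pr v)) z"
    using ms.diff_left[OF v m(1) z] by (simp add: z_def)
  also have "\<dots> = aO v z" using m(2)[OF z] by (simp add: ms_form_def)
  finally have e: "aO z z + sO (pr z) (pr z) = aO v z" by (simp add: ms_form_def)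
  have y: "2 * aO v z \<le> aO v v + aO z z"
    using a.square_diff_scale[OF V0_Vh[OF v] V0_Vh[OF z], of 1] by simp
  have nn: "0 \<le> sO (pr z) (pr z)" "0 \<le> aO z z"
    using s.nonneg[OF W_bdd[OF pr_mem[OF V0_bdd[OF z]]]] a.nonneg[OF V0_Vh[OF z]] by auto
  show az: "aO z z \<le> aO v v" using e y nn by linarith
  have "2 * sO (pr z) (pr z) \<le> aO v v" using e y nn by linarith
  moreover have "2 * max 0 C\<^sub>\<pi> * aO z z \<le> 2 * max 0 C\<^sub>\<pi> * aO v v" using az by (intro mult_left_mono) auto
  ultimately show "sO z z \<le> (2 * max 0 C\<^sub>\<pi> + 1) * aO v v" using s_le[OF z] by (simp add: distrib_right)
qed

text \<open>Testing the multiscale equation with its own solution and applying Young gives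
  \<open>2 * aO y y + sO (pr y) (pr y) \<le> sO \<psi> \<psi>\<close>; the rest is
  \<open>s_le\<close>.\<close>

lemma ms_bounds:
  assumes \<psi>: "\<psi> \<in> W"
  defines "y \<equiv> ms \<psi>"
  shows "2 * aO y y \<le> sO \<psi> \<psi>" "sO y y \<le> (max 0 C\<^sub>\<pi> + 2) * sO \<psi> \<psi>"
proof -
  have y: "y \<in> V0" unfolding y_def by (rule ms_props(1)[OF \<psi>])
  have P: "pr y \<in> bdd_borel" by (rule W_bdd[OF pr_mem[OF V0_bdd[OF y]]])
  have e: "aO y y + sO (pr y) (pr y) = sO \<psi> (pr y)"
    using ms_props(2)[OF \<psi> y] by (simp add: ms_form_def y_def)
  have q: "2 * sO \<psi> (pr y) \<le> sO \<psi> \<psi> + sO (pr y) (pr y)"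
    using s.square_diff_scale[OF W_bdd[OF \<psi>] P, of 1] by simp
  have nn: "0 \<le> sO (pr y) (pr y)" "0 \<le> aO y y" using s.nonneg[OF P] a.nonneg[OF V0_Vh[OF y]] by auto
  show a: "2 * aO y y \<le> sO \<psi> \<psi>" using e q nn by linarith
  have "sO (pr y) (pr y) \<le> sO \<psi> \<psi>" using e q nn by linarith
  moreover have "max 0 C\<^sub>\<pi> * (2 * aO y y) \<le> max 0 C\<^sub>\<pi> * sO \<psi> \<psi>" using a by (intro mult_left_mono) auto
  ultimately show "sO y y \<le> (max 0 C\<^sub>\<pi> + 2) * sO \<psi> \<psi>" using s_le[OF y] by (simp add: distrib_right)
qed

text \<open>The outer factors 2 come from splitting a square. The first summand collects
  \<open>s_aux_residual\<close>; the second collects \<open>ms_bounds\<close> for the discarded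
  part, times \<open>C\<^sub>t * max 0 \<kappa>bar\<close> from
  \<open>low_component_bound\<close>.\<close>

definition coarse_const :: real where
  "coarse_const = (let c = 1 + 1 / (\<kappa>min * c\<^sub>t); p = max 0 C\<^sub>\<pi> in
     2 * (1 + c * (2 * p + 1)) + 2 * ((1 / 2 + c * (p + 2)) * (C\<^sub>t * max 0 \<kappa>bar)))"

lemma coarse_stability:
  assumes v: "v \<in> V0"
  obtains v0 where "v0 \<in> ms ` fspace.span B1" "v0 \<in> V0"
    "triple (v - v0) (v - v0) \<le> coarse_const * tilde v v"
proof -
  obtain \<psi>1 \<psi>2 where \<psi>: "pr v = \<psi>1 + \<psi>2" "\<psi>1 \<in> fspace.span B1" "\<psi>2 \<in> fspace.span B2"
    using pr_mem[OF V0_bdd[OF v]] unfolding Vaux_def fspace.span_Un by blast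
  have W: "\<psi>1 \<in> W" "\<psi>2 \<in> W" using \<psi> span_B_W by blast+
  define z y where "z = v - ms (pr v)" and "y = ms \<psi>2"
  note zb = s_aux_residual[OF v, folded z_def] and yb = ms_bounds[OF W(2), folded y_def]
  have y: "y \<in> V0" unfolding y_def by (rule ms_props(1)[OF W(2)])
  have m1: "ms \<psi>1 \<in> V0" by (rule ms_props(1)[OF W(1)])
  have split: "v - ms \<psi>1 = z + y" unfolding z_def y_def \<psi>(1) ms_add[OF W] by simp
  define c p where "c = 1 + 1 / (\<kappa>min * c\<^sub>t)" and "p = max 0 C\<^sub>\<pi>"
  have c: "0 \<le> c" using ct kappa_min by (simp add: c_def)
  have p: "0 \<le> p" by (simp add: p_def)
  have nn: "0 \<le> aO v v" "0 \<le> lO v v" "0 \<le> sO \<psi>2 \<psi>2"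
    using a.nonneg[OF V0_Vh[OF v]] l.nonneg[OF V0_bdd[OF v]] s.nonneg[OF W_bdd[OF W(2)]] by auto
  have "triple z z \<le> dt * (aO z z + c * sO z z)" unfolding c_def by (rule triple_le[OF zb(1)])
  also have "\<dots> \<le> dt * (aO v v + c * ((2 * p + 1) * aO v v))"
    using zb(2,3) c dt_pos unfolding p_def by (intro mult_left_mono add_mono) auto
  finally have tz: "triple z z \<le> (1 + c * (2 * p + 1)) * (dt * aO v v)" by (simp add: algebra_simps)
  have "triple y y \<le> dt * (aO y y + c * sO y y)" unfolding c_def by (rule triple_le[OF y])
  also have "\<dots> \<le> dt * (1 / 2 * sO \<psi>2 \<psi>2 + c * ((p + 2) * sO \<psi>2 \<psi>2))"
    using yb c dt_pos unfolding p_def by (intro mult_left_mono add_mono) auto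
  also have "\<dots> = (1 / 2 + c * (p + 2)) * (dt * sO \<psi>2 \<psi>2)" by (simp add: algebra_simps)
  also have "\<dots> \<le> (1 / 2 + c * (p + 2)) * (C\<^sub>t * (max 0 \<kappa>bar * lO v v))"
  proof (rule mult_left_mono)
    have Ct: "0 \<le> C\<^sub>t" using dt_pos dt_upper H by (smt (verit) mult_nonpos_nonneg zero_le_power2)
    have "dt * sO \<psi>2 \<psi>2 \<le> C\<^sub>t * H\<^sup>2 * sO \<psi>2 \<psi>2" using dt_upper nn(3) by (rule mult_right_mono)
    also have "\<dots> = C\<^sub>t * (H\<^sup>2 * sO \<psi>2 \<psi>2)" by simp
    also have "\<dots> \<le> C\<^sub>t * (max 0 \<kappa>bar * lO v v)"
      using low_component_bound[OF V0_bdd[OF v] \<psi>] Ct by (rule mult_left_mono)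
    finally show "dt * sO \<psi>2 \<psi>2 \<le> C\<^sub>t * (max 0 \<kappa>bar * lO v v)" .
  qed (use c p in simp)
  finally have ty: "triple y y \<le> ((1 / 2 + c * (p + 2)) * (C\<^sub>t * max 0 \<kappa>bar)) * lO v v" by (simp add: mult.assoc)
  define k1 k2 where "k1 = 1 + c * (2 * p + 1)" and "k2 = (1 / 2 + c * (p + 2)) * (C\<^sub>t * max 0 \<kappa>bar)"
  define E1 E2 where "E1 = 2 * k1" and "E2 = 2 * k2"
  have Ct: "0 \<le> C\<^sub>t" using dt_pos dt_upper H by (smt (verit) mult_nonpos_nonneg zero_le_power2)
  have E: "0 \<le> E1" "0 \<le> E2" unfolding E1_def E2_def k1_def k2_def using c p Ct by auto
  have "triple (z + y) (z + y) \<le> 2 * triple z z + 2 * triple y y"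
    by (rule r.quadratic_add_le[OF V0_Vh[OF zb(1)] V0_Vh[OF y]])
  also have "\<dots> \<le> E1 * (dt * aO v v) + E2 * lO v v" using tz ty unfolding E1_def E2_def k1_def[symmetric] k2_def[symmetric] by simp
  \<comment> \<open>One bound is in terms of the energy, the other of the mass; the sum of the
    constants serves both, so that \<open>tilde v v\<close> can be factored out.\<close>
  also have "\<dots> \<le> (E1 + E2) * (dt * aO v v) + (E1 + E2) * lO v v"
    using E nn dt_pos by (intro add_mono mult_right_mono) auto
  also have "\<dots> = coarse_const * tilde v v"
    unfolding coarse_const_def Let_def c_def[symmetric] p_def[symmetric] k1_def[symmetric] k2_def[symmetric]
      E1_def[symmetric] E2_def[symmetric] tilde_eq
    by (simp add: distrib_left)
  finally have "triple (v - ms \<psi>1) (v - ms \<psi>1) \<le> coarse_const * tilde v v" unfolding split .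
  then show ?thesis using that m1 \<psi>(2) by blast
qed

section \<open>Finite overlap of the subdomains\<close>

lemma layers_union: "i < N \<Longrightarrow> mesh_union (add_layers \<T> (layers i) (K i))"
  by (rule mesh_union_add_layers[OF K_union])

lemma omega_subset: "i < N \<Longrightarrow> \<omega> i \<subseteq> \<Omega>"
  unfolding subdomain_def by (rule mesh_union_interior_subset[OF layers_union])

text \<open>Vanishing at a single point says nothing about the gradient. Off the skeleton,
  \<open>x\<close> is interior to an element that misses the enlarged set altogether, so
  \<open>u\<close> vanishes on a neighbourhood.\<close>

lemma grad_zero_outside:
  assumes i: "i < N" and u: "\<And>x. x \<in> \<Omega> - \<omega> i \<Longrightarrow> u x = 0" and x: "x \<in> mesh_interior" "x \<notin> \<omega> i"
  shows "grad u x = 0"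
proof -
  obtain T where T: "T \<in> \<T>" "x \<in> interior T" using mesh_interiorE[OF x(1)] by blast
  have "interior T \<inter> add_layers \<T> (layers i) (K i) = {}"
    using mesh_union_cases[OF layers_union[OF i] T(1)] x(2) T(2) unfolding subdomain_def by blast
  then have "u y = inner 0 y + 0" if "y \<in> interior T" for y
    using u[of y] that interior_subset_Omega[OF T(1)] interior_subset unfolding subdomain_def by auto
  then have "GDERIV u x :> 0" by (rule gderiv_open_affine[OF open_interior T(2)])
  then show ?thesis by (rule grad_eq)
qed

lemma card_overlap: "x \<in> \<Omega> \<Longrightarrow> card {i. i < N \<and> x \<in> \<omega> i} \<le> N\<^sub>o\<^sub>v"
  using cover by (simp add: overlapping_cover_def)

lemma grad_sum:
  assumes "\<And>i. i \<in> I \<Longrightarrow> u i \<in> Vh \<T>" "x \<in> mesh_interior"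
  shows "grad (\<Sum>i\<in>I. u i) x = (\<Sum>i\<in>I. grad (u i) x)"
  using assms(1)
proof (induction I rule: infinite_finite_induct)
  case (insert j I)
  have "grad (u j + (\<Sum>i\<in>I. u i)) x = grad (u j) x + grad (\<Sum>i\<in>I. u i) x"
    by (rule grad_add[OF _ a.mem_sum assms(2)]) (use insert.prems in auto)
  moreover have "grad (\<Sum>i\<in>I. u i) x = (\<Sum>i\<in>I. grad (u i) x)" by (rule insert.IH) (use insert.prems in auto)
  ultimately show ?case by (simp only: sum.insert[OF insert.hyps])
qed (use grad_eq[OF GDERIV_const[of 0]] in \<open>simp_all add: zero_fun_def\<close>)

lemma a_overlap:
  assumes u: "\<And>i. i < N \<Longrightarrow> u i \<in> Vloc i"
  shows "aO (\<Sum>i<N. u i) (\<Sum>i<N. u i) \<le> real N\<^sub>o\<^sub>v * (\<Sum>i<N. aO (u i) (u i))"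
proof -
  note O = Omega_lebesgue Omega_subset
  have uV: "u i \<in> Vh \<T>" if "i < N" for i using u[OF that] Vh0_local_subset V0_Vh by blast
  have SV: "(\<Sum>i<N. u i) \<in> Vh \<T>" by (rule a.mem_sum) (use uV in simp)
  have ig: "integrable (lebesgue_on \<Omega>) (\<lambda>x. \<kappa> x * inner (grad v x) (grad v x))" if "v \<in> Vh \<T>" for v
    using integrable_grad_grad[OF O that that one_bdd_borel] by simp
  have "aO (\<Sum>i<N. u i) (\<Sum>i<N. u i)
      \<le> (LINT x|lebesgue_on \<Omega>. real N\<^sub>o\<^sub>v * (\<Sum>i<N. \<kappa> x * inner (grad (u i) x) (grad (u i) x)))"
    unfolding a_form_def
  proof (rule integral_mono_AE[OF ig[OF SV]])
    show "integrable (lebesgue_on \<Omega>) (\<lambda>x. real N\<^sub>o\<^sub>v * (\<Sum>i<N. \<kappa> x * inner (grad (u i) x) (grad (u i) x)))"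
      by (intro integrable_mult_right Bochner_Integration.integrable_sum ig uV) simp
    show "AE x in lebesgue_on \<Omega>. \<kappa> x * inner (grad (\<Sum>i<N. u i) x) (grad (\<Sum>i<N. u i) x)
        \<le> real N\<^sub>o\<^sub>v * (\<Sum>i<N. \<kappa> x * inner (grad (u i) x) (grad (u i) x))"
      using AE_kappa[OF O]
    proof eventually_elim
      case (elim x)
      have x: "x \<in> \<Omega>" using elim mesh_interior_subset by blast
      have "(norm (\<Sum>i<N. grad (u i) x))\<^sup>2 \<le> real N\<^sub>o\<^sub>v * (\<Sum>i<N. (norm (grad (u i) x))\<^sup>2)"
      proof (rule norm_sum_square_le[OF card_overlap[OF x]])
        fix i assume i: "i < N" "x \<notin> \<omega> i"
        show "grad (u i) x = 0"
          by (rule grad_zero_outside[OF i(1) _ _ i(2)]) (use u[OF i(1)] elim in \<open>auto simp: Vh0_local_def\<close>)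
      qed
      then have "inner (grad (\<Sum>i<N. u i) x) (grad (\<Sum>i<N. u i) x)
          \<le> real N\<^sub>o\<^sub>v * (\<Sum>i<N. inner (grad (u i) x) (grad (u i) x))"
        using grad_sum[of "{..<N}" u x] uV elim by (simp add: power2_norm_eq_inner)
      then have "\<kappa> x * inner (grad (\<Sum>i<N. u i) x) (grad (\<Sum>i<N. u i) x)
          \<le> \<kappa> x * (real N\<^sub>o\<^sub>v * (\<Sum>i<N. inner (grad (u i) x) (grad (u i) x)))"
        using elim kappa_min by (intro mult_left_mono) auto
      then show ?case by (simp add: sum_distrib_left mult.left_commute)
    qed
  qed
  also have "\<dots> = real N\<^sub>o\<^sub>v * (\<Sum>i<N. aO (u i) (u i))"
    unfolding a_form_def integral_mult_right_zero
    by (subst Bochner_Integration.integral_sum) (use ig uV in auto)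
  finally show ?thesis .
qed

lemma integrable_bdd: "h \<in> bdd_borel \<Longrightarrow> integrable (lebesgue_on \<Omega>) h"
proof -
  assume "h \<in> bdd_borel"
  then obtain B where "\<And>x. \<bar>h x\<bar> \<le> B" "h \<in> borel_measurable borel" using bdd_borelE by blast
  then show ?thesis
    by (intro integrable_lebesgue_on_bounded[OF Omega_lebesgue Omega_subset, of _ B]) (auto intro: borel_lebesgue)
qed

lemma L2_overlap:
  assumes u: "\<And>i. i < N \<Longrightarrow> u i \<in> Vloc i"
  shows "lO (\<Sum>i<N. u i) (\<Sum>i<N. u i) \<le> real N\<^sub>o\<^sub>v * (\<Sum>i<N. lO (u i) (u i))"
proof -
  note O = Omega_lebesgue Omega_subset
  have uV: "u i \<in> bdd_borel" if "i < N" for i using u[OF that] Vh0_local_subset V0_bdd by blast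
  have SV: "(\<Sum>i<N. u i) \<in> bdd_borel" by (rule l.mem_sum) (use uV in simp)
  have "lO (\<Sum>i<N. u i) (\<Sum>i<N. u i) \<le> (LINT x|lebesgue_on \<Omega>. real N\<^sub>o\<^sub>v * (\<Sum>i<N. u i x * u i x))"
    unfolding L2_form_def
  proof (rule integral_mono_AE[OF integrable_bdd[OF bdd_borel_mult[OF SV SV]]])
    show "integrable (lebesgue_on \<Omega>) (\<lambda>x. real N\<^sub>o\<^sub>v * (\<Sum>i<N. u i x * u i x))"
      by (intro integrable_mult_right Bochner_Integration.integrable_sum integrable_bdd bdd_borel_mult uV) auto
    show "AE x in lebesgue_on \<Omega>. (\<Sum>i<N. u i) x * (\<Sum>i<N. u i) x \<le> real N\<^sub>o\<^sub>v * (\<Sum>i<N. u i x * u i x)"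
      using AE_mesh_interior[OF O]
    proof eventually_elim
      case (elim x)
      then have x: "x \<in> \<Omega>" using mesh_interior_subset by blast
      have "(norm (\<Sum>i<N. u i x))\<^sup>2 \<le> real N\<^sub>o\<^sub>v * (\<Sum>i<N. (norm (u i x))\<^sup>2)"
        by (rule norm_sum_square_le[OF card_overlap[OF x]]) (use u in \<open>auto simp: Vh0_local_def\<close>)
      then show ?case by (simp add: sum_apply power2_eq_square)
    qed
  qed
  also have "\<dots> = real N\<^sub>o\<^sub>v * (\<Sum>i<N. lO (u i) (u i))"
    unfolding L2_form_def integral_mult_right_zero
    by (subst Bochner_Integration.integral_sum) (use integrable_bdd bdd_borel_mult uV in auto)
  finally show ?thesis .
qed

text \<open>The factor 2 separates coarse and local parts; \<open>max 1\<close> lets one constant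
  cover both.\<close>

lemma overlap_bound:
  assumes u0: "u0 \<in> V0" and u: "\<And>i. i < N \<Longrightarrow> u i \<in> Vloc i"
  shows "tilde (u0 + (\<Sum>i<N. u i)) (u0 + (\<Sum>i<N. u i))
    \<le> 2 * max 1 (real N\<^sub>o\<^sub>v) * (tilde u0 u0 + (\<Sum>i<N. tilde (u i) (u i)))"
proof -
  let ?S = "\<Sum>i<N. u i" and ?m = "max 1 (real N\<^sub>o\<^sub>v)"
  have uV: "u i \<in> V0" if "i < N" for i using u[OF that] Vh0_local_subset by blast
  have S: "?S \<in> V0" by (rule t.mem_sum) (use uV in simp)
  have nn: "0 \<le> tilde u0 u0" "0 \<le> (\<Sum>i<N. tilde (u i) (u i))"
    using t.nonneg u0 uV by (auto intro: sum_nonneg)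
  have "dt * aO ?S ?S \<le> dt * (real N\<^sub>o\<^sub>v * (\<Sum>i<N. aO (u i) (u i)))"
    using a_overlap[of u] u dt_pos by (intro mult_left_mono) auto
  moreover have "lO ?S ?S \<le> real N\<^sub>o\<^sub>v * (\<Sum>i<N. lO (u i) (u i))" using L2_overlap u by blast
  moreover have "(\<Sum>i<N. tilde (u i) (u i)) = dt * (\<Sum>i<N. aO (u i) (u i)) + (\<Sum>i<N. lO (u i) (u i))"
    by (simp add: tilde_eq sum.distrib sum_distrib_left)
  ultimately have "tilde ?S ?S \<le> real N\<^sub>o\<^sub>v * (\<Sum>i<N. tilde (u i) (u i))"
    by (simp add: tilde_eq distrib_left mult.left_commute)
  also have "\<dots> \<le> ?m * (\<Sum>i<N. tilde (u i) (u i))" using nn by (intro mult_right_mono) auto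
  finally have tS: "tilde ?S ?S \<le> ?m * (\<Sum>i<N. tilde (u i) (u i))" .
  have t0: "tilde u0 u0 \<le> ?m * tilde u0 u0" using mult_right_mono[of 1 ?m, OF _ nn(1)] by simp
  have "tilde (u0 + ?S) (u0 + ?S) \<le> 2 * tilde u0 u0 + 2 * tilde ?S ?S" by (rule t.quadratic_add_le[OF u0 S])
  also have "\<dots> \<le> 2 * (?m * tilde u0 u0) + 2 * (?m * (\<Sum>i<N. tilde (u i) (u i)))"
    using t0 tS by (intro add_mono mult_left_mono) auto
  finally show ?thesis by (simp only: distrib_left mult.assoc)
qed

section \<open>Localization by the partition of unity\<close>

lemma theta_Vh: "i < N \<Longrightarrow> \<theta> i \<in> Vh \<T>" using pou by (simp add: partition_of_unity_def)

lemma theta_zero: "i < N \<Longrightarrow> x \<in> \<Omega> \<Longrightarrow> x \<notin> \<omega> i \<Longrightarrow> \<theta> i x = 0"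
  using pou by (simp add: partition_of_unity_def)

lemma theta_sum: "x \<in> \<Omega> \<Longrightarrow> (\<Sum>i<N. \<theta> i x) = 1" "x \<in> \<Omega> \<Longrightarrow> (\<Sum>i<N. (\<theta> i x)\<^sup>2) \<le> 1"
  using pou by (simp_all add: partition_of_unity_def)

lemma theta_grad: "AE x in lebesgue_on \<Omega>. \<forall>i\<in>{..<N}. norm (grad (\<theta> i) x) \<le> C\<^sub>\<theta> / H"
  using pou by (intro AE_finite_allI) (auto simp: partition_of_unity_def)

abbreviation "cutoff w i \<equiv> \<lambda>x. \<theta> i x * w x"

definition loc :: "('a \<Rightarrow> real) \<Rightarrow> nat \<Rightarrow> 'a \<Rightarrow> real" where
  "loc w i = nodal_interp \<T> (cutoff w i)"

text \<open>At a vertex outside \<open>\<omega> i\<close> either \<open>\<theta> i\<close> or, off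
  \<open>\<Omega>\<close>, \<open>w\<close> vanishes. \<open>Vh_zero_outside\<close> carries this
  from vertices to all points.\<close>

lemma loc_mem:
  assumes w: "w \<in> V0" and i: "i < N"
  shows "loc w i \<in> Vloc i"
proof -
  have V: "loc w i \<in> Vh \<T>" unfolding loc_def by (rule nodal_interp)
  have zero: "loc w i p = 0" if "p \<in> vertices \<T>" "p \<notin> \<omega> i" for p
  proof -
    have "loc w i p = \<theta> i p * w p" unfolding loc_def by (rule nodal_interp(2)[OF that(1)])
    then show ?thesis using theta_zero[OF i _ that(2)] Vh0_zero[OF w, of p] by (cases "p \<in> \<Omega>") auto
  qed
  have out: "loc w i x = 0" if "x \<notin> \<omega> i" for x
    by (rule Vh_zero_outside[OF V layers_union[OF i], folded subdomain_def, OF zero that])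
  then have "\<forall>x\<in>frontier \<Omega>. loc w i x = 0" using omega_subset[OF i] frontier_Omega by blast
  then show ?thesis using V out by (simp add: Vh0_local_def Vh0_def)
qed

text \<open>Nodal values decide. Boundary vertices, where the weights are not assumed to add up to
  1, are covered by \<open>w = 0\<close>.\<close>

lemma loc_sum:
  assumes w: "w \<in> V0"
  shows "(\<Sum>i<N. loc w i) = w"
proof (rule Vh_eqI)
  show "(\<Sum>i<N. loc w i) \<in> Vh \<T>" by (rule a.mem_sum) (simp add: loc_def nodal_interp)
  show "w \<in> Vh \<T>" by (rule V0_Vh[OF w])
  fix p assume p: "p \<in> vertices \<T>"
  have "(\<Sum>i<N. loc w i) p = (\<Sum>i<N. \<theta> i p) * w p"
    unfolding sum_apply loc_def sum_distrib_right by (simp add: nodal_interp(2)[OF p])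
  then show "(\<Sum>i<N. loc w i) p = w p"
    using theta_sum(1)[of p] Vh0_zero[OF w, of p] by (cases "p \<in> \<Omega>") auto
qed

lemma piecewise_quadratic_mult:
  assumes u: "u \<in> Vh \<T>" and v: "v \<in> Vh \<T>"
  shows "piecewise_quadratic \<T> (\<lambda>x. u x * v x)"
  unfolding piecewise_quadratic_def
proof (intro conjI ballI)
  show "continuous_on (\<Union>\<T>) (\<lambda>x. u x * v x)"
    using u v by (auto simp: Vh_def intro!: continuous_on_mult)
  fix T assume T: "T \<in> \<T>"
  obtain b c where bc: "\<And>x. x \<in> T \<Longrightarrow> u x = inner b x + c" using Vh_affine[OF u T] by blast
  obtain b' c' where bc': "\<And>x. x \<in> T \<Longrightarrow> v x = inner b' x + c'" using Vh_affine[OF v T] by blast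
  have lin: "linear (\<lambda>x. inner b x *\<^sub>R b')"
    by (rule linearI) (auto simp: inner_add_right scaleR_add_left)
  have "\<forall>x\<in>T. u x * v x = inner (inner b x *\<^sub>R b') x + inner (c' *\<^sub>R b + c *\<^sub>R b') x + c * c'"
    by (simp add: bc bc' inner_add_left algebra_simps)
  then show "\<exists>Q b c. linear Q \<and> (\<forall>x\<in>T. u x * v x = inner (Q x) x + inner b x + c)"
    using lin by blast
qed

text \<open>Stated for arbitrary \<open>v\<close> because a cutoff is piecewise quadratic and falls
  outside \<open>Vh\<close>, the carrier of the semidefinite form.\<close>

lemma a_form_nonneg: "0 \<le> aO v v"
  unfolding a_form_def
proof (rule integral_nonneg_AE)
  show "AE x in lebesgue_on \<Omega>. 0 \<le> \<kappa> x * inner (grad v x) (grad v x)"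
    using AE_kappa[OF Omega_lebesgue Omega_subset] by eventually_elim (use kappa_min in simp)
qed

lemma s_form_nonneg: "0 \<le> sO v v"
proof -
  have "AE x in lebesgue_on \<Omega>. 0 \<le> \<kappa> x * v x * v x"
    using AE_kappa[OF Omega_lebesgue Omega_subset]
    by eventually_elim (use kappa_min in \<open>simp add: mult.assoc\<close>)
  then show ?thesis unfolding s_form_def by (simp add: integral_nonneg_AE)
qed

lemma loc_bounds:
  assumes w: "w \<in> V0" and i: "i < N"
  shows "aO (loc w i) (loc w i) \<le> C\<^sub>I\<^sup>2 * aO (cutoff w i) (cutoff w i)"
    "sO (loc w i) (loc w i) \<le> C\<^sub>I\<^sup>2 * sO (cutoff w i) (cutoff w i)"
proof -
  have "piecewise_quadratic \<T> (cutoff w i)"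
    by (rule piecewise_quadratic_mult[OF theta_Vh[OF i] V0_Vh[OF w]])
  then have "sqrt (aO (loc w i) (loc w i)) \<le> C\<^sub>I * sqrt (aO (cutoff w i) (cutoff w i))"
    "sqrt (sO (loc w i) (loc w i)) \<le> C\<^sub>I * sqrt (sO (cutoff w i) (cutoff w i))"
    using interp unfolding interp_stable_def form_norm_def loc_def by blast+
  then show "aO (loc w i) (loc w i) \<le> C\<^sub>I\<^sup>2 * aO (cutoff w i) (cutoff w i)"
    "sO (loc w i) (loc w i) \<le> C\<^sub>I\<^sup>2 * sO (cutoff w i) (cutoff w i)"
    by (auto intro: sqrt_le_imp_le a_form_nonneg s_form_nonneg)
qed

lemma s_theta_sum:
  assumes w: "w \<in> V0"
  shows "(\<Sum>i<N. sO (cutoff w i) (cutoff w i)) \<le> sO w w"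
proof -
  note O = Omega_lebesgue Omega_subset
  have wb: "w \<in> bdd_borel" by (rule V0_bdd[OF w])
  have tb: "(cutoff w i) \<in> bdd_borel" if "i < N" for i
    by (rule bdd_borel_mult[OF Vh_bdd_borel[OF theta_Vh[OF that]] wb])
  have ii: "integrable (lebesgue_on \<Omega>) (\<lambda>x. \<kappa> x * ((\<theta> i x * w x) * (\<theta> i x * w x)))" if "i < N" for i
    by (rule integrable_weighted_bdd[OF O bdd_borel_mult[OF tb[OF that] tb[OF that]]])
  have "(\<Sum>i<N. LINT x|lebesgue_on \<Omega>. \<kappa> x * ((\<theta> i x * w x) * (\<theta> i x * w x)))
      = (LINT x|lebesgue_on \<Omega>. (\<Sum>i<N. \<kappa> x * ((\<theta> i x * w x) * (\<theta> i x * w x))))"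
    by (rule Bochner_Integration.integral_sum[symmetric]) (use ii in simp)
  also have "\<dots> \<le> (LINT x|lebesgue_on \<Omega>. \<kappa> x * (w x * w x))"
  proof (rule integral_mono_AE)
    show "integrable (lebesgue_on \<Omega>) (\<lambda>x. \<Sum>i<N. \<kappa> x * ((\<theta> i x * w x) * (\<theta> i x * w x)))"
      by (rule Bochner_Integration.integrable_sum) (use ii in simp)
    show "integrable (lebesgue_on \<Omega>) (\<lambda>x. \<kappa> x * (w x * w x))"
      by (rule integrable_weighted_bdd[OF O bdd_borel_mult[OF wb wb]])
    show "AE x in lebesgue_on \<Omega>. (\<Sum>i<N. \<kappa> x * ((\<theta> i x * w x) * (\<theta> i x * w x))) \<le> \<kappa> x * (w x * w x)"
      using AE_kappa[OF O]
    proof eventually_elim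
      case (elim x)
      then have x: "x \<in> \<Omega>" using mesh_interior_subset by blast
      have "(\<Sum>i<N. \<kappa> x * ((\<theta> i x * w x) * (\<theta> i x * w x))) = (\<Sum>i<N. (\<theta> i x)\<^sup>2) * (\<kappa> x * (w x * w x))"
        unfolding sum_distrib_right by (intro sum.cong) (auto simp: power2_eq_square)
      also have "\<dots> \<le> 1 * (\<kappa> x * (w x * w x))"
        using theta_sum(2)[OF x] elim kappa_min by (intro mult_right_mono) auto
      finally show ?case by simp
    qed
  qed
  finally have "(\<Sum>i<N. LINT x|lebesgue_on \<Omega>. \<kappa> x * ((\<theta> i x * w x) * (\<theta> i x * w x))) / H\<^sup>2
      \<le> (LINT x|lebesgue_on \<Omega>. \<kappa> x * (w x * w x)) / H\<^sup>2" by (rule divide_right_mono) simp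
  then show ?thesis by (simp add: s_form_def mult.assoc sum_divide_distrib)
qed

text \<open>In the product rule the gradient of \<open>\<theta> i\<close> costs
  \<open>C\<^sub>\<theta> / H\<close>, and \<open>H\<close> to the power -2 times the weighted mass
  is \<open>s\<close>. This is why the coarse error must be measured in the triple norm.\<close>

lemma a_theta_sum:
  assumes w: "w \<in> V0"
  shows "(\<Sum>i<N. aO (cutoff w i) (cutoff w i)) \<le> 2 * aO w w + 2 * C\<^sub>\<theta>\<^sup>2 * real N\<^sub>o\<^sub>v * sO w w"
proof -
  note O = Omega_lebesgue Omega_subset
  have wV: "w \<in> Vh \<T>" and wb: "w \<in> bdd_borel" using V0_Vh V0_bdd w by auto
  define C where "C = (C\<^sub>\<theta> / H)\<^sup>2"
  \<comment> \<open>Keeping the indicator makes the sum over \<open>i\<close> count the overlap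
    instead of all \<open>N\<close> subdomains.\<close>
  define ind where "ind i x = indicat_real (\<omega> i) x * (w x * w x)" for i x
  define g where "g i x = 2 * (\<kappa> x * ((\<theta> i x * \<theta> i x) * inner (grad w x) (grad w x))) + 2 * C * (\<kappa> x * ind i x)" for i x
  have ob: "\<omega> i \<in> sets borel" for i unfolding subdomain_def by simp
  have indb: "ind i \<in> bdd_borel" for i
    unfolding ind_def[abs_def] by (rule bdd_borel_mult[OF indicat_bdd_borel[OF ob] bdd_borel_mult[OF wb wb]])
  have gi: "integrable (lebesgue_on \<Omega>) (g i)" if "i < N" for i
    unfolding g_def[abs_def]
    by (intro Bochner_Integration.integrable_add integrable_mult_right
        integrable_grad_grad[OF O wV wV] integrable_weighted_bdd[OF O indb]
        bdd_borel_mult[OF Vh_bdd_borel[OF theta_Vh[OF that]] Vh_bdd_borel[OF theta_Vh[OF that]]])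
  have "aO (cutoff w i) (cutoff w i) \<le> (LINT x|lebesgue_on \<Omega>. g i x)" if i: "i < N" for i
    unfolding a_form_def
  \<comment> \<open>This form of monotonicity asks for integrability of the majorant only, which
    spares the cutoff's gradient.\<close>
  proof (rule integral_mono_AE'[OF gi[OF i]])
    show "AE x in lebesgue_on \<Omega>. \<kappa> x * inner (grad (cutoff w i) x) (grad (cutoff w i) x) \<le> g i x"
      using AE_kappa[OF O] theta_grad
    proof eventually_elim
      case (elim x)
      then have x: "x \<in> mesh_interior" "x \<in> \<Omega>" using mesh_interior_subset by auto
      let ?a = "\<theta> i x *\<^sub>R grad w x" and ?c = "w x *\<^sub>R grad (\<theta> i) x"
      have "grad (cutoff w i) x = ?a + ?c"
        by (rule grad_eq[OF GDERIV_mult[OF gderiv_grad[OF theta_Vh[OF i] x(1)] gderiv_grad[OF wV x(1)]]])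
      then have "inner (grad (cutoff w i) x) (grad (cutoff w i) x) \<le> 2 * inner ?a ?a + 2 * inner ?c ?c"
        using norm_add_square_le[of ?a ?c] by simp
      also have "inner ?c ?c = (w x * w x) * (norm (grad (\<theta> i) x))\<^sup>2"
        by (simp add: power2_norm_eq_inner mult_ac)
      also have "\<dots> \<le> C * ind i x"
      proof (cases "x \<in> \<omega> i")
        case True
        have "norm (grad (\<theta> i) x) \<le> C\<^sub>\<theta> / H" using elim i by auto
        then have "(norm (grad (\<theta> i) x))\<^sup>2 \<le> C" unfolding C_def by (rule power_mono) simp
        then have "(w x * w x) * (norm (grad (\<theta> i) x))\<^sup>2 \<le> (w x * w x) * C" by (rule mult_left_mono) simp
        then show ?thesis using True by (simp add: ind_def mult.commute)
      next
        case False
        have "grad (\<theta> i) x = 0"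
          by (rule grad_zero_outside[OF i _ x(1) False]) (use theta_zero[OF i] in auto)
        then show ?thesis using False by (simp add: ind_def)
      qed
      finally have "inner (grad (cutoff w i) x) (grad (cutoff w i) x)
          \<le> 2 * ((\<theta> i x * \<theta> i x) * inner (grad w x) (grad w x)) + 2 * (C * ind i x)" by (simp add: mult_ac)
      then have "\<kappa> x * inner (grad (cutoff w i) x) (grad (cutoff w i) x)
          \<le> \<kappa> x * (2 * ((\<theta> i x * \<theta> i x) * inner (grad w x) (grad w x)) + 2 * (C * ind i x))"
        using elim kappa_min by (intro mult_left_mono) auto
      also have "\<dots> = g i x" unfolding g_def by (simp add: distrib_left mult_ac)
      finally show ?case .
    qed
    show "AE x in lebesgue_on \<Omega>. 0 \<le> g i x"
      using AE_kappa[OF O]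
      by eventually_elim (use kappa_min in \<open>auto simp: g_def ind_def C_def intro!: add_nonneg_nonneg mult_nonneg_nonneg\<close>)
  qed
  then have "(\<Sum>i<N. aO (cutoff w i) (cutoff w i)) \<le> (\<Sum>i<N. LINT x|lebesgue_on \<Omega>. g i x)"
    by (intro sum_mono) simp
  also have "\<dots> = (LINT x|lebesgue_on \<Omega>. (\<Sum>i<N. g i x))"
    by (rule Bochner_Integration.integral_sum[symmetric]) (use gi in simp)
  also have "\<dots> \<le> (LINT x|lebesgue_on \<Omega>. 2 * (\<kappa> x * inner (grad w x) (grad w x)) + (2 * C * real N\<^sub>o\<^sub>v) * (\<kappa> x * (w x * w x)))"
  proof (rule integral_mono_AE)
    show "integrable (lebesgue_on \<Omega>) (\<lambda>x. \<Sum>i<N. g i x)"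
      by (rule Bochner_Integration.integrable_sum) (use gi in simp)
    show "integrable (lebesgue_on \<Omega>) (\<lambda>x. 2 * (\<kappa> x * inner (grad w x) (grad w x)) + (2 * C * real N\<^sub>o\<^sub>v) * (\<kappa> x * (w x * w x)))"
      using integrable_grad_grad[OF O wV wV one_bdd_borel] integrable_weighted_bdd[OF O bdd_borel_mult[OF wb wb]] by simp
    show "AE x in lebesgue_on \<Omega>. (\<Sum>i<N. g i x)
        \<le> 2 * (\<kappa> x * inner (grad w x) (grad w x)) + (2 * C * real N\<^sub>o\<^sub>v) * (\<kappa> x * (w x * w x))"
      using AE_kappa[OF O]
    proof eventually_elim
      case (elim x)
      then have x: "x \<in> \<Omega>" using mesh_interior_subset by blast
      let ?G = "\<kappa> x * inner (grad w x) (grad w x)" and ?S = "\<kappa> x * (w x * w x)"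
      have k: "0 \<le> \<kappa> x" using elim kappa_min by simp
      have "(\<Sum>i<N. indicat_real (\<omega> i) x) = real (card {i. i < N \<and> x \<in> \<omega> i})"
      proof -
        have "(\<Sum>i<N. indicat_real (\<omega> i) x) = (\<Sum>i\<in>{i. i < N \<and> x \<in> \<omega> i}. 1)"
          by (rule sum.mono_neutral_cong_right) (auto simp: indicator_def)
        then show ?thesis by simp
      qed
      then have n: "(\<Sum>i<N. indicat_real (\<omega> i) x) \<le> real N\<^sub>o\<^sub>v" using card_overlap[OF x] by simp
      have "(\<Sum>i<N. g i x) = (\<Sum>i<N. (\<theta> i x)\<^sup>2 * (2 * ?G) + indicat_real (\<omega> i) x * (2 * C * ?S))"
        by (intro sum.cong) (auto simp: g_def ind_def power2_eq_square)
      also have "\<dots> = (\<Sum>i<N. (\<theta> i x)\<^sup>2) * (2 * ?G) + (\<Sum>i<N. indicat_real (\<omega> i) x) * (2 * C * ?S)"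
        by (simp only: sum.distrib sum_distrib_right)
      also have "\<dots> \<le> 1 * (2 * ?G) + real N\<^sub>o\<^sub>v * (2 * C * ?S)"
        using theta_sum(2)[OF x] n k by (intro add_mono mult_right_mono) (auto simp: C_def)
      finally show ?case by (simp add: mult_ac)
    qed
  qed
  also have "\<dots> = 2 * aO w w + (2 * C * real N\<^sub>o\<^sub>v) * (LINT x|lebesgue_on \<Omega>. \<kappa> x * (w x * w x))"
    using integrable_grad_grad[OF O wV wV one_bdd_borel] integrable_weighted_bdd[OF O bdd_borel_mult[OF wb wb]]
    by (simp add: a_form_def)
  also have "\<dots> = 2 * aO w w + 2 * C\<^sub>\<theta>\<^sup>2 * real N\<^sub>o\<^sub>v * sO w w"
    using H by (simp add: s_form_def C_def power_divide mult_ac)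
  finally show ?thesis .
qed

text \<open>\<open>C\<^sub>I\<^sup>2\<close> is the price of interpolation, the next two terms come
  from \<open>a_theta_sum\<close>, and the last one from bounding mass by \<open>s\<close>.\<close>

definition local_const :: real where
  "local_const = C\<^sub>I\<^sup>2 * (2 + 2 * C\<^sub>\<theta>\<^sup>2 * real N\<^sub>o\<^sub>v + 1 / (\<kappa>min * c\<^sub>t))"

lemma local_const_nonneg: "0 \<le> local_const"
  unfolding local_const_def using ct kappa_min by simp

text \<open>The interpolant is stable in the \<open>a\<close> and \<open>s\<close> norms, so its
  mass is first traded for \<open>s\<close> by \<open>L2_bound\<close>.\<close>

lemma local_stability:
  assumes w: "w \<in> V0"
  shows "(\<Sum>i<N. tilde (loc w i) (loc w i)) \<le> local_const * triple w w"
proof -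
  define k m where "k = 1 / (\<kappa>min * c\<^sub>t)" and "m = 2 * C\<^sub>\<theta>\<^sup>2 * real N\<^sub>o\<^sub>v"
  have k: "0 \<le> k" "0 \<le> m" using ct kappa_min by (simp_all add: k_def m_def)
  let ?f = "cutoff w"
  have "tilde (loc w i) (loc w i) \<le> dt * (C\<^sub>I\<^sup>2 * (aO (?f i) (?f i) + k * sO (?f i) (?f i)))" if i: "i < N" for i
  proof -
    have b: "loc w i \<in> bdd_borel" using loc_mem[OF w i] Vh0_local_subset V0_bdd by blast
    have "tilde (loc w i) (loc w i) \<le> dt * (aO (loc w i) (loc w i) + k * sO (loc w i) (loc w i))"
      using L2_bound[OF b] by (simp add: tilde_eq k_def distrib_left)
    also have "\<dots> \<le> dt * (C\<^sub>I\<^sup>2 * aO (?f i) (?f i) + k * (C\<^sub>I\<^sup>2 * sO (?f i) (?f i)))"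
      using loc_bounds[OF w i] k dt_pos by (intro mult_left_mono add_mono) auto
    finally show ?thesis by (simp only: distrib_left mult.left_commute)
  qed
  then have "(\<Sum>i<N. tilde (loc w i) (loc w i))
      \<le> (\<Sum>i<N. dt * (C\<^sub>I\<^sup>2 * (aO (?f i) (?f i) + k * sO (?f i) (?f i))))" by (intro sum_mono) simp
  also have "\<dots> = dt * (C\<^sub>I\<^sup>2 * ((\<Sum>i<N. aO (?f i) (?f i)) + k * (\<Sum>i<N. sO (?f i) (?f i))))"
    by (simp only: sum_distrib_left sum.distrib distrib_left)
  also have "\<dots> \<le> dt * (C\<^sub>I\<^sup>2 * ((2 * aO w w + m * sO w w) + k * sO w w))"
    using a_theta_sum[OF w] s_theta_sum[OF w] k dt_pos unfolding m_def
    by (intro mult_left_mono add_mono) auto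
  also have "\<dots> \<le> dt * (C\<^sub>I\<^sup>2 * ((2 + m + k) * (aO w w + sO w w)))"
  proof -
    have "0 \<le> (m + k) * aO w w + 2 * sO w w" using k a_form_nonneg[of w] s_form_nonneg[of w] by simp
    then have "(2 * aO w w + m * sO w w) + k * sO w w \<le> (2 + m + k) * (aO w w + sO w w)"
      by (simp add: algebra_simps)
    then show ?thesis using dt_pos by (intro mult_left_mono) auto
  qed
  also have "\<dots> = local_const * (dt * (aO w w + sO w w))"
    unfolding local_const_def k_def[symmetric] m_def[symmetric] by (simp add: mult_ac)
  also have "\<dots> \<le> local_const * triple w w"
    using l.nonneg[OF V0_bdd[OF w]] local_const_nonneg
    by (intro mult_left_mono) (auto simp: triple_eq distrib_left)
  finally show ?thesis .
qed

text \<open>\<open>M\<close> bounds the triple norm of \<open>w = v - p\<close> relative to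
  \<open>v\<close>: the coarse error contributes \<open>e\<close>, the perturbation
  \<open>1 + e\<close>, with \<open>e = sqrt coarse_const\<close>. Then
  \<open>2 + 2 * M\<^sup>2\<close> bounds the coarse part \<open>p\<close>, and
  \<open>local_const * M\<^sup>2\<close> the local parts.\<close>

definition lower_const :: real where
  "lower_const = (let M = 1 + 2 * sqrt coarse_const in 2 + 2 * M\<^sup>2 + local_const * M\<^sup>2)"

lemma lower_const_pos: "0 < lower_const"
  unfolding lower_const_def Let_def using local_const_nonneg
  by (intro add_pos_nonneg) auto

lemma stable_decomposition:
  assumes Bh: "finite Bh" "Bh \<subseteq> V0" and \<epsilon>: "0 \<le> \<epsilon>" "\<epsilon> \<le> 1"
    and Tm: "\<And>v. v \<in> ms ` fspace.span B1 \<Longrightarrow>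
      form_norm triple (v - orth_proj triple (fspace.span Bh) v) \<le> \<epsilon> * form_norm tilde v"
    and v: "v \<in> V0"
  shows "\<exists>u0 u. u0 \<in> fspace.span Bh \<and> (\<forall>i<N. u i \<in> Vloc i) \<and> v = u0 + (\<Sum>i<N. u i) \<and>
    tilde u0 u0 + (\<Sum>i<N. tilde (u i) (u i)) \<le> lower_const * tilde v v"
proof -
  let ?n = "form_norm tilde" and ?r = "form_norm triple"
  obtain v0 where v0: "v0 \<in> ms ` fspace.span B1" "v0 \<in> V0"
    "triple (v - v0) (v - v0) \<le> coarse_const * tilde v v" using coarse_stability[OF v] by blast
  define p w where "p = orth_proj triple (fspace.span Bh) v0" and "w = v - p"
  have BhV: "Bh \<subseteq> Vh \<T>" using Bh(2) V0_Vh by blast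
  have pS: "p \<in> fspace.span Bh" unfolding p_def by (rule r.orth_proj_span(1)[OF Bh(1) BhV V0_Vh[OF v0(2)]])
  have p: "p \<in> V0" by (rule t.mem_span[OF Bh(2) pS])
  have w: "w \<in> V0" unfolding w_def by (rule t.mem_diff[OF v p])
  have d: "v - v0 \<in> V0" "v0 - v \<in> V0" "v0 - p \<in> V0" using t.mem_diff v v0(2) p by auto
  have nr: "?n u \<le> ?r u" if "u \<in> V0" for u
    unfolding form_norm_def using tilde_le_triple[OF that] by simp
  have nv: "0 \<le> ?n v" by (rule t.form_norm_nonneg[OF v])
  define e where "e = sqrt coarse_const"
  have r1: "?r (v - v0) \<le> e * ?n v"
    unfolding form_norm_def e_def using v0(3) by (simp flip: real_sqrt_mult)
  have "?n v0 \<le> ?n v + ?n (v0 - v)" using t.form_norm_triangle[OF v d(2)] by simp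
  also have "?n (v0 - v) \<le> ?r (v - v0)" using nr[OF d(1)] t.form_norm_diff_commute[OF v v0(2)] by simp
  finally have n0: "?n v0 \<le> ?n v + e * ?n v" using r1 by simp
  \<comment> \<open>The perturbation is relative to \<open>v0\<close>, not to \<open>v\<close>; the
    bound \<open>n0\<close> converts it.\<close>
  have "?r (v0 - p) \<le> \<epsilon> * ?n v0" unfolding p_def by (rule Tm[OF v0(1)])
  also have "\<dots> \<le> 1 * ?n v0" using \<epsilon> t.form_norm_nonneg[OF v0(2)] by (intro mult_right_mono) auto
  finally have r2: "?r (v0 - p) \<le> ?n v + e * ?n v" using n0 by simp
  have "w = (v - v0) + (v0 - p)" by (simp add: w_def)
  then have "?r w \<le> ?r (v - v0) + ?r (v0 - p)"
    using r.form_norm_triangle[OF V0_Vh[OF d(1)] V0_Vh[OF d(3)]] by simp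
  then have rw: "?r w \<le> (1 + 2 * e) * ?n v" using r1 r2 by (simp add: algebra_simps)
  define M where "M = 1 + 2 * e"
  have "triple w w = (?r w)\<^sup>2" by (rule r.form_norm_square[OF V0_Vh[OF w], symmetric])
  also have "\<dots> \<le> (M * ?n v)\<^sup>2"
    using rw r.form_norm_nonneg[OF V0_Vh[OF w]] unfolding M_def by (rule power_mono)
  also have "\<dots> = M\<^sup>2 * tilde v v" by (simp add: power_mult_distrib t.form_norm_square[OF v])
  finally have tw: "triple w w \<le> M\<^sup>2 * tilde v v" .
  have mw: "p - v \<in> V0" by (rule t.mem_diff[OF p v])
  have "tilde (p - v) (p - v) = tilde w w"
    using p v unfolding w_def by (simp add: t.diff_left t.diff_right t.mem_diff t.sym[of p v])
  moreover have "tilde p p \<le> 2 * tilde v v + 2 * tilde (p - v) (p - v)"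
    using t.quadratic_add_le[OF v mw] by simp
  ultimately have tp: "tilde p p \<le> 2 * tilde v v + 2 * (M\<^sup>2 * tilde v v)"
    using tilde_le_triple[OF w] tw by linarith
  have "(\<Sum>i<N. tilde (loc w i) (loc w i)) \<le> local_const * (M\<^sup>2 * tilde v v)"
    using local_stability[OF w] mult_left_mono[OF tw local_const_nonneg] by linarith
  then have "tilde p p + (\<Sum>i<N. tilde (loc w i) (loc w i))
      \<le> 2 * tilde v v + 2 * (M\<^sup>2 * tilde v v) + local_const * (M\<^sup>2 * tilde v v)" using tp by simp
  also have "\<dots> = lower_const * tilde v v"
    unfolding lower_const_def Let_def e_def[symmetric] M_def[symmetric] by (simp add: distrib_right)
  finally have "tilde p p + (\<Sum>i<N. tilde (loc w i) (loc w i)) \<le> lower_const * tilde v v" .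
  moreover have "v = p + (\<Sum>i<N. loc w i)" unfolding loc_sum[OF w] by (simp add: w_def)
  ultimately show ?thesis using pS loc_mem[OF w] by blast
qed

end

section \<open>Uniformity over meshes and coefficients\<close>

lemma tilde_gram_mat:
  "dt \<cdot>\<^sub>m gram_mat (a_form \<Omega> \<kappa>) bs + gram_mat (L2_form \<Omega>) bs = gram_mat (tilde_form \<Omega> \<kappa> dt) bs"
  by (rule eq_matI) (auto simp: gram_mat_def tilde_form_def)

text \<open>A coarse element contains a full-dimensional simplex, hence two distinct points. This
  provides \<open>0 < H\<close>, since \<open>H\<close> is defined from the mesh.\<close>

lemma (in mesh) mesh_size_pos:
  assumes "\<Omega> \<noteq> {}" "coarse_mesh \<T> N K"
  shows "0 < mesh_size (K ` {..<N})"
proof -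
  have c: "\<And>i. i < N \<Longrightarrow> K i \<noteq> {} \<and> K i = \<Union>{T\<in>\<T>. T \<subseteq> K i}" "(\<Union>i<N. K i) = \<Union>\<T>"
    using assms(2)[unfolded coarse_mesh_def, THEN conjunct1]
      assms(2)[unfolded coarse_mesh_def, THEN conjunct2, THEN conjunct2] by blast+
  have "0 < N" using c(2) assms(1) Omega_subset by (cases N) auto
  from c(1)[OF this] obtain T where T: "T \<in> \<T>" "T \<subseteq> K 0" by blast
  obtain x where "x \<in> interior T" using interior_T[OF T(1)] by blast
  then obtain r where r: "0 < r" "ball x r \<subseteq> T" by (auto simp: mem_interior)
  obtain b :: 'a where b: "b \<in> Basis" using nonempty_Basis by blast
  define y where "y = x + (r / 2) *\<^sub>R b"
  have d: "dist x y = r / 2" using b r by (simp add: y_def dist_norm)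
  have xy: "x \<in> K 0" "y \<in> K 0" using r d T(2) by (auto simp: subset_iff)
  have "K 0 \<subseteq> \<Union>\<T>" using c(2) \<open>0 < N\<close> by blast
  then have "bounded (K 0)" using compact_imp_bounded[OF compact_Union] bounded_subset by blast
  then have "dist x y \<le> diameter (K 0)" using xy by (rule diameter_bounded_bound)
  also have "\<dots> \<le> mesh_size (K ` {..<N})"
    unfolding mesh_size_def by (rule Max_ge) (use \<open>0 < N\<close> in auto)
  finally show ?thesis using d r by simp
qed

lemma AE_low_part_le:
  assumes "ess_max D \<kappa> < ereal \<kappa>0" "\<kappa>0 \<le> \<kappa>bar"
  shows "AE x in lebesgue_on D. \<kappa> x \<le> \<kappa>bar"
proof -
  have "AE x in lebesgue_on D. ereal (\<kappa> x) \<le> ess_max D \<kappa>" unfolding ess_max_def by (rule esssup_AE)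
  then show ?thesis
  proof eventually_elim
    case (elim x)
    then have "ereal (\<kappa> x) < ereal \<kappa>0" using assms(1) by (rule le_less_trans)
    then show ?case using assms(2) by simp
  qed
qed

theorem theorem6:
  fixes \<Omega> :: "'a::euclidean_space set"
    and \<kappa>min c\<^sub>t C\<^sub>t \<eta>bar \<kappa>bar C\<^sub>P C\<^sub>\<pi> C\<^sub>\<theta> C\<^sub>I \<epsilon>star :: real
    and N\<^sub>o\<^sub>v :: nat
  assumes dim: "DIM('a) = 2 \<or> DIM('a) = 3"
    and domain: "\<Omega> \<noteq> {}" "open \<Omega>" "connected \<Omega>" "bounded \<Omega>"
    and ct: "0 < c\<^sub>t" "c\<^sub>t \<le> C\<^sub>t"
    and \<epsilon>star: "\<epsilon>star < 1"
  shows "\<exists>C. \<forall>\<T> N K P \<kappa> \<kappa>max \<eta>0 \<kappa>0 layers \<theta> dt \<phi>hat \<epsilon>m bs cs ls.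
    (let H = mesh_size (K ` {..<N});
         \<omega> = (\<lambda>i. subdomain \<T> (layers i) (K i));
         \<phi> = multiscale_function \<Omega> \<T> \<kappa> H (Vaux N K P);
         VH1 = \<phi> ` fspace.span (aux_basis1 N P);
         VH2 = \<phi> ` fspace.span (aux_basis2 N K P);
         VH = {u + v |u v. u \<in> VH1 \<and> v \<in> VH2};
         VHhat = fspace.span (\<phi>hat ` (aux_basis1 N P \<union> aux_basis2 N K P));
         VHhat1 = fspace.span (\<phi>hat ` aux_basis1 N P);
         Tm = orth_proj (triple_form \<Omega> \<kappa> H dt) VHhat1;
         A = gram_mat (a_form \<Omega> \<kappa>) bs;
         M = gram_mat (L2_form \<Omega>) bs;
         Atilde = dt \<cdot>\<^sub>m A + M;
         R0T = inclusion_mat bs cs;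
         RT = (\<lambda>i. inclusion_mat bs (ls i));
         Q = additive_schwarz Atilde R0T (map RT [0..<N]) * Atilde
     in fine_mesh \<Omega> \<T> \<longrightarrow> coarse_mesh \<T> N K \<longrightarrow>
        coefficient \<Omega> \<kappa>min \<kappa>max \<kappa> \<longrightarrow>
        high_perm_components N K P \<kappa> H \<eta>0 \<kappa>0 C\<^sub>P \<longrightarrow> \<eta>0 \<le> \<eta>bar \<longrightarrow> \<kappa>0 \<le> \<kappa>bar \<longrightarrow>
        aux_approximation N K P \<kappa> H C\<^sub>\<pi> \<longrightarrow>
        (\<forall>i<N. 1 \<le> layers i) \<longrightarrow> overlapping_cover \<Omega> N \<omega> N\<^sub>o\<^sub>v \<longrightarrow>
        partition_of_unity \<Omega> \<T> N \<omega> \<theta> H C\<^sub>\<theta> \<longrightarrow> interp_stable \<Omega> \<T> \<kappa> H C\<^sub>I \<longrightarrow>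
        c\<^sub>t * H\<^sup>2 \<le> dt \<longrightarrow> dt \<le> C\<^sub>t * H\<^sup>2 \<longrightarrow>
        (\<forall>\<psi>\<in>aux_basis1 N P \<union> aux_basis2 N K P. \<phi>hat \<psi> \<in> Vh0 \<Omega> \<T>) \<longrightarrow>
        fspace.dim VH = fspace.dim VHhat \<longrightarrow>
        0 \<le> \<epsilon>m \<longrightarrow> \<epsilon>m \<le> \<epsilon>star \<longrightarrow>
        (\<forall>v\<in>VH1. form_norm (triple_form \<Omega> \<kappa> H dt) (v - Tm v)
                   \<le> \<epsilon>m * form_norm (tilde_form \<Omega> \<kappa> dt) v) \<longrightarrow>
        basis_list bs (Vh0 \<Omega> \<T>) \<longrightarrow> bs \<noteq> [] \<longrightarrow>
        basis_list cs VHhat1 \<longrightarrow> (\<forall>i<N. basis_list (ls i) (Vh0_local \<Omega> \<T> (\<omega> i))) \<longrightarrow>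
        0 < Min (spectrum Q) \<and> cond_number Q \<le> C)"
proof -
  \<comment> \<open>The constants are spelled out from data fixed before the existential quantifier;
    \<open>const\<close> below identifies them with those of the stable decomposition on each
    mesh.\<close>
  define c0 where "c0 = (let c = 1 + 1 / (\<kappa>min * c\<^sub>t); p = max 0 C\<^sub>\<pi> in
     2 * (1 + c * (2 * p + 1)) + 2 * ((1 / 2 + c * (p + 2)) * (C\<^sub>t * max 0 \<kappa>bar)))"
  define c1 where "c1 = C\<^sub>I\<^sup>2 * (2 + 2 * C\<^sub>\<theta>\<^sup>2 * real N\<^sub>o\<^sub>v + 1 / (\<kappa>min * c\<^sub>t))"
  define c2 where "c2 = (let M = 1 + 2 * sqrt c0 in 2 + 2 * M\<^sup>2 + c1 * M\<^sup>2)"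
  show ?thesis
    unfolding Let_def
  proof (intro exI[of _ "2 * max 1 (real N\<^sub>o\<^sub>v) * c2"] allI impI)
    fix \<T> :: "'a set set" and N :: nat and K :: "nat \<Rightarrow> 'a set" and P :: "nat \<Rightarrow> 'a set set"
      and \<kappa> :: "'a \<Rightarrow> real" and \<kappa>max \<eta>0 \<kappa>0 :: real and layers :: "nat \<Rightarrow> nat" and \<theta> :: "nat \<Rightarrow> 'a \<Rightarrow> real"
      and dt :: real and \<phi>hat :: "('a \<Rightarrow> real) \<Rightarrow> ('a \<Rightarrow> real)" and \<epsilon>m :: real
      and bs cs :: "('a \<Rightarrow> real) list" and ls :: "nat \<Rightarrow> ('a \<Rightarrow> real) list"
    let ?H = "mesh_size (K ` {..<N})"
    let ?\<omega> = "\<lambda>i. subdomain \<T> (layers i) (K i)"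
    let ?B1 = "aux_basis1 N P"
    let ?ms = "multiscale_function \<Omega> \<T> \<kappa> ?H (Vaux N K P)"
    let ?Vh1 = "fspace.span (\<phi>hat ` ?B1)"
    let ?Q = "additive_schwarz (dt \<cdot>\<^sub>m gram_mat (a_form \<Omega> \<kappa>) bs + gram_mat (L2_form \<Omega>) bs) (inclusion_mat bs cs)
        (map (\<lambda>i. inclusion_mat bs (ls i)) [0..<N]) * (dt \<cdot>\<^sub>m gram_mat (a_form \<Omega> \<kappa>) bs + gram_mat (L2_form \<Omega>) bs)"
    assume fm: "fine_mesh \<Omega> \<T>" and cm: "coarse_mesh \<T> N K" and co: "coefficient \<Omega> \<kappa>min \<kappa>max \<kappa>"
      and hp: "high_perm_components N K P \<kappa> ?H \<eta>0 \<kappa>0 C\<^sub>P" and \<kappa>0: "\<kappa>0 \<le> \<kappa>bar"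
      and ap: "aux_approximation N K P \<kappa> ?H C\<^sub>\<pi>"
      and cover: "overlapping_cover \<Omega> N ?\<omega> N\<^sub>o\<^sub>v"
      and pou: "partition_of_unity \<Omega> \<T> N ?\<omega> \<theta> ?H C\<^sub>\<theta>" and stable: "interp_stable \<Omega> \<T> \<kappa> ?H C\<^sub>I"
      and dt: "c\<^sub>t * ?H\<^sup>2 \<le> dt" "dt \<le> C\<^sub>t * ?H\<^sup>2"
      and \<phi>hat: "\<forall>\<psi>\<in>?B1 \<union> aux_basis2 N K P. \<phi>hat \<psi> \<in> Vh0 \<Omega> \<T>"
      and \<epsilon>: "0 \<le> \<epsilon>m" "\<epsilon>m \<le> \<epsilon>star"
      and Tm: "\<forall>v\<in>?ms ` fspace.span ?B1. form_norm (triple_form \<Omega> \<kappa> ?H dt)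
          (v - orth_proj (triple_form \<Omega> \<kappa> ?H dt) ?Vh1 v) \<le> \<epsilon>m * form_norm (tilde_form \<Omega> \<kappa> dt) v"
      and basis: "basis_list bs (Vh0 \<Omega> \<T>)" "bs \<noteq> []" and cs: "basis_list cs ?Vh1"
      and ls: "\<forall>i<N. basis_list (ls i) (Vh0_local \<Omega> \<T> (?\<omega> i))"
    interpret mesh \<Omega> \<T> by (rule mesh.intro[OF fm])
    have H: "0 < ?H" by (rule mesh_size_pos[OF domain(1) cm])
    have P: "finite (P i)" "\<And>D. D \<in> P i \<Longrightarrow> open D" "\<And>D. D \<in> P i \<Longrightarrow> D \<subseteq> K i"
      "ess_max (low_part K P i) \<kappa> < ereal \<kappa>0" if "i < N" for i
      using hp that unfolding high_perm_components_def by blast+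
    interpret two_level \<Omega> \<T> \<kappa> \<kappa>min \<kappa>max ?H N K P C\<^sub>\<pi> \<kappa>bar bs layers \<theta> N\<^sub>o\<^sub>v C\<^sub>\<theta> C\<^sub>I dt c\<^sub>t C\<^sub>t
      by unfold_locales (use co H cm P AE_low_part_le[OF P(4) \<kappa>0] ap basis(1) cover pou stable ct(1) dt in blast)+
    have Bh: "finite (\<phi>hat ` ?B1)" "\<phi>hat ` ?B1 \<subseteq> Vh0 \<Omega> \<T>" using finite_B1 \<phi>hat by auto
    have span: "?Vh1 \<subseteq> Vh0 \<Omega> \<T>" using t.mem_span[OF Bh(2)] by blast
    interpret S: schwarz_spaces "Vh0 \<Omega> \<T>" "tilde_form \<Omega> \<kappa> dt" bs cs ls ?Vh1
      "\<lambda>i. Vh0_local \<Omega> \<T> (?\<omega> i)" N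
      "additive_schwarz (gram_mat (tilde_form \<Omega> \<kappa> dt) bs) (inclusion_mat bs cs)
        (map (\<lambda>i. inclusion_mat bs (ls i)) [0..<N]) * gram_mat (tilde_form \<Omega> \<kappa> dt) bs"
      by unfold_locales (use basis(1) cs span ls Vh0_local_subset in auto)
    have const: "lower_const = c2"
      unfolding lower_const_def coarse_const_def local_const_def c2_def c1_def c0_def ..
    have up: "tilde (u0 + (\<Sum>i<N. u i)) (u0 + (\<Sum>i<N. u i))
        \<le> 2 * max 1 (real N\<^sub>o\<^sub>v) * (tilde u0 u0 + (\<Sum>i<N. tilde (u i) (u i)))"
      if "u0 \<in> ?Vh1" "\<And>i. i < N \<Longrightarrow> u i \<in> Vh0_local \<Omega> \<T> (?\<omega> i)" for u0 u
      by (rule overlap_bound) (use that span in auto)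
    have lo: "\<exists>u0 u. u0 \<in> ?Vh1 \<and> (\<forall>i<N. u i \<in> Vh0_local \<Omega> \<T> (?\<omega> i)) \<and> v = u0 + (\<Sum>i<N. u i) \<and>
        tilde u0 u0 + (\<Sum>i<N. tilde (u i) (u i)) \<le> c2 * tilde v v" if "v \<in> Vh0 \<Omega> \<T>" for v
      unfolding const[symmetric]
      by (rule stable_decomposition[OF Bh \<epsilon>(1) _ _ that]) (use \<epsilon> \<epsilon>star Tm in auto)
    have "0 < c2" using lower_const_pos const by simp
    from S.cond_number_bound[OF basis(2) up lo this]
    show "0 < Min (spectrum ?Q) \<and> cond_number ?Q \<le> 2 * max 1 (real N\<^sub>o\<^sub>v) * c2"
      unfolding tilde_gram_mat by blast
  qed
qed

end
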